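(* Let $n,\bar n \geq 0$ be integers, let $A \in GL_n(\mathbb{Q})$ and $\bar A \in GL_{\bar n}(\mathbb{Q})$, and let $L \leq \mathbb{Z}^n \cap A^{-1}(\mathbb{Z}^n)$ and $\bar L \leq \mathbb{Z}^{\bar n} \cap \bar A^{-1}(\mathbb{Z}^{\bar n})$ be finite index subgroups. Suppose that $G(A,L)$ is not metabelian and that it is isomorphic to $G(\bar A,\bar L)$. Then there exist a group isomorphism $\Phi\colon G(A,L) \to G(\bar A,\bar L)$ and an isomorphism of trees $\xi\colon T(A,L) \to T(\bar A,\bar L)$ such that $\Phi(g)\cdot\xi(y) = \xi(g\cdot y)$ for all $g \in G(A,L)$ and $y \in T(A,L)$.
   Context: For $n \geq 0$, $A \in GL_n(\mathbb{Q})$ and a finite index subgroup $L$ of $\mathbb{Z}^n \cap A^{-1}(\mathbb{Z}^n)$, the Leary--Minasyan group $G(A,L)$ is the group with presentation $$G(A,L) = \langle x_1,\ldots,x_n,t \mid [x_i,x_j]=1 \text{ for } 1 \leq i<j \leq n,\ t\mathbf{x}^{\mathbf{v}}t^{-1} = \mathbf{x}^{A\mathbf{v}} \text{ for } \mathbf{v} \in L\rangle,$$ where $\mathbf{x}^{\mathbf{w}} := x_1^{w_1}\cdots x_n^{w_n}$ for $\mathbf{w}=(w_1,\ldots,w_n) \in \mathbb{Z}^n$. It is an HNN-extension of $H = \langle x_1,\ldots,x_n\rangle \cong \mathbb{Z}^n$, and $\mathbb{Z}^n$ (hence $L$) is identified with a subgroup of $G(A,L)$ via $\mathbf{v}\mapsto\mathbf{x}^{\mathbf{v}}$.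 $T(A,L)$ denotes the Bass--Serre tree of this HNN-extension: its vertices are the left cosets $gH$, its edges are the left cosets $gL$ ($g \in G(A,L)$), the edge $gL$ is incident to the vertices $gH$ and $gt^{-1}H$, and $G(A,L)$ acts by left multiplication. A group $G$ is metabelian if it has a normal subgroup $K$ with $K$ and $G/K$ abelian. An isomorphism of trees is a graph isomorphism (not required to respect any edge orientation). *)

theory Defs
  imports "Jordan_Normal_Form.Matrix" "HOL-Algebra.Coset" "HOL-Algebra.Generated_Groups"
begin

section \<open>Group presentations\<close>

text \<open>A word is a list of letters \<open>(a, e)\<close>, standing for \<open>a\<close> if \<open>e\<close> is \<open>True\<close> and for
  the inverse of \<open>a\<close> if \<open>e\<close> is \<open>False\<close>. A pair \<open>(u, v)\<close> in \<open>R\<close> is the relation \<open>u = v\<close>.\<close>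

type_synonym 'a word = "('a \<times> bool) list"

definition words :: "'a set \<Rightarrow> 'a word set" where
  "words S = lists (S \<times> UNIV)"

inductive_set pres_rel :: "'a set \<Rightarrow> ('a word \<times> 'a word) set \<Rightarrow> ('a word \<times> 'a word) set"
  for S R where
  pres_refl: "w \<in> words S \<Longrightarrow> (w, w) \<in> pres_rel S R"
| pres_sym: "(u, v) \<in> pres_rel S R \<Longrightarrow> (v, u) \<in> pres_rel S R"
| pres_trans: "(u, v) \<in> pres_rel S R \<Longrightarrow> (v, w) \<in> pres_rel S R \<Longrightarrow> (u, w) \<in> pres_rel S R"
| pres_append: "(u, u') \<in> pres_rel S R \<Longrightarrow> (v, v') \<in> pres_rel S R
    \<Longrightarrow> (u @ v, u' @ v') \<in> pres_rel S R"
| pres_cancel: "a \<in> S \<Longrightarrow> ([(a, e), (a, \<not> e)], []) \<in> pres_rel S R"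
| pres_relator: "(u, v) \<in> R \<Longrightarrow> u \<in> words S \<Longrightarrow> v \<in> words S \<Longrightarrow> (u, v) \<in> pres_rel S R"

definition pres_class :: "'a set \<Rightarrow> ('a word \<times> 'a word) set \<Rightarrow> 'a word \<Rightarrow> 'a word set" where
  "pres_class S R w = pres_rel S R `` {w}"

definition presented_group :: "'a set \<Rightarrow> ('a word \<times> 'a word) set \<Rightarrow> 'a word set monoid" where
  "presented_group S R = \<lparr>
     carrier = words S // pres_rel S R,
     mult = (\<lambda>C D. \<Union>u\<in>C. \<Union>v\<in>D. pres_class S R (u @ v)),
     one = pres_class S R []\<rparr>"

lemma pres_rel_words: "(u, v) \<in> pres_rel S R \<Longrightarrow> u \<in> words S \<and> v \<in> words S"
  by (induction rule: pres_rel.induct) (auto simp: words_def)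

lemma equiv_pres_rel: "equiv (words S) (pres_rel S R)"
proof (rule equivI)
  show "pres_rel S R \<subseteq> words S \<times> words S" by (auto dest: pres_rel_words)
  show "refl_on (words S) (pres_rel S R)" by (rule refl_onI) (rule pres_refl)
  show "sym (pres_rel S R)" by (rule symI) (rule pres_sym)
  show "trans (pres_rel S R)" by (rule transI) (rule pres_trans)
qed

lemma pres_class_eq_iff:
  assumes "u \<in> words S" "v \<in> words S"
  shows "pres_class S R u = pres_class S R v \<longleftrightarrow> (u, v) \<in> pres_rel S R"
  unfolding pres_class_def using eq_equiv_class_iff[OF equiv_pres_rel assms] .

lemma carrier_presented_group: "carrier (presented_group S R) = pres_class S R ` words S"
  by (auto simp: presented_group_def quotient_def pres_class_def)

lemma mult_presented_group:
  assumes "u \<in> words S" "v \<in> words S"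
  shows "pres_class S R u \<otimes>\<^bsub>presented_group S R\<^esub> pres_class S R v = pres_class S R (u @ v)"
proof -
  have "pres_class S R (u' @ v') = pres_class S R (u @ v)"
    if "u' \<in> pres_class S R u" "v' \<in> pres_class S R v" for u' v'
  proof -
    have "(u @ v, u' @ v') \<in> pres_rel S R"
      using that by (auto simp: pres_class_def intro: pres_append)
    thus ?thesis
      unfolding pres_class_def by (rule equiv_class_eq[OF equiv_pres_rel, symmetric])
  qed
  moreover have "u \<in> pres_class S R u" "v \<in> pres_class S R v"
    using assms by (auto simp: pres_class_def intro: pres_refl)
  ultimately have "(\<Union>u'\<in>pres_class S R u. \<Union>v'\<in>pres_class S R v. pres_class S R (u' @ v'))
      = pres_class S R (u @ v)"
    by blast
  thus ?thesis by (simp add: presented_group_def)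
qed

definition inv_word :: "'a word \<Rightarrow> 'a word" where
  "inv_word w = rev (map (\<lambda>(a, e). (a, \<not> e)) w)"

lemma inv_word_words: "w \<in> words S \<Longrightarrow> inv_word w \<in> words S"
  by (auto simp: inv_word_def words_def)

lemma inv_word_append: "w \<in> words S \<Longrightarrow> (inv_word w @ w, []) \<in> pres_rel S R"
proof (induction w)
  case Nil
  then show ?case by (simp add: inv_word_def pres_refl)
next
  case (Cons l w)
  obtain a e where l: "l = (a, e)" by (cases l)
  have w: "w \<in> words S" and a: "a \<in> S" using Cons.prems l by (auto simp: words_def)
  have "([(a, \<not> e), (a, \<not> \<not> e)] @ w, [] @ w) \<in> pres_rel S R"
    by (intro pres_append pres_cancel pres_refl a w)
  from pres_append[OF pres_refl[OF inv_word_words[OF w]] this]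
  have "(inv_word (l # w) @ l # w, inv_word w @ w) \<in> pres_rel S R"
    by (simp add: inv_word_def l)
  then show ?case using Cons.IH[OF w] by (rule pres_trans)
qed

lemma group_presented_group: "group (presented_group S R)"
proof (rule groupI)
  have nil: "[] \<in> words S" and app: "\<And>u v. u \<in> words S \<Longrightarrow> v \<in> words S \<Longrightarrow> u @ v \<in> words S"
    by (auto simp: words_def)
  have one: "\<one>\<^bsub>presented_group S R\<^esub> = pres_class S R []" by (simp add: presented_group_def)
  show "\<one>\<^bsub>presented_group S R\<^esub> \<in> carrier (presented_group S R)"
    by (simp add: one carrier_presented_group nil)
  fix x y z
  assume x: "x \<in> carrier (presented_group S R)"
  show "\<one>\<^bsub>presented_group S R\<^esub> \<otimes>\<^bsub>presented_group S R\<^esub> x = x"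
    using x by (auto simp: one carrier_presented_group mult_presented_group nil)
  show "\<exists>y\<in>carrier (presented_group S R). y \<otimes>\<^bsub>presented_group S R\<^esub> x = \<one>\<^bsub>presented_group S R\<^esub>"
  proof -
    from x obtain w where w: "w \<in> words S" "x = pres_class S R w"
      by (auto simp: carrier_presented_group)
    hence "pres_class S R (inv_word w) \<otimes>\<^bsub>presented_group S R\<^esub> x = \<one>\<^bsub>presented_group S R\<^esub>"
      by (simp add: one mult_presented_group inv_word_words pres_class_eq_iff app nil inv_word_append)
    thus ?thesis using inv_word_words[OF w(1)] by (auto simp: carrier_presented_group)
  qed
  assume y: "y \<in> carrier (presented_group S R)"
  show "x \<otimes>\<^bsub>presented_group S R\<^esub> y \<in> carrier (presented_group S R)"
    using x y by (auto simp: carrier_presented_group mult_presented_group app)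
  assume z: "z \<in> carrier (presented_group S R)"
  show "x \<otimes>\<^bsub>presented_group S R\<^esub> y \<otimes>\<^bsub>presented_group S R\<^esub> z
      = x \<otimes>\<^bsub>presented_group S R\<^esub> (y \<otimes>\<^bsub>presented_group S R\<^esub> z)"
    using x y z by (auto simp: carrier_presented_group mult_presented_group app)
qed

definition metabelian :: "('a, 'b) monoid_scheme \<Rightarrow> bool" where
  "metabelian G \<longleftrightarrow> (\<exists>K. K \<lhd> G \<and> comm_group (G\<lparr>carrier := K\<rparr>) \<and> comm_group (G Mod K))"

definition finite_index_subgroup :: "'a set \<Rightarrow> ('a, 'b) monoid_scheme \<Rightarrow> bool" where
  "finite_index_subgroup L G \<longleftrightarrow> subgroup L G \<and> finite (rcosets\<^bsub>G\<^esub> L)"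


section \<open>Leary--Minasyan groups\<close>

abbreviation int_to_rat_vec :: "int vec \<Rightarrow> rat vec" where
  "int_to_rat_vec \<equiv> map_vec rat_of_int"

text \<open>The group \<open>\<int>\<^sup>n \<inter> A\<^sup>-\<^sup>1(\<int>\<^sup>n)\<close>, for an \<open>n \<times> n\<close> matrix \<open>A\<close>.\<close>

definition lm_lattice :: "rat mat \<Rightarrow> int vec monoid" where
  "lm_lattice A = (monoid_vec TYPE(int) (dim_row A))
     \<lparr>carrier := {v \<in> carrier_vec (dim_row A).
        \<exists>w \<in> carrier_vec (dim_row A). A *\<^sub>v int_to_rat_vec v = int_to_rat_vec w}\<rparr>"

text \<open>The generators \<open>x\<^sub>1, \<dots>, x\<^sub>n\<close> are \<open>LM_x 0, \<dots>, LM_x (n - 1)\<close>.\<close>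

datatype lm_gen = LM_x nat | LM_t

definition lm_gens :: "nat \<Rightarrow> lm_gen set" where
  "lm_gens n = insert LM_t (LM_x ` {..<n})"

definition x_word :: "int vec \<Rightarrow> lm_gen word" where
  "x_word w = concat (map (\<lambda>i. replicate (nat \<bar>w $ i\<bar>) (LM_x i, w $ i \<ge> 0)) [0..<dim_vec w])"

definition lm_relations :: "rat mat \<Rightarrow> int vec set \<Rightarrow> (lm_gen word \<times> lm_gen word) set" where
  "lm_relations A L =
     {([(LM_x i, True), (LM_x j, True), (LM_x i, False), (LM_x j, False)], []) | i j.
        i < j \<and> j < dim_row A} \<union>
     {([(LM_t, True)] @ x_word v @ [(LM_t, False)], x_word w) | v w.
        v \<in> L \<and> w \<in> carrier_vec (dim_row A) \<and> A *\<^sub>v int_to_rat_vec v = int_to_rat_vec w}"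

definition LM_group :: "rat mat \<Rightarrow> int vec set \<Rightarrow> lm_gen word set monoid" where
  "LM_group A L = presented_group (lm_gens (dim_row A)) (lm_relations A L)"

definition lm_class :: "rat mat \<Rightarrow> int vec set \<Rightarrow> lm_gen word \<Rightarrow> lm_gen word set" where
  "lm_class A L = pres_class (lm_gens (dim_row A)) (lm_relations A L)"

definition LM_H :: "rat mat \<Rightarrow> int vec set \<Rightarrow> lm_gen word set set" where
  "LM_H A L = generate (LM_group A L) ((\<lambda>i. lm_class A L [(LM_x i, True)]) ` {..<dim_row A})"

definition LM_L :: "rat mat \<Rightarrow> int vec set \<Rightarrow> lm_gen word set set" where
  "LM_L A L = (\<lambda>v. lm_class A L (x_word v)) ` L"


section \<open>The Bass--Serre tree\<close>

text \<open>Vertices and edges are kept apart, also when their types agree: for \<open>L = \<int>\<^sup>n\<close> the same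
  coset is both a vertex and an edge of the Bass--Serre tree.\<close>

record ('v, 'e) graph =
  verts :: "'v set"
  edges :: "'e set"
  incident :: "'e \<Rightarrow> 'v \<Rightarrow> bool"

definition graph_iso ::
  "('v, 'e) graph \<Rightarrow> ('w, 'f) graph \<Rightarrow> ('v \<Rightarrow> 'w) \<Rightarrow> ('e \<Rightarrow> 'f) \<Rightarrow> bool" where
  "graph_iso T T' f h \<longleftrightarrow> bij_betw f (verts T) (verts T') \<and> bij_betw h (edges T) (edges T') \<and>
     (\<forall>e\<in>edges T. \<forall>v\<in>verts T. incident T' (h e) (f v) \<longleftrightarrow> incident T e v)"

definition LM_tree ::
  "rat mat \<Rightarrow> int vec set \<Rightarrow> (lm_gen word set set, lm_gen word set set) graph" where
  "LM_tree A L =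
    (let G = LM_group A L; H = LM_H A L; M = LM_L A L; t = lm_class A L [(LM_t, True)] in
     \<lparr>verts = {g <#\<^bsub>G\<^esub> H | g. g \<in> carrier G},
      edges = {g <#\<^bsub>G\<^esub> M | g. g \<in> carrier G},
      incident = (\<lambda>e v. \<exists>g\<in>carrier G. e = g <#\<^bsub>G\<^esub> M \<and>
        (v = g <#\<^bsub>G\<^esub> H \<or> v = (g \<otimes>\<^bsub>G\<^esub> inv\<^bsub>G\<^esub> t) <#\<^bsub>G\<^esub> H))\<rparr>)"

end

(* Write H = Z^n for the vertex group and L, M for the two edge groups of the HNN extension G(A,L).
   If L = H or M = H, the kernel of the degree map G(A,L) -> Z is abelian and G(A,L) is
   metabelian; so all edge groups are proper. An abelian subgroup U commensurated by G(A,L)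
   contains no hyperbolic element u: some power of u would commute with every given conjugate of
   u, and Britton's lemma forbids this for a suitable conjugate. Hence a finitely generated such
   U is conjugate into H. Applied to both groups, this lets us assume that the isomorphism
   \<Phi> maps H onto H'.

   The degree (killing H) is then preserved up to a sign, which we absorb by exchanging t and
   t^-1. If g has degree 1, v and g v g^-1 lie in H, then v lies in L, because the suffixes of a
   reduced word for g pass from degree 0 to degree 1 at some letter t, and conjugation by an
   element of degree 0 is trivial on H wherever it stays in H. This makes L intrinsic, so that
   \<Phi> maps L onto L' and intertwines the conjugations by t and t'. Now t \<mapsto> t'
   together with \<Phi> on H defines another isomorphism, which visibly maps cosets of H and L
   to cosets of H' and L'. *)

theory Submission
  imports Defs "HOL-Library.Function_Algebras"
begin

section \<open>Conjugation\<close>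

text \<open>The isomorphism produced at the end is in general not the given one. An isomorphism that
  maps \<open>H\<close> onto \<open>H'\<close> may still send \<open>t\<close> to the product of
  \<open>t'\<close> with a nontrivial element of degree 0, and then the endpoint
  \<open>g t^-1 H\<close> of an edge need not go to an endpoint of the image edge. What survives is
  the effect on \<open>H\<close>; the stable letter is reassigned by the universal property. Two
  assumptions of the locale \<open>hnn\<close> carry the arithmetic. Finite index enters as
  \<open>D_power\<close>: each element of \<open>H\<close> has a power in each edge group, which
  makes \<open>H\<close> commensurated. The matrix enters as \<open>deg_zero_conj\<close>: the group
  acts on Q^n by affine maps, and the linear part of an element depends only on its degree.
  Britton's lemma comes from an action of the presented group on normal forms. The lemmas about
  \<open>hnn\<close> are applied to an isomorphism and to its inverse, so that one-sided inclusions
  between vertex groups and between edge groups become equalities.\<close>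

context group
begin

lemma inv_cancel [simp]:
  assumes "x \<in> carrier G" "y \<in> carrier G"
  shows "inv x \<otimes> (x \<otimes> y) = y" "x \<otimes> (inv x \<otimes> y) = y"
  using assms by (simp_all flip: m_assoc)

definition conj :: "'a \<Rightarrow> 'a \<Rightarrow> 'a" where
  "conj g x = g \<otimes> x \<otimes> inv g"

lemma conj_closed [simp]: "g \<in> carrier G \<Longrightarrow> x \<in> carrier G \<Longrightarrow> conj g x \<in> carrier G"
  by (simp add: conj_def)

lemma conj_one [simp]: "x \<in> carrier G \<Longrightarrow> conj \<one> x = x"
  by (simp add: conj_def)

lemma conj_conj:
  "g \<in> carrier G \<Longrightarrow> h \<in> carrier G \<Longrightarrow> x \<in> carrier G \<Longrightarrow> conj g (conj h x) = conj (g \<otimes> h) x"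
  by (simp add: conj_def m_assoc inv_mult_group)

lemma conj_conj_conj:
  "\<lbrakk>g \<in> carrier G; h \<in> carrier G; k \<in> carrier G; x \<in> carrier G\<rbrakk>
    \<Longrightarrow> conj (g \<otimes> h \<otimes> k) x = conj g (conj h (conj k x))"
  by (simp add: conj_conj m_assoc)

lemma conj_mult:
  "g \<in> carrier G \<Longrightarrow> x \<in> carrier G \<Longrightarrow> y \<in> carrier G \<Longrightarrow> conj g (x \<otimes> y) = conj g x \<otimes> conj g y"
  by (simp add: conj_def m_assoc)

lemma conj_inv: "g \<in> carrier G \<Longrightarrow> x \<in> carrier G \<Longrightarrow> conj g (inv x) = inv (conj g x)"
  by (simp add: conj_def m_assoc inv_mult_group)

lemma conj_of_one [simp]: "g \<in> carrier G \<Longrightarrow> conj g \<one> = \<one>"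
  by (simp add: conj_def)

lemma conj_pow:
  "g \<in> carrier G \<Longrightarrow> x \<in> carrier G \<Longrightarrow> conj g (x [^] (k::nat)) = conj g x [^] k"
  by (induction k) (simp_all add: conj_mult)

lemma conj_inv_cancel [simp]:
  assumes "g \<in> carrier G" "x \<in> carrier G"
  shows "conj (inv g) (conj g x) = x" "conj g (conj (inv g) x) = x"
  using assms by (simp_all add: conj_conj)

lemma conj_commute_eq:
  "g \<in> carrier G \<Longrightarrow> x \<in> carrier G \<Longrightarrow> g \<otimes> x = x \<otimes> g \<Longrightarrow> conj g x = x"
  by (simp add: conj_def m_assoc)

lemma commute_conj:
  assumes "g \<in> carrier G" "x \<in> carrier G" "y \<in> carrier G"
  shows "conj g x \<otimes> conj g y = conj g y \<otimes> conj g x \<longleftrightarrow> x \<otimes> y = y \<otimes> x"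
  by (metis assms conj_mult conj_inv_cancel(1) m_closed)

text \<open>The claim is strengthened to "left multiplication by \<open>g\<close> preserves
  \<open>P\<close>". This form is closed under products, so ordinary induction over
  \<open>generate\<close> applies, and evaluating at the unit gives the result.\<close>

lemma generate_induct_left [consumes 2, case_names one mult inv_mult]:
  assumes "g \<in> generate G S" "S \<subseteq> carrier G" "P \<one>"
    and "\<And>s g. s \<in> S \<Longrightarrow> g \<in> carrier G \<Longrightarrow> P g \<Longrightarrow> P (s \<otimes> g)"
    and "\<And>s g. s \<in> S \<Longrightarrow> g \<in> carrier G \<Longrightarrow> P g \<Longrightarrow> P (inv s \<otimes> g)"
  shows "P g"
proof -
  have "\<forall>x \<in> carrier G. P x \<longrightarrow> P (g \<otimes> x)"
    using assms(1)
  proof induction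
    case (eng h1 h2)
    have "h1 \<in> carrier G" "h2 \<in> carrier G"
      using eng.hyps generate_in_carrier[OF assms(2)] by auto
    with eng.IH show ?case by (simp add: m_assoc)
  qed (use assms(2-5) in auto)
  moreover have "g \<in> carrier G" using assms(1,2) generate_in_carrier by blast
  ultimately show ?thesis using assms(3) by (metis one_closed r_one)
qed

text \<open>The witness is the derived subgroup: its quotient is abelian, and it is itself
  commutative because \<open>d\<close> vanishes on commutators.\<close>

lemma metabelian_of_degree:
  fixes d :: "'a \<Rightarrow> int"
  assumes add: "\<And>x y. x \<in> carrier G \<Longrightarrow> y \<in> carrier G \<Longrightarrow> d (x \<otimes> y) = d x + d y"
    and ker: "\<And>x y. \<lbrakk>x \<in> carrier G; y \<in> carrier G; d x = 0; d y = 0\<rbrakk> \<Longrightarrow> x \<otimes> y = y \<otimes> x"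
  shows "metabelian G"
proof -
  let ?K = "derived G (carrier G)"
  have one: "d \<one> = 0" using add[of \<one> \<one>] by simp
  have dinv: "d (inv x) = - d x" if "x \<in> carrier G" for x
    using add[of x "inv x"] that one by simp
  have sub: "?K \<subseteq> carrier G" by (simp add: derived_in_carrier)
  have zero: "d x = 0" if "x \<in> ?K" for x
  proof (rule generate_induct_left[of x "derived_set G (carrier G)"])
    show "x \<in> generate G (derived_set G (carrier G))" using that by (simp add: derived_def)
    show "derived_set G (carrier G) \<subseteq> carrier G" by (simp add: derived_set_in_carrier)
    show "d \<one> = 0" by (rule one)
  qed (auto simp: add dinv)
  have K: "?K \<lhd> G" by (rule derived_is_normal[OF normal_self])
  interpret K: subgroup ?K G using K by (simp add: normal_def)
  have "comm_group (G\<lparr>carrier := ?K\<rparr>)"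
    by (rule group.group_comm_groupI[OF K.subgroup_is_group]) (use sub zero ker in auto)
  thus ?thesis
    using K derived_quot_is_comm_group unfolding metabelian_def by blast
qed

end

section \<open>Reduced words in an HNN extension of an abelian group\<close>

text \<open>The Boolean index treats \<open>t\<close> and \<open>inv t\<close> alike:
  \<open>D True\<close> and \<open>D False\<close> are the two edge groups, and conjugation by
  \<open>stable e\<close> carries \<open>D e\<close> to \<open>D (\<not> e)\<close>. The locale
  supports only the rewriting of words; that a reduced word stays outside \<open>H\<close> is added
  in \<open>hnn\<close>.\<close>

locale hnn_words = group G for G :: "'a monoid" (structure) +
  fixes H :: "'a set" and D :: "bool \<Rightarrow> 'a set" and t :: 'a
  assumes H_subgroup: "subgroup H G"
    and H_comm: "\<And>x y. x \<in> H \<Longrightarrow> y \<in> H \<Longrightarrow> x \<otimes> y = y \<otimes> x"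
    and D_subgroup: "subgroup (D e) G"
    and D_le: "D e \<subseteq> H"
    and t_closed [simp]: "t \<in> carrier G"
    and t_conj: "x \<in> D True \<Longrightarrow> conj t x \<in> D False"
    and t_conj_inv: "x \<in> D False \<Longrightarrow> conj (inv t) x \<in> D True"
    and carrier_gen: "carrier G = generate G (insert t H)"
begin

definition stable :: "bool \<Rightarrow> 'a" where
  "stable e = (if e then t else inv t)"

lemma stable_closed [simp]: "stable e \<in> carrier G"
  by (simp add: stable_def)

lemma inv_stable [simp]: "inv (stable e) = stable (\<not> e)"
  by (simp add: stable_def)

lemma stable_cancel [simp]:
  "stable e \<otimes> stable (\<not> e) = \<one>" "stable (\<not> e) \<otimes> stable e = \<one>"
  by (simp_all add: stable_def)

lemma stable_cancel_left [simp]: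
  "g \<in> carrier G \<Longrightarrow> stable e \<otimes> (stable (\<not> e) \<otimes> g) = g"
  "g \<in> carrier G \<Longrightarrow> stable (\<not> e) \<otimes> (stable e \<otimes> g) = g"
  by (simp_all flip: m_assoc)

lemma stable_conj: "x \<in> D e \<Longrightarrow> conj (stable e) x \<in> D (\<not> e)"
  by (cases e) (simp_all add: stable_def t_conj t_conj_inv)

lemma H_closed [simp]: "x \<in> H \<Longrightarrow> x \<in> carrier G"
  by (rule subgroup.mem_carrier[OF H_subgroup])

lemma H_one [simp]: "\<one> \<in> H"
  by (rule subgroup.one_closed[OF H_subgroup])

lemma H_mult [simp]: "x \<in> H \<Longrightarrow> y \<in> H \<Longrightarrow> x \<otimes> y \<in> H"
  by (rule subgroup.m_closed[OF H_subgroup])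

lemma H_inv [simp]: "x \<in> H \<Longrightarrow> inv x \<in> H"
  by (rule subgroup.m_inv_closed[OF H_subgroup])

lemma H_conj [simp]: "x \<in> H \<Longrightarrow> y \<in> H \<Longrightarrow> conj x y = y"
  by (simp add: conj_commute_eq H_comm)

lemma D_H: "x \<in> D e \<Longrightarrow> x \<in> H"
  using D_le by blast

lemma D_closed [simp]: "x \<in> D e \<Longrightarrow> x \<in> carrier G"
  using D_H by auto

lemma D_inv_iff [simp]: "x \<in> carrier G \<Longrightarrow> inv x \<in> D e \<longleftrightarrow> x \<in> D e"
  by (metis D_subgroup inv_inv subgroup.m_inv_closed)

lemma carrier_induct [consumes 1, case_names one H stable]:
  assumes "g \<in> carrier G" "P \<one>"
    and "\<And>h g. h \<in> H \<Longrightarrow> g \<in> carrier G \<Longrightarrow> P g \<Longrightarrow> P (h \<otimes> g)"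
    and "\<And>e g. g \<in> carrier G \<Longrightarrow> P g \<Longrightarrow> P (stable e \<otimes> g)"
  shows "P g"
proof (rule generate_induct_left)
  show "g \<in> generate G (insert t H)" using assms(1) carrier_gen by simp
  show "insert t H \<subseteq> carrier G" by auto
  show "P (s \<otimes> g)" if "s \<in> insert t H" "g \<in> carrier G" "P g" for s g
    using that assms(3)[of s g] assms(4)[of g True] by (auto simp: stable_def)
  show "P (inv s \<otimes> g)" if "s \<in> insert t H" "g \<in> carrier G" "P g" for s g
    using that assms(3)[of "inv s" g] assms(4)[of g False] by (auto simp: stable_def)
qed (rule assms)

text \<open>\<open>red n a b g\<close>: \<open>g\<close> is the value of a reduced word with \<open>n + 1\<close> stable letters that begins with
  \<open>stable a\<close> and ends with \<open>stable b\<close>.\<close>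

inductive red :: "nat \<Rightarrow> bool \<Rightarrow> bool \<Rightarrow> 'a \<Rightarrow> bool" where
  red_stable: "red 0 a a (stable a)"
| red_step: "\<lbrakk>red n a b g; h \<in> H; a = (\<not> c) \<Longrightarrow> h \<notin> D c\<rbrakk> \<Longrightarrow> red (Suc n) c b (stable c \<otimes> h \<otimes> g)"

lemma red_closed [simp]: "red n a b g \<Longrightarrow> g \<in> carrier G"
  by (induction rule: red.induct) auto

lemma red_concat:
  assumes "red n a b g" "red m c d k" "h \<in> H" "c = (\<not> b) \<Longrightarrow> h \<notin> D b"
  shows "red (Suc (n + m)) a d (g \<otimes> h \<otimes> k)"
  using assms
proof (induction rule: red.induct)
  case (red_stable a)
  then show ?case by (auto intro: red_step)
next
  case (red_step n a b g h' e)
  have "red (Suc (Suc (n + m))) e d (stable e \<otimes> h' \<otimes> (g \<otimes> h \<otimes> k))"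
    using red_step by (intro red.red_step) auto
  moreover have "stable e \<otimes> h' \<otimes> (g \<otimes> h \<otimes> k) = stable e \<otimes> h' \<otimes> g \<otimes> h \<otimes> k"
    using red_step by (simp add: m_assoc)
  ultimately show ?case by simp
qed

lemma red_inv: "red n a b g \<Longrightarrow> red n (\<not> b) (\<not> a) (inv g)"
proof (induction rule: red.induct)
  case (red_stable a)
  then show ?case using red.red_stable[of "\<not> a"] by simp
next
  case (red_step n a b g h c)
  have "red (Suc (n + 0)) (\<not> b) (\<not> c) (inv g \<otimes> inv h \<otimes> stable (\<not> c))"
    using red_step by (intro red_concat[OF red_step.IH red.red_stable]) auto
  moreover have "inv (stable c \<otimes> h \<otimes> g) = inv g \<otimes> inv h \<otimes> stable (\<not> c)"
    using red_step by (simp add: inv_mult_group m_assoc)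
  ultimately show ?case by simp
qed

lemma red_exists:
  assumes "g \<in> carrier G"
  shows "g \<in> H \<or> (\<exists>n a b h g' k. h \<in> H \<and> k \<in> H \<and> red n a b g' \<and> g = h \<otimes> g' \<otimes> k)"
  using assms
proof (induction rule: carrier_induct)
  case one
  then show ?case by simp
next
  case (H x g)
  then consider "g \<in> H" | n a b h g' k where "h \<in> H" "k \<in> H" "red n a b g'" "g = h \<otimes> g' \<otimes> k"
    by blast
  then show ?case
  proof cases
    case 2
    hence "x \<otimes> g = (x \<otimes> h) \<otimes> g' \<otimes> k" using H by (simp add: m_assoc)
    then show ?thesis using 2 H(1) H_mult by blast
  qed (use H in auto)
next
  case (stable c g)
  from stable.IH consider "g \<in> H"
    | n a b h g' k where "h \<in> H" "k \<in> H" "red n a b g'" "g = h \<otimes> g' \<otimes> k" by blast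
  then show ?case
  proof cases
    case 1
    hence "stable c \<otimes> g = \<one> \<otimes> stable c \<otimes> g" by simp
    then show ?thesis using 1 H_one red_stable by blast
  next
    case 2
    show ?thesis
    proof (cases "a = (\<not> c) \<and> h \<in> D c")
      case False
      hence "red (Suc n) c b (stable c \<otimes> h \<otimes> g')" using 2 by (intro red_step) auto
      moreover have "stable c \<otimes> g = \<one> \<otimes> (stable c \<otimes> h \<otimes> g') \<otimes> k"
        using 2 by (simp add: m_assoc)
      ultimately show ?thesis using 2 H_one by blast
    next
      case True
      \<comment> \<open>The letters \<open>stable c\<close> and \<open>stable (\<not> c)\<close>
        cancel; the element \<open>h\<close> between them reappears on their left as its conjugate
        \<open>h'\<close>.\<close>
      define h' where "h' = conj (stable c) h"
      have h': "h' \<in> H" using True stable_conj D_H by (auto simp: h'_def)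
      have eq: "stable c \<otimes> g = h' \<otimes> (stable c \<otimes> g' \<otimes> k)"
        using 2 by (simp add: h'_def conj_def m_assoc)
      from 2(3) show ?thesis
      proof cases
        case red_stable
        hence "stable c \<otimes> g = h' \<otimes> k" using eq True 2 by simp
        then show ?thesis using h' 2 by auto
      next
        case (red_step m a' g1 h1)
        have "stable c \<otimes> g = (h' \<otimes> h1) \<otimes> g1 \<otimes> k"
          using eq True 2 h' red_step by (simp add: m_assoc flip: inv_stable)
        then show ?thesis using red_step 2(2) h' H_mult by blast
      qed
    qed
  qed
qed

lemma red_decomp_left:
  assumes "red n a b g"
  obtains (stable) "n = 0" "a = b" "g = stable a"
    | (step) m c g' h where "n = Suc m" "red m c b g'" "h \<in> H" "c = (\<not> a) \<Longrightarrow> h \<notin> D a" "g = stable a \<otimes> h \<otimes> g'"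
  using assms by cases auto

text \<open>The rules of \<open>red\<close> peel letters off on the left only; inversion exchanges
  the two ends.\<close>

lemma red_decomp_right:
  assumes "red n a b g"
  obtains (stable) "n = 0" "a = b" "g = stable b"
    | (step) m c g' h where "n = Suc m" "red m a c g'" "h \<in> H" "g = g' \<otimes> h \<otimes> stable b"
proof -
  from assms have g: "g \<in> carrier G" by simp
  from red_inv[OF assms] show thesis
  proof (cases rule: red_decomp_left)
    case stable
    from stable(3) have "inv (inv g) = stable b" by simp
    hence "g = stable b" using g by simp
    then show thesis using stable(1,2) by (intro that(1)) auto
  next
    case (step m c g' h)
    have "g = inv (stable (\<not> b) \<otimes> h \<otimes> g')" using step(5) g by (metis inv_inv)
    hence "g = inv g' \<otimes> inv h \<otimes> stable b" using step(2,3) by (simp add: inv_mult_group m_assoc)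
    then show thesis using step(1,3) that(2)[of m "\<not> c" "inv g'" "inv h"] red_inv[OF step(2)] by simp
  qed
qed

text \<open>Let the letters of \<open>g\<close> act on \<open>u\<close> one at a time, the last
  letter first. The conjugate stays in \<open>H\<close> until it misses the group \<open>D c\<close>
  of the next letter; from then on each letter lengthens the word at both ends without cancellation,
  whence the symmetric shape.\<close>

lemma red_conj:
  assumes "red n a b g" "u \<in> H"
  shows "conj g u \<in> H \<or> (\<exists>m. red m a (\<not> a) (conj g u))"
  using assms
proof (induction rule: red.induct)
  case (red_stable a)
  show ?case
  proof (cases "u \<in> D a")
    case True
    then show ?thesis using stable_conj D_H by blast
  next
    case False
    have "red (Suc (0 + 0)) a (\<not> a) (stable a \<otimes> u \<otimes> stable (\<not> a))"
      using False red_stable by (intro red_concat[OF red.red_stable red.red_stable]) auto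
    then show ?thesis by (auto simp: conj_def)
  qed
next
  case (red_step n a b g h c)
  define w where "w = conj g u"
  have w: "w \<in> carrier G" using red_step by (simp add: w_def)
  have eq: "conj (stable c \<otimes> h \<otimes> g) u = conj (stable c) (conj h w)"
    using red_step by (simp add: w_def conj_conj m_assoc)
  from red_step.IH[OF red_step.prems] consider "w \<in> H" | m where "red m a (\<not> a) w"
    unfolding w_def by blast
  then show ?case
  proof cases
    case 1
    show ?thesis
    proof (cases "w \<in> D c")
      case True
      then show ?thesis using stable_conj D_H eq 1 red_step by auto
    next
      case False
      have "red (Suc (0 + 0)) c (\<not> c) (stable c \<otimes> w \<otimes> stable (\<not> c))"
        using False 1 by (intro red_concat[OF red.red_stable red.red_stable]) auto
      moreover have "conj h w = w" using 1 red_step by simp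
      ultimately show ?thesis using eq by (metis conj_def inv_stable)
    qed
  next
    case 2
    have "red (Suc m) c (\<not> a) (stable c \<otimes> h \<otimes> w)"
      using 2 red_step by (intro red.red_step) auto
    hence "red (Suc (Suc m + 0)) c (\<not> c) (stable c \<otimes> h \<otimes> w \<otimes> inv h \<otimes> stable (\<not> c))"
      using red_step by (intro red_concat[OF _ red.red_stable]) auto
    moreover have "conj (stable c \<otimes> h \<otimes> g) u = stable c \<otimes> h \<otimes> w \<otimes> inv h \<otimes> stable (\<not> c)"
      using eq w red_step by (simp add: conj_def m_assoc)
    ultimately show ?thesis by auto
  qed
qed

text \<open>This makes the conjugator as short as possible. A first letter \<open>stable a\<close>
  of \<open>p\<close> with \<open>h\<close> in \<open>D (\<not> a)\<close> is absorbed by replacing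
  \<open>h\<close> with its conjugate, until the process stops.\<close>

lemma conj_inv_red_normal:
  assumes "red n a b p" "h \<in> H"
  shows "conj (inv p) h \<in> H \<or>
    (\<exists>m c d p' h'. red m c d p' \<and> h' \<in> H \<and> h' \<notin> D (\<not> c) \<and> conj (inv p) h = conj (inv p') h')"
  using assms
proof (induction arbitrary: h rule: red.induct)
  case (red_stable a)
  show ?case
  proof (cases "h \<in> D (\<not> a)")
    case True
    then show ?thesis using stable_conj D_H by fastforce
  next
    case False
    then show ?thesis using red.red_stable red_stable by blast
  qed
next
  case (red_step n a b g h1 c)
  show ?case
  proof (cases "h \<in> D (\<not> c)")
    case True
    define h2 where "h2 = conj (stable (\<not> c)) h"
    have h2: "h2 \<in> H" using True stable_conj D_H by (auto simp: h2_def)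
    have "conj (inv (stable c \<otimes> h1 \<otimes> g)) h = conj (inv g) (conj (inv h1) h2)"
      using red_step by (simp add: h2_def conj_conj inv_mult_group m_assoc)
    also have "\<dots> = conj (inv g) h2" using h2 red_step by simp
    finally show ?thesis using red_step.IH[OF h2] by auto
  next
    case False
    have "red (Suc n) c b (stable c \<otimes> h1 \<otimes> g)" using red_step by (intro red.red_step) auto
    then show ?thesis using False red_step.prems by blast
  qed
qed

section \<open>Cyclically reduced words and elliptic elements\<close>

lemma red_pow:
  assumes "red n a b k" "h \<in> H" "a = (\<not> b) \<Longrightarrow> h \<notin> D b"
  shows "\<exists>m k'. red m a b k' \<and> (k \<otimes> h) [^] Suc j = k' \<otimes> h"
proof (induction j)
  case 0
  show ?case using assms by (intro exI[of _ n] exI[of _ k]) auto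
next
  case (Suc j)
  then obtain m k' where k': "red m a b k'" "(k \<otimes> h) [^] Suc j = k' \<otimes> h" by blast
  \<comment> \<open>The third assumption says that \<open>k \<otimes> h\<close> is cyclically
    reduced, so nothing cancels where two copies meet.\<close>
  have "red (Suc (m + n)) a b (k' \<otimes> h \<otimes> k)" using k' assms by (intro red_concat) auto
  moreover have "(k \<otimes> h) [^] Suc (Suc j) = (k \<otimes> h) [^] Suc j \<otimes> (k \<otimes> h)" by simp
  hence "(k \<otimes> h) [^] Suc (Suc j) = (k' \<otimes> h \<otimes> k) \<otimes> h"
    using k' assms by (simp add: m_assoc del: nat_pow_Suc)
  ultimately show ?case by blast
qed

text \<open>In the Bass-Serre tree: \<open>g\<close> fixes a vertex, namely the coset of
  \<open>inv p\<close>.\<close>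

definition elliptic :: "'a \<Rightarrow> bool" where
  "elliptic g \<longleftrightarrow> (\<exists>p\<in>carrier G. conj p g \<in> H)"

lemma elliptic_conj:
  assumes "p \<in> carrier G" "g \<in> carrier G"
  shows "elliptic (conj p g) \<longleftrightarrow> elliptic g"
proof
  assume "elliptic (conj p g)"
  then obtain q where "q \<in> carrier G" "conj q (conj p g) \<in> H" by (auto simp: elliptic_def)
  thus "elliptic g" using assms by (auto simp: elliptic_def conj_conj)
next
  assume "elliptic g"
  then obtain q where q: "q \<in> carrier G" "conj q g \<in> H" by (auto simp: elliptic_def)
  hence "conj (q \<otimes> inv p) (conj p g) \<in> H" using assms by (simp add: conj_conj m_assoc)
  thus "elliptic (conj p g)" using q assms unfolding elliptic_def by blast
qed

text \<open>If the last and the first letter cancel across \<open>h\<close>, conjugation by the last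
  letter shortens the word by two letters. The process cannot run into \<open>H\<close> because the
  element is not elliptic, so it stops at a cyclically reduced word.\<close>

lemma cyclically_reduced:
  assumes "red n a b k" "h \<in> H" "\<not> elliptic (k \<otimes> h)"
  shows "\<exists>p m a' b' k' h'. p \<in> carrier G \<and> red m a' b' k' \<and> h' \<in> H \<and> (a' = (\<not> b') \<longrightarrow> h' \<notin> D b') \<and>
    conj p (k \<otimes> h) = k' \<otimes> h'"
  using assms
proof (induction n arbitrary: a b k h rule: less_induct)
  case (less n)
  show ?case
  proof (cases "a = (\<not> b) \<and> h \<in> D b")
    case False
    have "conj \<one> (k \<otimes> h) = k \<otimes> h" using less.prems by simp
    then show ?thesis using False less.prems one_closed by blast
  next
    case True
    define h3 where "h3 = conj (stable b) h"
    have h3: "h3 \<in> H" using True stable_conj D_H by (auto simp: h3_def)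
    have a: "a = (\<not> b)" using True by simp
    have k: "k \<in> carrier G" using less.prems by simp
    from less.prems(1) show ?thesis
    proof (cases rule: red_decomp_left)
      case stable
      then show ?thesis using a by simp
    next
      case 1: (step m c k1 h1)
      from 1(2) show ?thesis
      proof (cases rule: red_decomp_right)
        case stable
        have "conj (stable b) (k \<otimes> h) = h1 \<otimes> h3"
          using 1 stable less.prems a by (simp add: conj_def h3_def m_assoc flip: inv_stable)
        hence "elliptic (k \<otimes> h)" using 1 h3 by (auto simp: elliptic_def intro!: bexI[of _ "stable b"])
        then show ?thesis using less.prems by simp
      next
        case 2: (step l d k2 h2)
        have h23: "h2 \<otimes> h3 \<otimes> h1 \<in> H" using 1 2 h3 by simp
        have eq: "conj (inv h1 \<otimes> stable b) (k \<otimes> h) = k2 \<otimes> (h2 \<otimes> h3 \<otimes> h1)"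
          using 1 2 less.prems a
          by (simp add: conj_def h3_def m_assoc inv_mult_group flip: inv_stable)
        have p: "inv h1 \<otimes> stable b \<in> carrier G" using 1 by simp
        have kh: "k \<otimes> h \<in> carrier G" using k less.prems by simp
        have "\<not> elliptic (k2 \<otimes> (h2 \<otimes> h3 \<otimes> h1))"
          using less.prems(3) elliptic_conj[OF p kh] eq by simp
        have "l < n" using 1(1) 2(1) by simp
        from less.IH[OF this 2(2) h23 \<open>\<not> elliptic (k2 \<otimes> (h2 \<otimes> h3 \<otimes> h1))\<close>] obtain q m a' b' k' h' where
          q: "q \<in> carrier G" "red m a' b' k'" "h' \<in> H" "a' = (\<not> b') \<longrightarrow> h' \<notin> D b'"
            "conj q (k2 \<otimes> (h2 \<otimes> h3 \<otimes> h1)) = k' \<otimes> h'" by blast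
        have "conj (q \<otimes> (inv h1 \<otimes> stable b)) (k \<otimes> h) = k' \<otimes> h'"
          using q(5) conj_conj[OF q(1) p kh] eq by simp
        then show ?thesis
          using m_closed[OF q(1) p] q(2-4)
          by (intro exI[of _ "q \<otimes> (inv h1 \<otimes> stable b)"] exI[of _ m] exI[of _ a'] exI[of _ b'] exI[of _ k'] exI[of _ h'])
             (intro conjI)
      qed
    qed
  qed
qed

lemma hyperbolic:
  assumes "g \<in> carrier G" "\<not> elliptic g"
  obtains p m a b k h where "p \<in> carrier G" "red m a b k" "h \<in> H" "a = (\<not> b) \<longrightarrow> h \<notin> D b"
    "conj p g = k \<otimes> h"
proof -
  from red_exists[OF assms(1)] consider "g \<in> H"
    | n a b h g' k where "h \<in> H" "k \<in> H" "red n a b g'" "g = h \<otimes> g' \<otimes> k" by blast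
  then show thesis
  proof cases
    case 1
    hence "conj \<one> g \<in> H" by simp
    then show thesis using assms unfolding elliptic_def by blast
  next
    case 2
    have eq: "conj (inv h) g = g' \<otimes> (k \<otimes> h)" using 2 by (simp add: conj_def m_assoc)
    have "\<not> elliptic (g' \<otimes> (k \<otimes> h))" using elliptic_conj[of "inv h" g] assms 2 eq by simp
    from cyclically_reduced[OF 2(3) H_mult[OF 2(2,1)] this] obtain p m a' b' k' h' where
      p: "p \<in> carrier G" "red m a' b' k'" "h' \<in> H" "a' = (\<not> b') \<longrightarrow> h' \<notin> D b'"
        "conj p (g' \<otimes> (k \<otimes> h)) = k' \<otimes> h'" by blast
    have "conj (p \<otimes> inv h) g = k' \<otimes> h'"
      using p conj_conj[of p "inv h" g] 2(1) assms(1) eq by simp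
    then show thesis using p 2 by (intro that[of "p \<otimes> inv h"]) auto
  qed
qed

end

section \<open>Elliptic subgroups\<close>

text \<open>An assumption of a locale cannot quantify over types, so \<open>universal\<close> ranges
  over groups on the same type. This suffices because both Leary-Minasyan groups consist of sets of
  words over \<open>lm_gen\<close>.\<close>

locale hnn = hnn_words +
  fixes deg :: "'a \<Rightarrow> int"
  assumes britton: "red n a b g \<Longrightarrow> g \<notin> H"
    and deg_mult: "x \<in> carrier G \<Longrightarrow> y \<in> carrier G \<Longrightarrow> deg (x \<otimes> y) = deg x + deg y"
    and deg_H: "x \<in> H \<Longrightarrow> deg x = 0"
    and deg_t: "deg t = 1"
    and deg_zero_conj: "\<lbrakk>g \<in> carrier G; deg g = 0; v \<in> H; conj g v \<in> H\<rbrakk> \<Longrightarrow> conj g v = v"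
    and D_power: "v \<in> H \<Longrightarrow> \<exists>j>0. v [^] (j::nat) \<in> D e"
    and H_finitely_generated: "\<exists>S. finite S \<and> H = generate G S"
    and universal: "\<lbrakk>group K; \<phi> \<in> hom (G\<lparr>carrier := H\<rparr>) K; s \<in> carrier K;
      \<And>v. v \<in> D True \<Longrightarrow> group.conj K s (\<phi> v) = \<phi> (conj t v)\<rbrakk>
      \<Longrightarrow> \<exists>F\<in>hom G (K::'a monoid). (\<forall>v\<in>H. F v = \<phi> v) \<and> F t = s"
begin

definition sgn :: "bool \<Rightarrow> int" where
  "sgn e = (if e then 1 else - 1)"

lemma deg_one: "deg \<one> = 0"
  by (simp add: deg_H)

lemma deg_inv: "x \<in> carrier G \<Longrightarrow> deg (inv x) = - deg x"
  using deg_mult[of x "inv x"] deg_one by simp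

lemma deg_stable: "deg (stable e) = sgn e"
  by (simp add: stable_def sgn_def deg_t deg_inv)

text \<open>If \<open>D e = H\<close>, the extension is ascending: conjugation by
  \<open>stable e\<close> maps \<open>H\<close> into itself, and a high power of
  \<open>stable e\<close> conjugates any given element of degree 0 into \<open>H\<close>. One power
  works for both \<open>x\<close> and \<open>y\<close>, and \<open>H\<close> is commutative.\<close>

lemma degree_kernel_commute:
  assumes "D e = H" "x \<in> carrier G" "y \<in> carrier G" "deg x = 0" "deg y = 0"
  shows "x \<otimes> y = y \<otimes> x"
proof -
  let ?s = "stable e"
  have conjH: "conj (?s [^] (m::nat)) h \<in> H" if "h \<in> H" for m h
  proof (induction m)
    case (Suc m)
    have "conj (?s [^] Suc m) h = conj ?s (conj (?s [^] m) h)"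
      by (subst nat_pow_Suc2) (use that in \<open>simp_all add: conj_conj\<close>)
    then show ?case using Suc stable_conj D_H assms(1) by metis
  qed (use that in simp)
  \<comment> \<open>The exponent on the right compensates the degree of \<open>g\<close>, so the
    induction can pass through elements of every degree. The factor \<open>sgn e\<close> is the
    degree of \<open>?s\<close>.\<close>
  have shift: "\<exists>i\<ge>0. \<forall>m\<ge>i. ?s [^] m \<otimes> g \<otimes> ?s [^] (- (m + sgn e * deg g)) \<in> H"
    if "g \<in> carrier G" for g
    using that
  proof (induction rule: carrier_induct)
    case one
    then show ?case by (auto simp: deg_one int_pow_neg)
  next
    case (H h g)
    then obtain i where i: "i \<ge> 0" "\<forall>m\<ge>i. ?s [^] m \<otimes> g \<otimes> ?s [^] (- (m + sgn e * deg g)) \<in> H" by blast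
    have "?s [^] m \<otimes> (h \<otimes> g) \<otimes> ?s [^] (- (m + sgn e * deg (h \<otimes> g))) \<in> H" if "m \<ge> i" for m
    proof -
      have "m \<ge> 0" using i(1) that by simp
      then obtain k where k: "m = int k" using zero_le_imp_eq_int by blast
      have "?s [^] m \<otimes> (h \<otimes> g) \<otimes> ?s [^] (- (m + sgn e * deg (h \<otimes> g)))
        = conj (?s [^] k) h \<otimes> (?s [^] m \<otimes> g \<otimes> ?s [^] (- (m + sgn e * deg g)))"
        using H by (simp add: deg_mult deg_H conj_def m_assoc k int_pow_int)
      then show ?thesis using conjH[OF H(1), of k] i(2) that by simp
    qed
    then show ?case using i by blast
  next
    case (stable c g)
    then obtain i where i: "i \<ge> 0" "\<forall>m\<ge>i. ?s [^] m \<otimes> g \<otimes> ?s [^] (- (m + sgn e * deg g)) \<in> H" by blast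
    define d where "d = sgn e * sgn c"
    have c: "stable c = ?s [^] d"
      by (cases c; cases e) (simp_all add: d_def sgn_def int_pow_neg int_pow_1)
    have d: "d \<ge> - 1" by (auto simp: d_def sgn_def)
    \<comment> \<open>The letter \<open>stable c\<close> may be the inverse of \<open>?s\<close> and
      then lowers the exponent by one; hence the bound \<open>i + 1\<close>.\<close>
    have "?s [^] m \<otimes> (stable c \<otimes> g) \<otimes> ?s [^] (- (m + sgn e * deg (stable c \<otimes> g))) \<in> H" if "m \<ge> i + 1" for m
    proof -
      have "?s [^] m \<otimes> (stable c \<otimes> g) = ?s [^] (m + d) \<otimes> g"
        using stable by (simp add: c int_pow_mult m_assoc)
      moreover have "m + sgn e * deg (stable c \<otimes> g) = (m + d) + sgn e * deg g"
        using stable by (simp add: deg_mult deg_stable d_def algebra_simps)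
      moreover have "m + d \<ge> i" using that d by simp
      ultimately show ?thesis using i(2) by metis
    qed
    then show ?case using i by (intro exI[of _ "i + 1"]) auto
  qed
  from shift[OF assms(2)] obtain i where i: "\<forall>m\<ge>i::int. ?s [^] m \<otimes> x \<otimes> ?s [^] (- m) \<in> H"
    using assms(4) by auto
  from shift[OF assms(3)] obtain j where j: "\<forall>m\<ge>j::int. ?s [^] m \<otimes> y \<otimes> ?s [^] (- m) \<in> H"
    using assms(5) by auto
  define m where "m = max i j"
  have "conj (?s [^] m) x \<in> H" "conj (?s [^] m) y \<in> H"
    using i j by (auto simp: conj_def m_def int_pow_neg)
  then show ?thesis
    using H_comm commute_conj[of "?s [^] m" x y] assms by simp
qed

section \<open>Commutative commensurated subgroups and their fixed vertices\<close>

lemma commensurated: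
  assumes "g \<in> carrier G" "v \<in> H"
  shows "\<exists>j>0. conj g (v [^] (j::nat)) \<in> H"
  using assms(1)
proof (induction rule: carrier_induct)
  case one
  show ?case using assms by (intro exI[of _ 1]) simp
next
  case (H h g)
  then obtain j where j: "j > 0" "conj g (v [^] (j::nat)) \<in> H" by blast
  have "conj (h \<otimes> g) (v [^] j) = conj h (conj g (v [^] j))"
    using H assms by (simp add: conj_conj)
  then show ?case using j H by auto
next
  case (stable c g)
  then obtain j where j: "j > 0" "conj g (v [^] (j::nat)) \<in> H" by blast
  \<comment> \<open>Every stable letter costs one more power, which brings the element into the edge
    group of that letter.\<close>
  obtain i where i: "i > 0" "conj g (v [^] (j::nat)) [^] (i::nat) \<in> D c" using D_power[OF j(2)] by blast
  have "conj (stable c \<otimes> g) (v [^] (j * i)) = conj (stable c) (conj g (v [^] (j::nat)) [^] i)"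
    using stable assms by (simp add: conj_conj flip: conj_pow nat_pow_pow)
  also have "\<dots> \<in> H" using i stable_conj D_H by blast
  finally show ?case using i j by (intro exI[of _ "j * i"]) auto
qed

text \<open>A hyperbolic element of \<open>U\<close> would, for each of its conjugates, have a power commuting with that
  conjugate; a suitable conjugator \<open>P\<close> makes the corresponding commutator a reduced word.\<close>

lemma commensurated_elliptic:
  assumes proper: "\<And>e. D e \<noteq> H"
    and U: "U \<subseteq> carrier G" "\<And>x y. x \<in> U \<Longrightarrow> y \<in> U \<Longrightarrow> x \<otimes> y = y \<otimes> x"
    and comm: "\<And>g u. g \<in> carrier G \<Longrightarrow> u \<in> U \<Longrightarrow> \<exists>j>0. conj g (u [^] (j::nat)) \<in> U"
    and u: "u \<in> U"
  shows "elliptic u"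
proof (rule ccontr)
  have uc: "u \<in> carrier G" using U(1) u by blast
  assume "\<not> elliptic u"
  then obtain p m a b k h where p: "p \<in> carrier G" and k: "red m a b k" and h: "h \<in> H"
    and ab: "a = (\<not> b) \<longrightarrow> h \<notin> D b" and eq: "conj p u = k \<otimes> h"
    using hyperbolic[OF uc] by metis
  have kc: "k \<in> carrier G" using k by simp
  have hc: "h \<in> carrier G" using h by simp
  \<comment> \<open>The product is the commutator of the power \<open>k' \<otimes> h\<close> of
    \<open>k \<otimes> h\<close> with the conjugate of \<open>k \<otimes> h\<close> by
    \<open>P\<close>. It is expanded so that the junctions between the reduced factors become
    visible.\<close>
  have comm': "\<exists>n k'. red n a b k' \<and>
      k' \<otimes> h \<otimes> P \<otimes> k \<otimes> h \<otimes> inv P \<otimes> inv h \<otimes> inv k' \<otimes> P \<otimes> inv h \<otimes> inv k \<otimes> inv P = \<one>"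
    if P: "P \<in> carrier G" for P
  proof -
    \<comment> \<open>\<open>y\<close> is \<open>P\<close> transported back through conjugation by
      \<open>p\<close>. Conjugation by \<open>inv y\<close> takes some power of \<open>u\<close>
      into \<open>U\<close>, where it commutes with \<open>u\<close>; conjugating back, that power
      of \<open>u\<close> commutes with \<open>conj y u\<close>.\<close>
    define y where "y = inv p \<otimes> P \<otimes> p"
    have y: "y \<in> carrier G" using p P by (simp add: y_def)
    obtain j where j: "j > 0" "conj (inv y) (u [^] (j::nat)) \<in> U" using comm[of "inv y" u] y u by auto
    then obtain i where i: "j = Suc i" using gr0_implies_Suc by blast
    have "conj (inv y) (u [^] j) \<otimes> u = u \<otimes> conj (inv y) (u [^] j)" using U(2) u j by blast
    hence "conj y (conj (inv y) (u [^] j)) \<otimes> conj y u = conj y u \<otimes> conj y (conj (inv y) (u [^] j))"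
      using commute_conj[of y "conj (inv y) (u [^] j)" u] y uc by simp
    hence "u [^] j \<otimes> conj y u = conj y u \<otimes> u [^] j" using y uc by simp
    hence "conj p (u [^] j) \<otimes> conj p (conj y u) = conj p (conj y u) \<otimes> conj p (u [^] j)"
      using commute_conj[of p "u [^] j" "conj y u"] y uc p by simp
    moreover have "conj p (conj y u) = conj P (conj p u)"
      using p P uc y by (simp add: conj_conj y_def m_assoc)
    ultimately have c: "(k \<otimes> h) [^] j \<otimes> conj P (k \<otimes> h) = conj P (k \<otimes> h) \<otimes> (k \<otimes> h) [^] j"
      using p uc by (simp add: conj_pow eq)
    obtain n k' where k': "red n a b k'" "(k \<otimes> h) [^] Suc i = k' \<otimes> h"
      using red_pow[OF k h] ab by blast
    have kc': "k' \<in> carrier G" using k' by simp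
    define w where "w = k' \<otimes> h"
    define z where "z = conj P (k \<otimes> h)"
    have wz: "w \<in> carrier G" "z \<in> carrier G" "w \<otimes> z = z \<otimes> w"
      using c i k' kc' kc hc P by (simp_all add: w_def z_def)
    hence "w \<otimes> z \<otimes> inv w \<otimes> inv z = \<one>" by (simp add: m_assoc)
    also have "w \<otimes> z \<otimes> inv w \<otimes> inv z
      = k' \<otimes> h \<otimes> P \<otimes> k \<otimes> h \<otimes> inv P \<otimes> inv h \<otimes> inv k' \<otimes> P \<otimes> inv h \<otimes> inv k \<otimes> inv P"
      using kc' kc hc P by (simp add: w_def z_def conj_def m_assoc inv_mult_group)
    finally show ?thesis using k' by blast
  qed
  obtain x where x: "x \<in> H" "x \<notin> D b" using proper[of b] D_le[of b] by blast
  show False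
  proof (cases "a = b")
    \<comment> \<open>Here \<open>P\<close> can be taken in \<open>H\<close>. Opposite letters meet
      only between \<open>k\<close> and \<open>inv k'\<close>; the factor there is
      \<open>h \<otimes> inv x \<otimes> inv h = inv x\<close>, which is not in \<open>D b\<close>.
      The trailing \<open>inv x\<close> is split off, and the rest is the reduced word
      \<open>v\<close>.\<close>
    case True
    obtain n k' where k': "red n a b k'" and
      c: "k' \<otimes> h \<otimes> x \<otimes> k \<otimes> h \<otimes> inv x \<otimes> inv h \<otimes> inv k' \<otimes> x \<otimes> inv h \<otimes> inv k \<otimes> inv x = \<one>"
      using comm'[of x] x by auto
    define v where "v = k' \<otimes> (h \<otimes> x) \<otimes> k \<otimes> inv x \<otimes> inv k' \<otimes> (x \<otimes> inv h) \<otimes> inv k"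
    have kc': "k' \<in> carrier G" using k' by simp
    have 1: "red (Suc (n + m)) a b (k' \<otimes> (h \<otimes> x) \<otimes> k)"
      using True x h by (intro red_concat[OF k' k]) auto
    have 2: "red (Suc (Suc (n + m) + n)) a (\<not> a) (k' \<otimes> (h \<otimes> x) \<otimes> k \<otimes> inv x \<otimes> inv k')"
      using True x by (intro red_concat[OF 1 red_inv[OF k']]) auto
    have "red (Suc (Suc (Suc (n + m) + n) + m)) a (\<not> a) v"
      unfolding v_def using True x h by (intro red_concat[OF 2 red_inv[OF k]]) auto
    hence nin: "v \<notin> H" by (rule britton)
    have "h \<otimes> (inv x \<otimes> inv h) = inv x"
      using h x H_comm[of h "inv x"] by (simp flip: m_assoc) (simp add: m_assoc)
    hence "v \<otimes> inv x = k' \<otimes> h \<otimes> x \<otimes> k \<otimes> (h \<otimes> (inv x \<otimes> inv h)) \<otimes> inv k' \<otimes> x \<otimes> inv h \<otimes> inv k \<otimes> inv x"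
      using kc kc' hc x by (simp add: v_def m_assoc)
    also have "\<dots> = \<one>" using c kc kc' hc x by (simp add: m_assoc)
    finally have "inv (inv x) = v" using x kc kc' hc by (intro inv_equality) (simp_all add: v_def)
    hence "v = x" using x by simp
    with nin show False using x by simp
  next
    case False
    hence a: "a = (\<not> b)" by auto
    \<comment> \<open>\<open>P\<close> and \<open>inv P\<close> begin with \<open>stable b\<close>
      and end with \<open>stable (\<not> b)\<close>, whereas \<open>k\<close>, \<open>k'\<close> and
      their inverses begin with \<open>stable (\<not> b)\<close> and end with
      \<open>stable b\<close>. In the commutator the two kinds alternate, so every junction joins
      equal letters and nothing cancels.\<close>
    define P where "P = stable b \<otimes> x \<otimes> stable (\<not> b)"
    have P: "red (Suc (0 + 0)) b (\<not> b) P"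
      unfolding P_def using x by (intro red_concat[OF red_stable red_stable]) auto
    have P': "red (Suc (0 + 0)) b (\<not> b) (inv P)" using red_inv[OF P] by simp
    have Pc: "P \<in> carrier G" using P by simp
    obtain n k' where k': "red n a b k'" and
      c: "k' \<otimes> h \<otimes> P \<otimes> k \<otimes> h \<otimes> inv P \<otimes> inv h \<otimes> inv k' \<otimes> P \<otimes> inv h \<otimes> inv k \<otimes> inv P = \<one>"
      using comm'[OF Pc] by blast
    have kc': "k' \<in> carrier G" using k' by simp
    have ik: "red m a b (inv k)" "red n a b (inv k')" using red_inv[OF k] red_inv[OF k'] a by auto
    have ab_concat: "red (Suc (i + j)) a b (g \<otimes> h \<otimes> g')"
      if "red i a (\<not> b) g" "red j a b g'" "h \<in> H" for i j g g' h
      by (rule red_concat[OF that]) (simp add: a)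
    have ba_concat: "red (Suc (i + j)) a (\<not> b) (g \<otimes> h \<otimes> g')"
      if "red i a b g" "red j b (\<not> b) g'" "h \<in> H" for i j g g' h
      by (rule red_concat[OF that]) simp
    note 1 = ab_concat[OF ba_concat[OF k' P h] k H_one]
    note 2 = ab_concat[OF ba_concat[OF 1 P' h] ik(2) H_inv[OF h]]
    note 3 = ab_concat[OF ba_concat[OF 2 P H_one] ik(1) H_inv[OF h]]
    note 4 = ba_concat[OF 3 P' H_one]
    have eq1: "k' \<otimes> h \<otimes> P \<otimes> \<one> \<otimes> k \<otimes> h \<otimes> inv P \<otimes> inv h \<otimes> inv k' \<otimes> \<one> \<otimes> P
        \<otimes> inv h \<otimes> inv k \<otimes> \<one> \<otimes> inv P = \<one>"
      using c kc kc' hc Pc by (simp add: m_assoc)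
    show False using britton[OF 4] H_one unfolding eq1 by blast
  qed
qed

text \<open>In the tree: \<open>U\<close> fixes the base vertex and commutes with \<open>u\<close>,
  so it permutes the vertices fixed by \<open>u\<close> and fixes the one nearest to the base
  vertex. In words, \<open>q\<close> is a conjugator that admits no further absorption. If
  \<open>w = conj q v\<close> were outside \<open>H\<close>, it would be a reduced word ending in
  \<open>stable (\<not> c)\<close>, and \<open>h'\<close> outside \<open>D (\<not> c)\<close> would
  make \<open>w \<otimes> h' \<otimes> inv w\<close> reduced, although it equals
  \<open>h'\<close>.\<close>

lemma elliptic_common_conj:
  assumes "U \<subseteq> H" "u \<in> carrier G" "elliptic u" "\<And>v. v \<in> U \<Longrightarrow> u \<otimes> v = v \<otimes> u"
  shows "\<exists>q\<in>carrier G. conj q u \<in> H \<and> (\<forall>v\<in>U. conj q v \<in> H)"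
proof (cases "u \<in> H")
  case True
  then show ?thesis using assms by (intro bexI[of _ \<one>]) auto
next
  case False
  obtain p where p: "p \<in> carrier G" "conj p u \<in> H" using assms(3) by (auto simp: elliptic_def)
  define h where "h = conj p u"
  have h: "h \<in> H" "u = conj (inv p) h" using p assms(2) by (simp_all add: h_def)
  from red_exists[OF p(1)] show ?thesis
  proof
    assume "p \<in> H"
    hence "u \<in> H" using h by simp
    with False show ?thesis by simp
  next
    assume "\<exists>n a b h g' k. h \<in> H \<and> k \<in> H \<and> red n a b g' \<and> p = h \<otimes> g' \<otimes> k"
    then obtain n a b k1 g k2 where g: "k1 \<in> H" "k2 \<in> H" "red n a b g" "p = k1 \<otimes> g \<otimes> k2" by blast
    have gc: "g \<in> carrier G" using g by simp
    have "u = conj (inv k2) (conj (inv g) (conj (inv k1) h))"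
      using g gc h conj_conj_conj[of "inv k2" "inv g" "inv k1" h] by (simp add: inv_mult_group m_assoc)
    hence u: "u = conj (inv k2) (conj (inv g) h)" using g h by simp
    from conj_inv_red_normal[OF g(3) h(1)] show ?thesis
    proof
      assume "conj (inv g) h \<in> H"
      hence "u \<in> H" using u g by simp
      with False show ?thesis by simp
    next
      assume "\<exists>m c d p' h'. red m c d p' \<and> h' \<in> H \<and> h' \<notin> D (\<not> c) \<and> conj (inv g) h = conj (inv p') h'"
      then obtain m c d p' h' where p': "red m c d p'" "h' \<in> H" "h' \<notin> D (\<not> c)"
        "conj (inv g) h = conj (inv p') h'" by blast
      have pc': "p' \<in> carrier G" using p' by simp
      define q where "q = p' \<otimes> k2"
      have q: "q \<in> carrier G" using pc' g by (simp add: q_def)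
      have "u = conj (inv q) h'"
        using u p' pc' g by (simp add: q_def conj_conj inv_mult_group)
      hence qu: "conj q u = h'" using q p' by simp
      have "conj q v \<in> H" if v: "v \<in> U" for v
      proof (rule ccontr)
        assume nin: "conj q v \<notin> H"
        have vH: "v \<in> H" using v assms by blast
        define w where "w = conj q v"
        have wc: "w \<in> carrier G" using q vH by (simp add: w_def)
        have "w = conj p' (conj k2 v)" using conj_conj[of p' k2 v] pc' g vH by (simp add: w_def q_def)
        hence "w = conj p' v" using g vH by simp
        then obtain l where l: "red l c (\<not> c) w"
          using red_conj[OF p'(1) vH] nin w_def by auto
        have l': "red l c (\<not> c) (inv w)" using red_inv[OF l] by simp
        have "red (Suc (l + l)) c (\<not> c) (w \<otimes> h' \<otimes> inv w)"
          using p' by (intro red_concat[OF l l']) auto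
        moreover have "h' \<otimes> w = w \<otimes> h'"
          using assms(4)[OF v] commute_conj[of q u v] q vH assms(2) by (simp add: w_def flip: qu)
        hence "w \<otimes> h' \<otimes> inv w = h'" using wc p' by (simp add: m_assoc flip: \<open>h' \<otimes> w = w \<otimes> h'\<close>)
        ultimately show False using britton p'(2) by metis
      qed
      then show ?thesis using q qu p'(2) by auto
    qed
  qed
qed

lemma finite_elliptic_common_conj:
  assumes "finite S" "S \<subseteq> carrier G" "\<And>u. u \<in> S \<Longrightarrow> elliptic u"
    "\<And>u v. u \<in> S \<Longrightarrow> v \<in> S \<Longrightarrow> u \<otimes> v = v \<otimes> u"
  shows "\<exists>p\<in>carrier G. \<forall>u\<in>S. conj p u \<in> H"
  using assms
proof (induction S)
  case empty
  then show ?case by auto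
next
  case (insert u S)
  then obtain p where p: "p \<in> carrier G" "\<forall>u\<in>S. conj p u \<in> H" by auto
  have "\<exists>q\<in>carrier G. conj q (conj p u) \<in> H \<and> (\<forall>v\<in>conj p ` S. conj q v \<in> H)"
  proof (rule elliptic_common_conj)
    show "elliptic (conj p u)" using insert.prems p elliptic_conj by simp
    show "conj p u \<otimes> v = v \<otimes> conj p u" if "v \<in> conj p ` S" for v
    proof -
      obtain s where s: "s \<in> S" "v = conj p s" using \<open>v \<in> conj p ` S\<close> by blast
      thus ?thesis using commute_conj[of p u s] p insert.prems by auto
    qed
  qed (use insert.prems p in auto)
  then obtain q where q: "q \<in> carrier G" "conj q (conj p u) \<in> H" "\<forall>v\<in>S. conj q (conj p v) \<in> H" by auto
  have "\<forall>v\<in>insert u S. conj (q \<otimes> p) v \<in> H"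
    using p q insert.prems by (auto simp flip: conj_conj)
  then show ?case using p q by (intro bexI[of _ "q \<otimes> p"]) auto
qed

text \<open>If \<open>k\<close> contained a stable letter, then for its last one,
  \<open>stable b\<close>, some \<open>x\<close> in \<open>H\<close> would lie outside
  \<open>D b\<close>, and conjugating \<open>x\<close> by \<open>k\<close> would give a reduced word
  up to factors from \<open>H\<close>.\<close>

lemma conj_maximal:
  assumes "\<And>e. D e \<noteq> H" "k \<in> carrier G" "\<And>h. h \<in> H \<Longrightarrow> conj k h \<in> H"
  shows "k \<in> H"
  using red_exists[OF assms(2)]
proof
  assume "\<exists>n a b h g' k'. h \<in> H \<and> k' \<in> H \<and> red n a b g' \<and> k = h \<otimes> g' \<otimes> k'"
  then obtain n a b h1 g h2 where g: "h1 \<in> H" "h2 \<in> H" "red n a b g" "k = h1 \<otimes> g \<otimes> h2" by blast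
  obtain x where x: "x \<in> H" "x \<notin> D b" using assms(1)[of b] D_le[of b] by blast
  have "conj k x = conj h1 (conj g (conj h2 x))" using g x conj_conj_conj[of h1 g h2 x] by simp
  hence "conj g x = conj (inv h1) (conj k x)" using g x by simp
  hence "conj g x \<in> H" using assms(3)[OF x(1)] g by simp
  moreover have "red (Suc (n + n)) a (\<not> a) (g \<otimes> x \<otimes> inv g)"
    using x by (intro red_concat[OF g(3) red_inv[OF g(3)]]) auto
  ultimately show ?thesis using britton unfolding conj_def by blast
qed

lemma conj_mem_H_of_elliptic_generators:
  assumes "group_hom K G f" "S \<subseteq> carrier K" "p \<in> carrier G" "\<And>u. u \<in> S \<Longrightarrow> conj p (f u) \<in> H"
    "v \<in> generate K S"
  shows "conj p (f v) \<in> H"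
proof -
  interpret f: group_hom K G f by (rule assms(1))
  have vc: "v \<in> carrier K" using assms f.G.generate_in_carrier by blast
  from assms(5,2) show ?thesis
  proof (induction rule: f.G.generate_induct_left)
    case (mult s g)
    have "s \<in> carrier K" using mult assms by blast
    then show ?case using mult assms by (simp add: conj_mult)
  next
    case (inv_mult s g)
    have "s \<in> carrier K" using inv_mult assms by blast
    then show ?case using inv_mult assms by (simp add: conj_mult conj_inv)
  qed (use assms in simp)
qed

section \<open>The edge groups\<close>

text \<open>A discrete intermediate value argument: the degrees of the suffixes of a reduced word for \<open>g\<close>
  start at 0, so on their way to a value of sign \<open>e\<close> some letter \<open>stable e\<close> takes them from 0 to
  \<open>sgn e\<close>, and the suffix of degree 0 before that letter conjugates \<open>v\<close> to itself.\<close>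

lemma red_conj_mem_D:
  assumes "red n a b g" "v \<in> H" "conj g v \<in> H" "sgn e * deg g \<ge> 1"
  shows "v \<in> D e"
  using assms
proof (induction rule: red.induct)
  case (red_stable a)
  have e: "e = a" using red_stable(3) by (auto simp: deg_stable sgn_def split: if_splits)
  show ?case
  proof (rule ccontr)
    assume "v \<notin> D e"
    hence "red (Suc (0 + 0)) a (\<not> a) (stable a \<otimes> v \<otimes> stable (\<not> a))"
      using e red_stable by (intro red_concat[OF red.red_stable red.red_stable]) auto
    then show False using britton red_stable(2) by (auto simp: conj_def)
  qed
next
  case (red_step n a b g h c)
  define w where "w = conj g v"
  have gc: "g \<in> carrier G" and wc: "w \<in> carrier G" using red_step by (simp_all add: w_def)
  have eq: "conj (stable c \<otimes> h \<otimes> g) v = stable c \<otimes> h \<otimes> w \<otimes> inv h \<otimes> stable (\<not> c)"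
    using red_step gc by (simp add: w_def conj_def inv_mult_group m_assoc)
  \<comment> \<open>Once a suffix moves \<open>v\<close> out of \<open>H\<close>, the shape given by
    \<open>red_conj\<close> lets no later letter bring it back.\<close>
  have w: "w \<in> H"
  proof (rule ccontr)
    assume "w \<notin> H"
    then obtain m where m: "red m a (\<not> a) w" using red_conj red_step w_def by blast
    have "red (Suc m) c (\<not> a) (stable c \<otimes> h \<otimes> w)"
      using m red_step by (intro red.red_step) auto
    hence "red (Suc (Suc m + 0)) c (\<not> c) (stable c \<otimes> h \<otimes> w \<otimes> inv h \<otimes> stable (\<not> c))"
      using red_step by (intro red_concat[OF _ red.red_stable]) auto
    then show False using britton red_step.prems(2) eq by metis
  qed
  show ?case
  proof (cases "sgn e * deg g \<ge> 1")
    case True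
    then show ?thesis using red_step w w_def by blast
  next
    case False
    have "deg (stable c \<otimes> h \<otimes> g) = sgn c + deg g"
      using red_step gc by (simp add: deg_mult deg_stable deg_H)
    \<comment> \<open>One letter changes the degree by one. To raise the signed degree from at most
      0 to at least 1 it must start at exactly 0, and the letter must be
      \<open>stable e\<close>.\<close>
    with False red_step.prems(3) have "deg g = 0" "c = e"
      by (auto simp: sgn_def split: if_splits)
    hence wv: "w = v" using deg_zero_conj gc red_step w by (simp add: w_def)
    show ?thesis
    proof (rule ccontr)
      assume "v \<notin> D e"
      hence "red (Suc (0 + 0)) c (\<not> c) (stable c \<otimes> v \<otimes> stable (\<not> c))"
        using \<open>c = e\<close> red_step by (intro red_concat[OF red.red_stable red.red_stable]) auto
      moreover have "h \<otimes> (v \<otimes> inv h) = v"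
        using H_conj[of h v] red_step by (simp add: conj_def m_assoc)
      hence "conj (stable c \<otimes> h \<otimes> g) v = stable c \<otimes> v \<otimes> stable (\<not> c)"
        using red_step eq wv by (simp add: m_assoc flip: inv_stable)
      ultimately show False using britton red_step.prems(2) by metis
    qed
  qed
qed

lemma conj_mem_D:
  assumes "g \<in> carrier G" "v \<in> H" "conj g v \<in> H" "sgn e * deg g \<ge> 1"
  shows "v \<in> D e"
  using red_exists[OF assms(1)]
proof
  assume "g \<in> H"
  then show ?thesis using assms deg_H by simp
next
  assume "\<exists>n a b h g' k. h \<in> H \<and> k \<in> H \<and> red n a b g' \<and> g = h \<otimes> g' \<otimes> k"
  then obtain n a b h1 g' h2 where g: "h1 \<in> H" "h2 \<in> H" "red n a b g'" "g = h1 \<otimes> g' \<otimes> h2" by blast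
  have "conj g v = conj h1 (conj g' (conj h2 v))" using g assms conj_conj_conj[of h1 g' h2 v] by simp
  hence "conj g' v = conj (inv h1) (conj g v)"
    using g assms conj_inv_cancel(1)[of h1 "conj g' v"] by simp
  hence "conj g' v \<in> H" using assms g by simp
  moreover have "deg g = deg g'" using g by (simp add: deg_mult deg_H)
  ultimately show ?thesis using red_conj_mem_D g assms by metis
qed

end

section \<open>Comparing two HNN extensions\<close>

lemma (in group) conj_iso:
  assumes "p \<in> carrier G"
  shows "conj p \<in> iso G G"
proof (rule isoI)
  show "conj p \<in> hom G G" using assms by (auto intro: homI simp: conj_mult)
  show "bij_betw (conj p) (carrier G) (carrier G)"
    by (rule bij_betw_byWitness[where f' = "conj (inv p)"]) (use assms in auto)
qed

lemma (in group_hom) hom_conj: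
  "g \<in> carrier G \<Longrightarrow> x \<in> carrier G \<Longrightarrow> h (G.conj g x) = H.conj (h g) (h x)"
  by (simp add: G.conj_def H.conj_def)

lemma iso_group_hom: "f \<in> iso G G' \<Longrightarrow> group G \<Longrightarrow> group G' \<Longrightarrow> group_hom G G' f"
  by (simp add: group_hom_def group_hom_axioms_def iso_def)

lemma (in hnn) hom_eqI:
  assumes "group K" "f \<in> hom G K" "f' \<in> hom G K" "\<And>v. v \<in> H \<Longrightarrow> f v = f' v" "f t = f' t" "g \<in> carrier G"
  shows "f g = f' g"
proof -
  interpret f: group_hom G K f using assms by (simp add: group_hom_def group_hom_axioms_def group_axioms)
  interpret f': group_hom G K f' using assms by (simp add: group_hom_def group_hom_axioms_def group_axioms)
  have s: "f (stable e) = f' (stable e)" for e using assms(5) by (simp add: stable_def)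
  show ?thesis using assms(6)
    by (induction rule: carrier_induct) (simp_all add: assms(4) s)
qed

text \<open>The image of \<open>H\<close> is commutative and commensurated in \<open>G'\<close>, so
  all its elements are elliptic. Finite generation turns the individual fixed vertices into a common
  one.\<close>

lemma iso_vertex_group_elliptic:
  assumes "hnn G H D t deg" "hnn G' H' D' t' deg'" "\<And>e. D' e \<noteq> H'" "f \<in> iso G G'"
  shows "\<exists>p\<in>carrier G'. \<forall>v\<in>H. group.conj G' p (f v) \<in> H'"
proof -
  interpret A: hnn G H D t deg by (rule assms(1))
  interpret B: hnn G' H' D' t' deg' by (rule assms(2))
  interpret f: group_hom G G' f
    by (rule iso_group_hom[OF assms(4) A.group_axioms B.group_axioms])
  have surj: "f ` carrier G = carrier G'" using assms(4) by (auto simp: iso_def bij_betw_def)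
  obtain S where S: "finite S" "H = generate G S" using A.H_finitely_generated by blast
  have SH: "S \<subseteq> H" unfolding S(2) by (auto intro: generate.incl)
  have ell: "B.elliptic u" if "u \<in> f ` H" for u
  proof (rule B.commensurated_elliptic[OF assms(3) _ _ _ that])
    show "f ` H \<subseteq> carrier G'" by auto
    show "x \<otimes>\<^bsub>G'\<^esub> y = y \<otimes>\<^bsub>G'\<^esub> x" if xy: "x \<in> f ` H" "y \<in> f ` H" for x y
    proof -
      obtain v w where "v \<in> H" "w \<in> H" "x = f v" "y = f w" using xy by blast
      thus ?thesis using A.H_comm[of v w] by (simp flip: f.hom_mult)
    qed
    show "\<exists>j>0. B.conj g (u [^]\<^bsub>G'\<^esub> (j::nat)) \<in> f ` H" if gu: "g \<in> carrier G'" "u \<in> f ` H" for g u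
    proof -
      obtain k v where k: "k \<in> carrier G" "g = f k" and v: "v \<in> H" "u = f v" using gu surj by blast
      obtain j where j: "j > 0" "A.conj k (v [^]\<^bsub>G\<^esub> (j::nat)) \<in> H" using A.commensurated k v by blast
      have "B.conj g (u [^]\<^bsub>G'\<^esub> j) = f (A.conj k (v [^]\<^bsub>G\<^esub> j))"
        using k v by (simp add: f.hom_conj f.hom_nat_pow)
      thus ?thesis using j by auto
    qed
  qed
  have "\<exists>p\<in>carrier G'. \<forall>u\<in>f ` S. B.conj p u \<in> H'"
  proof (rule B.finite_elliptic_common_conj)
    show "x \<otimes>\<^bsub>G'\<^esub> y = y \<otimes>\<^bsub>G'\<^esub> x" if xy: "x \<in> f ` S" "y \<in> f ` S" for x y
    proof -
      obtain v w where "v \<in> H" "w \<in> H" "x = f v" "y = f w" using xy SH by blast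
      thus ?thesis using A.H_comm[of v w] by (simp flip: f.hom_mult)
    qed
  qed (use S SH ell in auto)
  then obtain p where p: "p \<in> carrier G'" "\<forall>u\<in>f ` S. B.conj p u \<in> H'" by blast
  have "B.conj p (f v) \<in> H'" if "v \<in> H" for v
    by (rule B.conj_mem_H_of_elliptic_generators[OF f.group_hom_axioms])
       (use SH S p that in auto)
  thus ?thesis using p by blast
qed

text \<open>Both \<open>f\<close> and its inverse map one vertex group into a conjugate of the
  other. The composite of the two conjugated maps is conjugation by some \<open>k\<close> taking
  \<open>H\<close> into \<open>H\<close>; then \<open>k\<close> lies in \<open>H\<close> by
  \<open>conj_maximal\<close>, so the composite is the identity on \<open>H\<close> and the first
  inclusion is onto.\<close>

lemma exists_iso_vertex_group:
  assumes "hnn G H D t deg" "hnn G' H' D' t' deg'" "\<And>e. D e \<noteq> H" "\<And>e. D' e \<noteq> H'" "f \<in> iso G G'"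
  shows "\<exists>\<Phi>\<in>iso G G'. \<Phi> ` H = H'"
proof -
  interpret A: hnn G H D t deg by (rule assms(1))
  interpret B: hnn G' H' D' t' deg' by (rule assms(2))
  interpret f: group_hom G G' f
    by (rule iso_group_hom[OF assms(5) A.group_axioms B.group_axioms])
  define f' where "f' = inv_into (carrier G) f"
  have f': "f' \<in> iso G' G" unfolding f'_def by (rule A.iso_set_sym[OF assms(5)])
  interpret f': group_hom G' G f'
    by (rule iso_group_hom[OF f' B.group_axioms A.group_axioms])
  have bij: "bij_betw f (carrier G) (carrier G')" using assms(5) by (simp add: iso_def)
  have f'f: "f' (f x) = x" if "x \<in> carrier G" for x
    unfolding f'_def by (rule bij_betw_inv_into_left[OF bij that])
  obtain p where p: "p \<in> carrier G'" "\<forall>v\<in>H. B.conj p (f v) \<in> H'"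
    using iso_vertex_group_elliptic[OF assms(1,2,4,5)] by blast
  obtain q where q: "q \<in> carrier G" "\<forall>v\<in>H'. A.conj q (f' v) \<in> H"
    using iso_vertex_group_elliptic[OF assms(2,1,3) f'] by blast
  define k where "k = q \<otimes>\<^bsub>G\<^esub> f' p"
  have kc: "k \<in> carrier G" using p q by (simp add: k_def)
  have eq: "A.conj q (f' (B.conj p (f x))) = A.conj k x" if "x \<in> carrier G" for x
    using that p q by (simp add: f'.hom_conj f'f k_def A.conj_conj)
  have "k \<in> H"
    by (rule A.conj_maximal[OF assms(3) kc]) (use p q eq in fastforce)
  let ?\<Phi> = "B.conj p \<circ> f"
  have "?\<Phi> \<in> iso G G'"
    using iso_set_trans[OF assms(5) B.conj_iso[OF p(1)]] by (simp add: compose_def comp_def)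
  moreover have "?\<Phi> ` H = H'"
  proof
    show "?\<Phi> ` H \<subseteq> H'" using p by auto
    show "H' \<subseteq> ?\<Phi> ` H"
    proof
      fix y assume y: "y \<in> H'"
      define x where "x = A.conj q (f' y)"
      have x: "x \<in> H" using q y by (simp add: x_def)
      have "A.conj q (f' (?\<Phi> x)) = A.conj q (f' y)"
        using eq[of x] x \<open>k \<in> H\<close> by (simp flip: x_def)
      hence "f' (?\<Phi> x) = f' y"
        using q y x p by (metis A.H_closed A.conj_inv_cancel(1) B.H_closed f'.hom_closed p(2) comp_apply)
      moreover have "?\<Phi> x \<in> carrier G'" using p x by simp
      ultimately have "?\<Phi> x = y"
        using f' y by (auto simp: iso_def bij_betw_def dest: inj_onD)
      thus "y \<in> ?\<Phi> ` H" using x by blast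
    qed
  qed
  ultimately show ?thesis by blast
qed

section \<open>Degrees and edge groups under homomorphisms\<close>

lemma hom_degree:
  assumes "hnn G H D t deg" "hnn G' H' D' t' deg'" "f \<in> hom G G'" "f ` H \<subseteq> H'" "g \<in> carrier G"
  shows "deg' (f g) = deg' (f t) * deg g"
proof -
  interpret A: hnn G H D t deg by (rule assms(1))
  interpret B: hnn G' H' D' t' deg' by (rule assms(2))
  interpret f: group_hom G G' f
    using assms by (simp add: group_hom_def group_hom_axioms_def A.group_axioms B.group_axioms)
  have s: "deg' (f (A.stable e)) = deg' (f t) * deg (A.stable e)" for e
    by (simp add: A.deg_stable A.sgn_def A.stable_def A.deg_inv A.deg_t B.deg_inv)
  from assms(5) show ?thesis
  proof (induction rule: A.carrier_induct)
    case (H h g)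
    hence "f h \<in> H'" using assms(4) by blast
    then show ?case using H by (simp add: A.deg_mult B.deg_mult A.deg_H B.deg_H)
  qed (simp_all add: A.deg_one B.deg_one s A.deg_mult B.deg_mult algebra_simps)
qed

text \<open>The image of \<open>stable c\<close> may differ from \<open>stable d\<close>, but both
  have the same degree. Their quotient \<open>g\<close> has degree 0 and takes \<open>w\<close> from
  \<open>H'\<close> into \<open>H'\<close>, hence fixes it, so both elements conjugate
  \<open>f v\<close> in the same way.\<close>

lemma hom_edge_group:
  assumes "hnn G H D t deg" "hnn G' H' D' t' deg'" "f \<in> hom G G'" "f ` H \<subseteq> H'"
    and d: "deg' (f (hnn_words.stable G t c)) = hnn.sgn d" and v: "v \<in> D c"
  shows "f v \<in> D' d"
    and "f (group.conj G (hnn_words.stable G t c) v) = group.conj G' (hnn_words.stable G' t' d) (f v)"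
proof -
  interpret A: hnn G H D t deg by (rule assms(1))
  interpret B: hnn G' H' D' t' deg' by (rule assms(2))
  interpret f: group_hom G G' f
    using assms by (simp add: group_hom_def group_hom_axioms_def A.group_axioms B.group_axioms)
  define s where "s = f (A.stable c)"
  have sc: "s \<in> carrier G'" by (simp add: s_def)
  have vH: "v \<in> H" using v A.D_H by blast
  have fv: "f v \<in> H'" using vH assms(4) by blast
  have eq: "f (A.conj (A.stable c) v) = B.conj s (f v)" using vH by (simp add: f.hom_conj s_def)
  have "A.conj (A.stable c) v \<in> H" using A.stable_conj[OF v] A.D_H by blast
  hence cH: "B.conj s (f v) \<in> H'" using assms(4) eq by (metis image_subset_iff)
  have ds: "deg' s = B.sgn d" using d by (simp add: s_def)
  show D: "f v \<in> D' d"
    by (rule B.conj_mem_D[OF sc fv cH]) (auto simp: ds B.sgn_def)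
  define w where "w = B.conj (B.stable d) (f v)"
  have w: "w \<in> H'" unfolding w_def using B.stable_conj[OF D] B.D_H by blast
  define g where "g = s \<otimes>\<^bsub>G'\<^esub> B.stable (\<not> d)"
  have g: "g \<in> carrier G'" using sc by (simp add: g_def)
  have "deg' g = 0" using sc by (simp add: g_def B.deg_mult ds B.deg_stable B.sgn_def)
  moreover have gw: "B.conj g w = B.conj s (f v)"
    using sc fv by (simp add: g_def w_def B.conj_conj B.m_assoc)
  ultimately have "B.conj g w = w" using B.deg_zero_conj[OF g _ w] cH by simp
  thus "f (A.conj (A.stable c) v) = B.conj (B.stable d) (f v)" using gw eq by (simp add: w_def)
qed

theorem hnn_iso_normal_form:
  fixes G G' :: "'a monoid"
  assumes "hnn G H D t deg" "hnn G' H' D' t' deg'" "\<And>e. D e \<noteq> H" "\<And>e. D' e \<noteq> H'" "f \<in> iso G G'"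
  shows "\<exists>F\<in>iso G G'. \<exists>e. F ` H = H' \<and> F t = hnn_words.stable G' t' e \<and> F ` D True = D' e"
proof -
  interpret A: hnn G H D t deg by (rule assms(1))
  interpret B: hnn G' H' D' t' deg' by (rule assms(2))
  obtain \<Phi> where \<Phi>: "\<Phi> \<in> iso G G'" "\<Phi> ` H = H'" using exists_iso_vertex_group[OF assms] by blast
  define \<Psi> where "\<Psi> = inv_into (carrier G) \<Phi>"
  have \<Psi>: "\<Psi> \<in> iso G' G" unfolding \<Psi>_def by (rule A.iso_set_sym[OF \<Phi>(1)])
  interpret \<Phi>: group_hom G G' \<Phi> by (rule iso_group_hom[OF \<Phi>(1) A.group_axioms B.group_axioms])
  interpret \<Psi>: group_hom G' G \<Psi> by (rule iso_group_hom[OF \<Psi> B.group_axioms A.group_axioms])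
  have bij: "bij_betw \<Phi> (carrier G) (carrier G')" using \<Phi>(1) by (simp add: iso_def)
  have \<Psi>\<Phi>: "\<Psi> (\<Phi> x) = x" if "x \<in> carrier G" for x
    unfolding \<Psi>_def by (rule bij_betw_inv_into_left[OF bij that])
  have \<Phi>\<Psi>: "\<Phi> (\<Psi> x) = x" if "x \<in> carrier G'" for x
    unfolding \<Psi>_def by (rule bij_betw_inv_into_right[OF bij that])
  have \<Psi>H: "\<Psi> ` H' = H" unfolding \<Phi>(2)[symmetric] image_image using \<Psi>\<Phi> by simp
  have \<Phi>hom: "\<Phi> \<in> hom G G'" and \<Psi>hom: "\<Psi> \<in> hom G' G" using \<Phi> \<Psi> by (simp_all add: iso_def)
  have degs: "deg' (\<Phi> g) = deg' (\<Phi> t) * deg g" if "g \<in> carrier G" for g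
    using hom_degree[OF assms(1,2) \<Phi>hom _ that] \<Phi>(2) by simp
  have degs': "deg (\<Psi> g) = deg (\<Psi> t') * deg' g" if "g \<in> carrier G'" for g
    using hom_degree[OF assms(2,1) \<Psi>hom _ that] \<Psi>H by simp
  have prod: "deg (\<Psi> t') * deg' (\<Phi> t) = 1"
    using degs'[of "\<Phi> t"] \<Psi>\<Phi>[of t] A.deg_t by simp
  then obtain e where e: "deg' (\<Phi> t) = B.sgn e" "deg (\<Psi> t') = A.sgn e"
  proof -
    have "deg' (\<Phi> t) = 1 \<and> deg (\<Psi> t') = 1 \<or> deg' (\<Phi> t) = - 1 \<and> deg (\<Psi> t') = - 1"
      using prod by (auto simp: zmult_eq_1_iff)
    thus thesis using that[of True] that[of False] by (auto simp: A.sgn_def B.sgn_def)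
  qed
  \<comment> \<open>Facts \<open>1\<close> and \<open>2\<close> give the relations that allow
    \<open>\<Phi>\<close> and \<open>\<Psi>\<close> on the vertex groups to be extended by a new
    image of the stable letter. Fact \<open>3\<close> gives the inclusion of \<open>D' e\<close> in
    the image of \<open>D True\<close>.\<close>
  have 1: "deg' (\<Phi> (A.stable True)) = B.sgn e" using e by (simp add: A.stable_def)
  have 2: "deg (\<Psi> (B.stable True)) = A.sgn e" using e by (simp add: B.stable_def)
  have 3: "deg (\<Psi> (B.stable e)) = A.sgn True"
    using degs'[of "B.stable e"] e by (simp add: B.deg_stable B.sgn_def A.sgn_def)
  note edge1 = hom_edge_group[OF assms(1,2) \<Phi>hom equalityD1[OF \<Phi>(2)] 1]
  note edge2 = hom_edge_group[OF assms(2,1) \<Psi>hom equalityD1[OF \<Psi>H] 2]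
  note edge3 = hom_edge_group[OF assms(2,1) \<Psi>hom equalityD1[OF \<Psi>H] 3]
  have "\<Phi> \<in> hom (G\<lparr>carrier := H\<rparr>) G'" by (auto intro: homI)
  then obtain F where F: "F \<in> hom G G'" "\<forall>v\<in>H. F v = \<Phi> v" "F t = B.stable e"
    using A.universal[of G' \<Phi> "B.stable e"] edge1(2) B.group_axioms by (auto simp: A.stable_def)
  have "\<Psi> \<in> hom (G'\<lparr>carrier := H'\<rparr>) G" by (auto intro: homI)
  \<comment> \<open>The same sign \<open>e\<close> is used in both directions, so the two sign
    changes cancel and the composites fix \<open>t\<close> and \<open>t'\<close>.\<close>
  then obtain F' where F': "F' \<in> hom G' G" "\<forall>v\<in>H'. F' v = \<Psi> v" "F' t' = A.stable e"
    using B.universal[of G \<Psi> "A.stable e"] edge2(2) A.group_axioms by (auto simp: B.stable_def)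
  interpret F: group_hom G G' F
    using F(1) by (simp add: group_hom_def group_hom_axioms_def A.group_axioms B.group_axioms)
  interpret F': group_hom G' G F'
    using F'(1) by (simp add: group_hom_def group_hom_axioms_def A.group_axioms B.group_axioms)
  have F'F: "(F' \<circ> F) g = id g" if "g \<in> carrier G" for g
  proof (rule A.hom_eqI[OF A.group_axioms _ _ _ _ that])
    show "F' \<circ> F \<in> hom G G" using hom_compose[OF F(1) F'(1)] .
    show "id \<in> hom G G" by (auto intro: homI)
    show "(F' \<circ> F) v = id v" if "v \<in> H" for v
      using that F(2) F'(2) \<Phi>(2) \<Psi>\<Phi> by auto
    show "(F' \<circ> F) t = id t" using F(3) F'(3) by (cases e) (auto simp: B.stable_def A.stable_def)
  qed
  have FF': "(F \<circ> F') g = id g" if "g \<in> carrier G'" for g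
  proof (rule B.hom_eqI[OF B.group_axioms _ _ _ _ that])
    show "F \<circ> F' \<in> hom G' G'" using hom_compose[OF F'(1) F(1)] .
    show "id \<in> hom G' G'" by (auto intro: homI)
    show "(F \<circ> F') v = id v" if "v \<in> H'" for v
      using that F(2) F'(2) \<Psi>H \<Phi>\<Psi> by auto
    show "(F \<circ> F') t' = id t'" using F(3) F'(3) by (cases e) (auto simp: B.stable_def A.stable_def)
  qed
  have "F \<in> iso G G'"
  proof (rule isoI[OF F(1)])
    show "bij_betw F (carrier G) (carrier G')"
      by (rule bij_betw_byWitness[where f' = F']) (use F'F FF' in auto)
  qed
  moreover have "F ` H = H'" using F(2) \<Phi>(2) by auto
  moreover have "F ` D True = D' e"
  proof -
    have "F ` D True = \<Phi> ` D True" using F(2) A.D_H by (auto intro!: image_cong)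
    also have "\<dots> = D' e"
    proof
      show "\<Phi> ` D True \<subseteq> D' e" using edge1(1) by blast
      show "D' e \<subseteq> \<Phi> ` D True" using edge3(1) \<Phi>\<Psi> by (metis B.D_closed image_eqI subsetI)
    qed
    finally show ?thesis .
  qed
  ultimately show ?thesis using F(3) by blast
qed

section \<open>Equivariant isomorphisms of coset trees\<close>

text \<open>This detaches \<open>LM_tree\<close> from the presentation, so that it can be
  transported along any group isomorphism.\<close>

definition coset_tree :: "('a, 'b) monoid_scheme \<Rightarrow> 'a set \<Rightarrow> 'a set \<Rightarrow> 'a \<Rightarrow> ('a set, 'a set) graph" where
  "coset_tree G H M t =
     \<lparr>verts = {g <#\<^bsub>G\<^esub> H | g. g \<in> carrier G},
      edges = {g <#\<^bsub>G\<^esub> M | g. g \<in> carrier G},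
      incident = (\<lambda>e v. \<exists>g\<in>carrier G. e = g <#\<^bsub>G\<^esub> M \<and>
        (v = g <#\<^bsub>G\<^esub> H \<or> v = (g \<otimes>\<^bsub>G\<^esub> inv\<^bsub>G\<^esub> t) <#\<^bsub>G\<^esub> H))\<rparr>"

lemma (in group_hom) image_l_coset:
  "g \<in> carrier G \<Longrightarrow> M \<subseteq> carrier G \<Longrightarrow> h ` (g <#\<^bsub>G\<^esub> M) = h g <#\<^bsub>H\<^esub> (h ` M)"
  by (force simp: l_coset_def)

lemma (in group) lcos_rcos_assoc:
  assumes "M \<subseteq> carrier G" "g \<in> carrier G" "c \<in> carrier G"
  shows "g <# M #> c = g <# (M #> c)"
proof -
  have "g <# M #> c = (\<Union>m\<in>M. {g \<otimes> m \<otimes> c})" by (simp add: l_coset_def r_coset_def)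
  also have "\<dots> = (\<Union>m\<in>M. {g \<otimes> (m \<otimes> c)})" using assms by (intro SUP_cong) (auto simp: m_assoc subsetD)
  also have "\<dots> = g <# (M #> c)" by (simp add: l_coset_def r_coset_def)
  finally show ?thesis .
qed

text \<open>The element \<open>c\<close> is 1 if \<open>F\<close> maps \<open>t\<close> to \<open>t'\<close>, and \<open>t'\<close> if \<open>F\<close> inverts the orientation.\<close>

lemma coset_tree_iso:
  assumes "group G" "group G'" "F \<in> iso G G'"
    and H: "H \<subseteq> carrier G" "F ` H = H'"
    and M: "M \<subseteq> carrier G" "M' \<subseteq> carrier G'"
    and c: "c \<in> carrier G'" "F ` M #>\<^bsub>G'\<^esub> c = c <#\<^bsub>G'\<^esub> M'"
    and t: "t \<in> carrier G" "t' \<in> carrier G'"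
      "{H', F (inv\<^bsub>G\<^esub> t) <#\<^bsub>G'\<^esub> H'} = {c <#\<^bsub>G'\<^esub> H', (c \<otimes>\<^bsub>G'\<^esub> inv\<^bsub>G'\<^esub> t') <#\<^bsub>G'\<^esub> H'}"
  shows "\<exists>\<xi>V \<xi>E. graph_iso (coset_tree G H M t) (coset_tree G' H' M' t') \<xi>V \<xi>E \<and>
    (\<forall>g\<in>carrier G. \<forall>v\<in>verts (coset_tree G H M t). F g <#\<^bsub>G'\<^esub> \<xi>V v = \<xi>V (g <#\<^bsub>G\<^esub> v)) \<and>
    (\<forall>g\<in>carrier G. \<forall>e\<in>edges (coset_tree G H M t). F g <#\<^bsub>G'\<^esub> \<xi>E e = \<xi>E (g <#\<^bsub>G\<^esub> e))"
proof -
  interpret G: group G by (rule assms(1))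
  interpret G': group G' by (rule assms(2))
  interpret F: group_hom G G' F by (rule iso_group_hom[OF assms(3,1,2)])
  have inj: "inj_on F (carrier G)" and surj: "F ` carrier G = carrier G'"
    using assms(3) by (auto simp: iso_def bij_betw_def)
  have H': "H' \<subseteq> carrier G'" using H by auto
  have FM: "F ` M \<subseteq> carrier G'" using M by auto
  define \<xi>V where "\<xi>V C = F ` C" for C
  \<comment> \<open>If the orientation is reversed, \<open>F\<close> maps \<open>M\<close> onto the
    opposite edge group. Right translation by \<open>c\<close> turns left cosets of that group into
    left cosets of \<open>M'\<close> and commutes with the left action.\<close>
  define \<xi>E where "\<xi>E C = F ` C #>\<^bsub>G'\<^esub> c" for C
  have V: "\<xi>V (g <#\<^bsub>G\<^esub> H) = F g <#\<^bsub>G'\<^esub> H'" if "g \<in> carrier G" for g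
    using F.image_l_coset[OF that H(1)] H(2) by (simp add: \<xi>V_def)
  have E: "\<xi>E (g <#\<^bsub>G\<^esub> M) = (F g \<otimes>\<^bsub>G'\<^esub> c) <#\<^bsub>G'\<^esub> M'" if "g \<in> carrier G" for g
  proof -
    have "\<xi>E (g <#\<^bsub>G\<^esub> M) = (F g <#\<^bsub>G'\<^esub> F ` M) #>\<^bsub>G'\<^esub> c"
      using F.image_l_coset[OF that M(1)] by (simp add: \<xi>E_def)
    also have "\<dots> = F g <#\<^bsub>G'\<^esub> (F ` M #>\<^bsub>G'\<^esub> c)"
      using FM c that by (simp add: G'.lcos_rcos_assoc)
    also have "\<dots> = (F g \<otimes>\<^bsub>G'\<^esub> c) <#\<^bsub>G'\<^esub> M'"
      using c that M by (simp add: G'.lcos_m_assoc)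
    finally show ?thesis .
  qed
  have V_inj: "\<xi>V C = \<xi>V C' \<longleftrightarrow> C = C'" if "C \<subseteq> carrier G" "C' \<subseteq> carrier G" for C C'
    unfolding \<xi>V_def by (rule inj_on_image_eq_iff[OF inj that])
  have E_inj: "\<xi>E C = \<xi>E C' \<longleftrightarrow> C = C'" if "C \<subseteq> carrier G" "C' \<subseteq> carrier G" for C C'
  proof
    assume "\<xi>E C = \<xi>E C'"
    moreover have "(F ` B #>\<^bsub>G'\<^esub> c) #>\<^bsub>G'\<^esub> inv\<^bsub>G'\<^esub> c = F ` B" if "B \<subseteq> carrier G" for B
    proof -
      have "F ` B \<subseteq> carrier G'" using that by auto
      thus ?thesis using c by (simp add: G'.coset_mult_assoc G'.coset_mult_one)
    qed
    ultimately have "F ` C = F ` C'" using that unfolding \<xi>E_def by metis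
    thus "C = C'" using inj_on_image_eq_iff[OF inj that] by simp
  qed simp
  have lcc: "g <#\<^bsub>G\<^esub> C \<subseteq> carrier G" if "g \<in> carrier G" "C \<subseteq> carrier G" for g C
    by (rule G.l_coset_subset_G[OF that(2,1)])
  let ?T = "coset_tree G H M t" and ?T' = "coset_tree G' H' M' t'"
  have "graph_iso ?T ?T' \<xi>V \<xi>E"
    unfolding graph_iso_def
  proof (intro conjI ballI)
    have "\<xi>V ` verts ?T = verts ?T'"
    proof -
      have "\<xi>V ` verts ?T = (\<lambda>g. F g <#\<^bsub>G'\<^esub> H') ` carrier G"
        using V by (force simp: coset_tree_def)
      also have "\<dots> = (\<lambda>g. g <#\<^bsub>G'\<^esub> H') ` carrier G'" unfolding surj[symmetric] image_image ..
      finally show ?thesis by (auto simp: coset_tree_def)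
    qed
    moreover have "inj_on \<xi>V (verts ?T)"
      using V_inj lcc[OF _ H(1)] by (auto simp: inj_on_def coset_tree_def)
    ultimately show "bij_betw \<xi>V (verts ?T) (verts ?T')" by (simp add: bij_betw_def)
    have "\<xi>E ` edges ?T = edges ?T'"
    proof -
      have "\<xi>E ` edges ?T = (\<lambda>g. (F g \<otimes>\<^bsub>G'\<^esub> c) <#\<^bsub>G'\<^esub> M') ` carrier G"
        using E by (force simp: coset_tree_def)
      also have "\<dots> = (\<lambda>g. g <#\<^bsub>G'\<^esub> M') ` (\<lambda>g. g \<otimes>\<^bsub>G'\<^esub> c) ` carrier G'"
        unfolding surj[symmetric] image_image ..
      also have "(\<lambda>g. g \<otimes>\<^bsub>G'\<^esub> c) ` carrier G' = carrier G'"
        using c by (force simp: image_iff G'.m_assoc intro!: bexI[of _ "_ \<otimes>\<^bsub>G'\<^esub> inv\<^bsub>G'\<^esub> c"])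
      finally show ?thesis by (auto simp: coset_tree_def)
    qed
    moreover have "inj_on \<xi>E (edges ?T)"
      using E_inj lcc[OF _ M(1)] by (auto simp: inj_on_def coset_tree_def)
    ultimately show "bij_betw \<xi>E (edges ?T) (edges ?T')" by (simp add: bij_betw_def)
    fix e v assume e: "e \<in> edges ?T" and v: "v \<in> verts ?T"
    have sub: "e \<subseteq> carrier G" "v \<subseteq> carrier G" using e v lcc H M by (auto simp: coset_tree_def)
    have step: "\<xi>E e = (F g \<otimes>\<^bsub>G'\<^esub> c) <#\<^bsub>G'\<^esub> M' \<and> (\<xi>V v = (F g \<otimes>\<^bsub>G'\<^esub> c) <#\<^bsub>G'\<^esub> H' \<or>
        \<xi>V v = (F g \<otimes>\<^bsub>G'\<^esub> c \<otimes>\<^bsub>G'\<^esub> inv\<^bsub>G'\<^esub> t') <#\<^bsub>G'\<^esub> H') \<longleftrightarrow>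
      e = g <#\<^bsub>G\<^esub> M \<and> (v = g <#\<^bsub>G\<^esub> H \<or> v = (g \<otimes>\<^bsub>G\<^esub> inv\<^bsub>G\<^esub> t) <#\<^bsub>G\<^esub> H)"
      if g: "g \<in> carrier G" for g
    proof -
      have "(F g \<otimes>\<^bsub>G'\<^esub> c) <#\<^bsub>G'\<^esub> H' = F g <#\<^bsub>G'\<^esub> (c <#\<^bsub>G'\<^esub> H')"
        and "(F g \<otimes>\<^bsub>G'\<^esub> c \<otimes>\<^bsub>G'\<^esub> inv\<^bsub>G'\<^esub> t') <#\<^bsub>G'\<^esub> H' = F g <#\<^bsub>G'\<^esub> ((c \<otimes>\<^bsub>G'\<^esub> inv\<^bsub>G'\<^esub> t') <#\<^bsub>G'\<^esub> H')"
        using H' c t g by (simp_all add: G'.lcos_m_assoc G'.m_assoc)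
      \<comment> \<open>The endpoints are compared as an unordered pair because a reversed
        orientation exchanges them.\<close>
      hence "{(F g \<otimes>\<^bsub>G'\<^esub> c) <#\<^bsub>G'\<^esub> H', (F g \<otimes>\<^bsub>G'\<^esub> c \<otimes>\<^bsub>G'\<^esub> inv\<^bsub>G'\<^esub> t') <#\<^bsub>G'\<^esub> H'}
        = (\<lambda>C. F g <#\<^bsub>G'\<^esub> C) ` {c <#\<^bsub>G'\<^esub> H', (c \<otimes>\<^bsub>G'\<^esub> inv\<^bsub>G'\<^esub> t') <#\<^bsub>G'\<^esub> H'}" by simp
      also have "\<dots> = {F g <#\<^bsub>G'\<^esub> H', F g <#\<^bsub>G'\<^esub> (F (inv\<^bsub>G\<^esub> t) <#\<^bsub>G'\<^esub> H')}" unfolding t(3)[symmetric] by simp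
      also have "\<dots> = {\<xi>V (g <#\<^bsub>G\<^esub> H), \<xi>V ((g \<otimes>\<^bsub>G\<^esub> inv\<^bsub>G\<^esub> t) <#\<^bsub>G\<^esub> H)}"
        using V g t H' by (simp add: G'.lcos_m_assoc del: F.hom_inv)
      finally have "\<xi>V v = (F g \<otimes>\<^bsub>G'\<^esub> c) <#\<^bsub>G'\<^esub> H' \<or> \<xi>V v = (F g \<otimes>\<^bsub>G'\<^esub> c \<otimes>\<^bsub>G'\<^esub> inv\<^bsub>G'\<^esub> t') <#\<^bsub>G'\<^esub> H'
        \<longleftrightarrow> \<xi>V v = \<xi>V (g <#\<^bsub>G\<^esub> H) \<or> \<xi>V v = \<xi>V ((g \<otimes>\<^bsub>G\<^esub> inv\<^bsub>G\<^esub> t) <#\<^bsub>G\<^esub> H)" by blast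
      moreover have "\<xi>E e = (F g \<otimes>\<^bsub>G'\<^esub> c) <#\<^bsub>G'\<^esub> M' \<longleftrightarrow> e = g <#\<^bsub>G\<^esub> M"
        using E_inj[OF sub(1) lcc[OF g M(1)]] E[OF g] by simp
      ultimately show ?thesis
        using V_inj[OF sub(2) lcc[OF g H(1)]] V_inj[OF sub(2) lcc[OF _ H(1)], of "g \<otimes>\<^bsub>G\<^esub> inv\<^bsub>G\<^esub> t"] g t
        by simp
    qed
    have sub_c: "\<exists>g\<in>carrier G. g' = F g \<otimes>\<^bsub>G'\<^esub> c" if g': "g' \<in> carrier G'" for g'
    proof -
      obtain g where "g \<in> carrier G" "g' \<otimes>\<^bsub>G'\<^esub> inv\<^bsub>G'\<^esub> c = F g"
        using surj g' c by (metis G'.inv_closed G'.m_closed imageE)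
      thus ?thesis using g' c by (metis G'.inv_solve_right G'.inv_closed F.hom_closed G'.inv_inv)
    qed
    show "incident ?T' (\<xi>E e) (\<xi>V v) = incident ?T e v"
    proof
      assume "incident ?T' (\<xi>E e) (\<xi>V v)"
      thus "incident ?T e v" using step sub_c by (simp add: coset_tree_def) metis
    next
      assume "incident ?T e v"
      then obtain g where g: "g \<in> carrier G" "e = g <#\<^bsub>G\<^esub> M"
        "v = g <#\<^bsub>G\<^esub> H \<or> v = (g \<otimes>\<^bsub>G\<^esub> inv\<^bsub>G\<^esub> t) <#\<^bsub>G\<^esub> H" by (auto simp: coset_tree_def)
      with step[OF g(1)] c show "incident ?T' (\<xi>E e) (\<xi>V v)"
        by (auto simp: coset_tree_def intro!: bexI[of _ "F g \<otimes>\<^bsub>G'\<^esub> c"])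
    qed
  qed
  moreover have "F g <#\<^bsub>G'\<^esub> \<xi>V v = \<xi>V (g <#\<^bsub>G\<^esub> v)" if g: "g \<in> carrier G" and v: "v \<in> verts ?T" for g v
  proof -
    from v obtain k where k: "k \<in> carrier G" "v = k <#\<^bsub>G\<^esub> H" by (auto simp: coset_tree_def)
    thus ?thesis using V[OF k(1)] V[of "g \<otimes>\<^bsub>G\<^esub> k"] g H H' by (simp add: G.lcos_m_assoc G'.lcos_m_assoc)
  qed
  moreover have "F g <#\<^bsub>G'\<^esub> \<xi>E e = \<xi>E (g <#\<^bsub>G\<^esub> e)" if g: "g \<in> carrier G" and e: "e \<in> edges ?T" for g e
  proof -
    from e obtain k where k: "k \<in> carrier G" "e = k <#\<^bsub>G\<^esub> M" by (auto simp: coset_tree_def)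
    thus ?thesis using E[OF k(1)] E[of "g \<otimes>\<^bsub>G\<^esub> k"] g M c
      by (simp add: G.lcos_m_assoc G'.lcos_m_assoc G'.m_assoc)
  qed
  ultimately show ?thesis by blast
qed

theorem hnn_iso_coset_tree:
  fixes G G' :: "'a monoid"
  assumes "hnn G H D t deg" "hnn G' H' D' t' deg'" "\<And>e. D e \<noteq> H" "\<And>e. D' e \<noteq> H'" "f \<in> iso G G'"
  shows "\<exists>\<Phi> \<xi>V \<xi>E. \<Phi> \<in> iso G G' \<and>
    graph_iso (coset_tree G H (D True) t) (coset_tree G' H' (D' True) t') \<xi>V \<xi>E \<and>
    (\<forall>g\<in>carrier G. \<forall>v\<in>verts (coset_tree G H (D True) t). \<Phi> g <#\<^bsub>G'\<^esub> \<xi>V v = \<xi>V (g <#\<^bsub>G\<^esub> v)) \<and>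
    (\<forall>g\<in>carrier G. \<forall>e\<in>edges (coset_tree G H (D True) t). \<Phi> g <#\<^bsub>G'\<^esub> \<xi>E e = \<xi>E (g <#\<^bsub>G\<^esub> e))"
proof -
  interpret A: hnn G H D t deg by (rule assms(1))
  interpret B: hnn G' H' D' t' deg' by (rule assms(2))
  obtain F e where F: "F \<in> iso G G'" "F ` H = H'" "F t = B.stable e" "F ` D True = D' e"
    using hnn_iso_normal_form[OF assms] by blast
  interpret F: group_hom G G' F by (rule iso_group_hom[OF F(1) A.group_axioms B.group_axioms])
  define c where "c = (if e then \<one>\<^bsub>G'\<^esub> else t')"
  have c: "c \<in> carrier G'" by (simp add: c_def)
  have H: "H \<subseteq> carrier G" "H' \<subseteq> carrier G'" by auto
  have D: "D True \<subseteq> carrier G" "D' d \<subseteq> carrier G'" for d by auto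
  have M: "F ` D True #>\<^bsub>G'\<^esub> c = c <#\<^bsub>G'\<^esub> D' True"
  proof (cases e)
    case True
    then show ?thesis using D by (simp add: F c_def B.coset_mult_one B.lcos_mult_one)
  next
    case False
    have "D' False #>\<^bsub>G'\<^esub> t' = t' <#\<^bsub>G'\<^esub> D' True"
    proof (intro equalityI subsetI)
      fix x assume "x \<in> D' False #>\<^bsub>G'\<^esub> t'"
      then obtain v where v: "v \<in> D' False" "x = v \<otimes>\<^bsub>G'\<^esub> t'" by (auto simp: r_coset_def)
      hence "x = t' \<otimes>\<^bsub>G'\<^esub> B.conj (inv\<^bsub>G'\<^esub> t') v" by (simp add: B.conj_def B.m_assoc)
      thus "x \<in> t' <#\<^bsub>G'\<^esub> D' True" using B.t_conj_inv[OF v(1)] by (auto simp: l_coset_def)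
    next
      fix x assume "x \<in> t' <#\<^bsub>G'\<^esub> D' True"
      then obtain v where v: "v \<in> D' True" "x = t' \<otimes>\<^bsub>G'\<^esub> v" by (auto simp: l_coset_def)
      hence "x = B.conj t' v \<otimes>\<^bsub>G'\<^esub> t'" by (simp add: B.conj_def B.m_assoc)
      thus "x \<in> D' False #>\<^bsub>G'\<^esub> t'" using B.t_conj[OF v(1)] by (auto simp: r_coset_def)
    qed
    then show ?thesis using False by (simp add: F c_def)
  qed
  \<comment> \<open>If \<open>e\<close> is false, both \<open>F (inv t)\<close> and \<open>c\<close>
    are \<open>t'\<close>, and the two endpoints trade places.\<close>
  have t: "{H', F (inv\<^bsub>G\<^esub> t) <#\<^bsub>G'\<^esub> H'} = {c <#\<^bsub>G'\<^esub> H', (c \<otimes>\<^bsub>G'\<^esub> inv\<^bsub>G'\<^esub> t') <#\<^bsub>G'\<^esub> H'}"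
    using H by (auto simp: F c_def B.stable_def B.lcos_mult_one)
  show ?thesis
    using coset_tree_iso[OF A.group_axioms B.group_axioms F(1) H(1) F(2) D(1) D(2) c M A.t_closed B.t_closed t] F(1)
    by blast
qed

section \<open>Actions of words\<close>

text \<open>Letters act as mutually inverse permutations of \<open>X\<close>, and related words act
  alike; the action then descends to the presented group, the last letter of a word acting first. It
  is used with normal forms for Britton's lemma, with the integers for the degree, with rational
  vectors for the linear part, and with a target group for the universal property.\<close>

locale word_action =
  fixes S :: "'a set" and R :: "('a word \<times> 'a word) set"
    and X :: "'x set" and act :: "'a \<times> bool \<Rightarrow> 'x \<Rightarrow> 'x"
  assumes act_closed: "a \<in> S \<Longrightarrow> x \<in> X \<Longrightarrow> act (a, e) x \<in> X"
    and act_cancel: "a \<in> S \<Longrightarrow> x \<in> X \<Longrightarrow> act (a, e) (act (a, \<not> e) x) = x"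
    and act_relator: "\<lbrakk>(u, v) \<in> R; u \<in> words S; v \<in> words S; x \<in> X\<rbrakk> \<Longrightarrow> foldr act u x = foldr act v x"
begin

lemma foldr_closed: "w \<in> words S \<Longrightarrow> x \<in> X \<Longrightarrow> foldr act w x \<in> X"
  by (induction w) (auto simp: words_def act_closed)

lemma pres_rel_foldr: "(u, v) \<in> pres_rel S R \<Longrightarrow> x \<in> X \<Longrightarrow> foldr act u x = foldr act v x"
proof (induction arbitrary: x rule: pres_rel.induct)
  case (pres_append u u' v v')
  hence "foldr act v' x \<in> X" using foldr_closed pres_rel_words by blast
  then show ?case using pres_append by simp
qed (simp_all add: act_cancel act_relator)

definition class_act :: "'a word set \<Rightarrow> 'x \<Rightarrow> 'x" where
  "class_act C x = foldr act (SOME w. w \<in> C) x"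

lemma class_act_class:
  assumes "w \<in> words S" "x \<in> X"
  shows "class_act (pres_class S R w) x = foldr act w x"
proof -
  have "w \<in> pres_class S R w" using assms by (simp add: pres_class_def pres_refl)
  hence "(SOME u. u \<in> pres_class S R w) \<in> pres_class S R w" by (rule someI)
  hence "(w, SOME u. u \<in> pres_class S R w) \<in> pres_rel S R" by (simp add: pres_class_def)
  from pres_rel_foldr[OF this assms(2)] show ?thesis by (simp add: class_act_def)
qed

lemma class_act_mult:
  assumes "g \<in> carrier (presented_group S R)" "h \<in> carrier (presented_group S R)" "x \<in> X"
  shows "class_act (g \<otimes>\<^bsub>presented_group S R\<^esub> h) x = class_act g (class_act h x)"
    and "class_act h x \<in> X"
proof -
  obtain u v where "u \<in> words S" "v \<in> words S" "g = pres_class S R u" "h = pres_class S R v"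
    using assms by (auto simp: carrier_presented_group)
  moreover from this have "u @ v \<in> words S" by (simp add: words_def)
  ultimately show "class_act (g \<otimes>\<^bsub>presented_group S R\<^esub> h) x = class_act g (class_act h x)"
    "class_act h x \<in> X"
    using assms foldr_closed by (simp_all add: mult_presented_group class_act_class)
qed

end

section \<open>The action on normal forms\<close>

text \<open>The pair \<open>(h, [(e\<^sub>1, r\<^sub>1), \<dots>, (e\<^sub>k, r\<^sub>k)])\<close> stands for the element
  \<open>h \<cdot> stable e\<^sub>1 \<cdot> r\<^sub>1 \<cdots> stable e\<^sub>k \<cdot> r\<^sub>k\<close> with coset representatives \<open>r\<^sub>i\<close>.\<close>

locale normal_forms =
  fixes P :: "bool \<Rightarrow> 'h :: ab_group_add set" and \<phi> :: "bool \<Rightarrow> 'h \<Rightarrow> 'h"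
  assumes P_zero: "0 \<in> P e"
    and P_add: "x \<in> P e \<Longrightarrow> y \<in> P e \<Longrightarrow> x + y \<in> P e"
    and P_uminus: "x \<in> P e \<Longrightarrow> - x \<in> P e"
    and \<phi>_mem: "x \<in> P e \<Longrightarrow> \<phi> e x \<in> P (\<not> e)"
    and \<phi>_add: "x \<in> P e \<Longrightarrow> y \<in> P e \<Longrightarrow> \<phi> e (x + y) = \<phi> e x + \<phi> e y"
    and \<phi>_inverse: "x \<in> P e \<Longrightarrow> \<phi> (\<not> e) (\<phi> e x) = x"
begin

lemma P_add_iff: "d \<in> P e \<Longrightarrow> d + h \<in> P e \<longleftrightarrow> h \<in> P e"
  using P_add[of "- d" e "d + h"] P_uminus[of d e] P_add[of d e h] by auto

text \<open>The value of \<open>SOME\<close> depends only on its predicate, hence only on the coset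
  of \<open>h\<close>. The trivial coset gets 0, so a zero representative detects membership in
  \<open>P e\<close>.\<close>

definition rep :: "bool \<Rightarrow> 'h \<Rightarrow> 'h" where
  "rep e h = (if h \<in> P e then 0 else SOME r. h - r \<in> P e)"

lemma rep_mem: "h - rep e h \<in> P e"
  using someI[of "\<lambda>r. h - r \<in> P e" h] by (simp add: rep_def P_zero)

lemma rep_add: "d \<in> P e \<Longrightarrow> rep e (d + h) = rep e h"
  using P_add_iff[of d e] by (simp add: rep_def add_diff_eq[symmetric])

lemma rep_zero_iff: "rep e h = 0 \<longleftrightarrow> h \<in> P e"
  using rep_mem[of h e] by (auto simp: rep_def)

lemma rep_idem: "rep e (rep e h) = rep e h"
  using rep_add[OF rep_mem[of h e], of "rep e h"] by simp

text \<open>The clause for \<open>r = 0\<close> forbids \<open>stable e\<close> next to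
  \<open>stable (\<not> e)\<close>. As 0 represents the trivial coset, this is reducedness in the
  sense of Britton.\<close>

fun valid :: "(bool \<times> 'h) list \<Rightarrow> bool" where
  "valid [] = True"
| "valid ((e, r) # ls) = (rep e r = r \<and> (r = 0 \<longrightarrow> ls = [] \<or> fst (hd ls) = e) \<and> valid ls)"

text \<open>Left multiplication by \<open>stable e\<close>. In the second branch the part
  \<open>h - rep e h\<close>, which lies in \<open>P e\<close>, crosses the new letter by means of
  \<open>\<phi>\<close>, and the representative stays behind it; in the first branch two letters
  cancel.\<close>

fun tau :: "bool \<Rightarrow> 'h \<times> (bool \<times> 'h) list \<Rightarrow> 'h \<times> (bool \<times> 'h) list" where
  "tau e (h, ls) = (if ls \<noteq> [] \<and> fst (hd ls) = (\<not> e) \<and> h \<in> P e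
     then (\<phi> e h + snd (hd ls), tl ls) else (\<phi> e (h - rep e h), (e, rep e h) # ls))"

lemma valid_tau: "valid ls \<Longrightarrow> valid (snd (tau e (h, ls)))"
  by (cases ls) (auto simp: rep_idem rep_zero_iff)

lemma tau_cancel:
  assumes "valid ls"
  shows "tau (\<not> e) (tau e (h, ls)) = (h, ls)"
proof (cases "ls \<noteq> [] \<and> fst (hd ls) = (\<not> e) \<and> h \<in> P e")
  case True
  then obtain r ls' where ls: "ls = (\<not> e, r) # ls'" by (cases ls) auto
  have r: "rep (\<not> e) r = r" "r = 0 \<longrightarrow> ls' = [] \<or> fst (hd ls') = (\<not> e)" using assms ls by auto
  have rep: "rep (\<not> e) (\<phi> e h + r) = r" using rep_add[OF \<phi>_mem[of h e], of r] True r by simp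
  \<comment> \<open>The inverse letter has to recreate the removed one and must not cancel further.
    Membership in \<open>P (\<not> e)\<close> would mean \<open>r = 0\<close>, and then validity
    excludes a following letter of sign \<open>e\<close>.\<close>
  have "\<not> (ls' \<noteq> [] \<and> fst (hd ls') = e \<and> \<phi> e h + r \<in> P (\<not> e))"
    using r(2) rep_zero_iff[of "\<not> e" "\<phi> e h + r"] unfolding rep by auto
  then show ?thesis using True ls rep \<phi>_inverse[of h e] by auto
next
  case False
  hence "tau e (h, ls) = (\<phi> e (h - rep e h), (e, rep e h) # ls)" by (simp only: tau.simps if_False)
  then show ?thesis using \<phi>_mem[OF rep_mem] \<phi>_inverse[OF rep_mem] by simp
qed

text \<open>On normal forms this is the rule that \<open>d\<close> in \<open>P e\<close> crosses
  \<open>stable e\<close> from right to left as \<open>\<phi> e d\<close>.\<close>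

lemma tau_add:
  "d \<in> P e \<Longrightarrow> tau e (d + h, ls) = (\<phi> e d + fst (tau e (h, ls)), snd (tau e (h, ls)))"
  using \<phi>_add[OF _ rep_mem[of h e], of d] \<phi>_add[of d e h]
  by (auto simp: rep_add P_add_iff add.assoc add_diff_eq)

end

section \<open>Leary--Minasyan groups\<close>

lemma (in group) generate_commute:
  assumes "S \<subseteq> carrier G" "\<And>x y. x \<in> S \<Longrightarrow> y \<in> S \<Longrightarrow> x \<otimes> y = y \<otimes> x"
    and "x \<in> generate G S" "y \<in> generate G S"
  shows "x \<otimes> y = y \<otimes> x"
proof -
  have step: "x \<otimes> y = y \<otimes> x"
    if y: "y \<in> carrier G" and S: "\<And>s. s \<in> S \<Longrightarrow> s \<otimes> y = y \<otimes> s" and x: "x \<in> generate G S" for x y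
    using x assms(1)
  proof (induction rule: generate_induct_left)
    case (mult s g)
    have s: "s \<in> carrier G" using mult assms by blast
    have "s \<otimes> g \<otimes> y = s \<otimes> y \<otimes> g" using mult s y by (simp add: m_assoc)
    then show ?case using S[OF mult(1)] mult s y by (simp add: m_assoc)
  next
    case (inv_mult s g)
    have s: "s \<in> carrier G" using inv_mult assms by blast
    have c: "inv s \<otimes> y = y \<otimes> inv s"
      using S[OF inv_mult(1)] s y by (metis inv_closed inv_solve_left inv_solve_right m_assoc m_closed)
    have "inv s \<otimes> g \<otimes> y = inv s \<otimes> y \<otimes> g" using inv_mult s y by (simp add: m_assoc)
    then show ?case using c inv_mult s y by (simp add: m_assoc)
  qed (use y in simp)
  have gen: "z \<in> carrier G" if "z \<in> generate G S" for z using that assms(1) generate_in_carrier by blast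
  have "s \<otimes> y = y \<otimes> s" if "s \<in> S" for s
    by (rule step[of s y, symmetric]) (use that assms gen in auto)
  thus ?thesis using step assms gen by blast
qed

lemma rat_vec_denominator:
  assumes "q \<in> carrier_vec n"
  shows "\<exists>d>0. \<exists>w\<in>carrier_vec n. rat_of_nat d \<cdot>\<^sub>v q = int_to_rat_vec w"
proof -
  have ex: "\<exists>d>0::nat. rat_of_nat d * x \<in> \<int>" for x :: rat
  proof -
    obtain a b where ab: "x = Fract a b" "b > 0" by (cases x)
    have "rat_of_nat (nat b) * x = rat_of_int a"
      using ab by (simp add: Fract_of_int_quotient)
    thus ?thesis using ab by (metis Ints_of_int zero_less_nat_eq)
  qed
  obtain d where "\<forall>i. d i > (0::nat) \<and> rat_of_nat (d i) * q $ i \<in> \<int>"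
    using choice[of "\<lambda>i d. d > 0 \<and> rat_of_nat d * q $ i \<in> \<int>"] ex by blast
  hence d: "d i > 0" "rat_of_nat (d i) * q $ i \<in> \<int>" for i by auto
  define e where "e = (\<Prod>i<n. d i)"
  have "rat_of_nat e * q $ i \<in> \<int>" if "i < n" for i
  proof -
    have "e = (\<Prod>j\<in>{..<n} - {i}. d j) * d i" unfolding e_def using that
      by (simp add: prod.remove[of "{..<n}" i] mult.commute)
    hence "rat_of_nat e * q $ i = rat_of_nat (\<Prod>j\<in>{..<n} - {i}. d j) * (rat_of_nat (d i) * q $ i)"
      by simp
    thus ?thesis using d(2) by (metis Ints_mult Ints_of_nat)
  qed
  moreover have fl: "of_int \<lfloor>x\<rfloor> = x" if "x \<in> \<int>" for x :: rat
    using that by (metis Ints_cases of_int_floor_cancel)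
  ultimately have "rat_of_nat e \<cdot>\<^sub>v q = int_to_rat_vec (vec n (\<lambda>i. \<lfloor>rat_of_nat e * q $ i\<rfloor>))"
    using assms by (intro eq_vecI) (auto simp: fl)
  moreover have "e > 0" using d by (simp add: e_def prod_pos)
  ultimately show ?thesis by (intro exI[of _ e]) auto
qed

text \<open>Here \<open>Y\<close> parametrizes an orbit of the letters \<open>LM_x i\<close> by exponent functions.\<close>

lemma foldr_x_word:
  fixes Y :: "(nat \<Rightarrow> int) \<Rightarrow> 'x"
  assumes "\<And>i e f. i < dim_vec v \<Longrightarrow> act (LM_x i, e) (Y f) = Y (f(i := f i + (if e then 1 else - 1)))"
  shows "foldr act (x_word v) (Y f) = Y (\<lambda>i. f i + (if i < dim_vec v then v $ i else 0))"
proof -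
  have rep: "foldr act (replicate m (LM_x i, e)) (Y f) = Y (f(i := f i + (if e then int m else - int m)))"
    if "i < dim_vec v" for i e m f
  proof (induction m)
    case 0
    have "f(i := f i + (if e then int 0 else - int 0)) = f" by (auto simp: fun_eq_iff)
    then show ?case by (simp only: replicate_0 foldr.simps id_apply)
  next
    case (Suc m)
    define g where "g = f(i := f i + (if e then int m else - int m))"
    have "g(i := g i + (if e then 1 else - 1)) = f(i := f i + (if e then int (Suc m) else - int (Suc m)))"
      by (auto simp: g_def fun_eq_iff)
    then show ?case using assms[OF that, of e g] Suc.IH[folded g_def]
      by (simp only: replicate_Suc foldr.simps comp_apply)
  qed
  have "foldr act (concat (map (\<lambda>i. replicate (nat \<bar>v $ i\<bar>) (LM_x i, v $ i \<ge> 0)) [0..<k])) (Y f)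
      = Y (\<lambda>i. f i + (if i < k then v $ i else 0))" if "k \<le> dim_vec v" for k f
    using that
  proof (induction k arbitrary: f)
    case 0
    then show ?case by simp
  next
    case (Suc k)
    define g where "g = f(k := f k + (if v $ k \<ge> 0 then int (nat \<bar>v $ k\<bar>) else - int (nat \<bar>v $ k\<bar>)))"
    let ?F = "\<lambda>i. replicate (nat \<bar>v $ i\<bar>) (LM_x i, v $ i \<ge> 0)"
    have "foldr act (concat (map ?F [0..<Suc k])) (Y f)
      = foldr act (concat (map ?F [0..<k])) (foldr act (?F k) (Y f))" by simp
    also have "foldr act (?F k) (Y f) = Y g"
      unfolding g_def by (rule rep) (use Suc in simp)
    also have "foldr act (concat (map ?F [0..<k])) (Y g) = Y (\<lambda>i. g i + (if i < k then v $ i else 0))"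
      using Suc by simp
    also have "(\<lambda>i. g i + (if i < k then v $ i else 0)) = (\<lambda>i. f i + (if i < Suc k then v $ i else 0))"
      by (auto simp: g_def less_Suc_eq)
    finally show ?case .
  qed
  from this[of "dim_vec v"] show ?thesis by (simp add: x_word_def)
qed

text \<open>The inverse matrix is a parameter so that both directions of the edge isomorphism have
  the same form, \<open>Mat True\<close> and \<open>Mat False\<close>.\<close>

locale leary_minasyan =
  fixes n :: nat and A B :: "rat mat" and L :: "int vec set"
  assumes A: "A \<in> carrier_mat n n" and B: "B \<in> carrier_mat n n"
    and AB: "A * B = 1\<^sub>m n" and BA: "B * A = 1\<^sub>m n"
    and L: "finite_index_subgroup L (lm_lattice A)"
begin

lemma dim_row_A [simp]: "dim_row A = n"
  using A by simp

subsection \<open>The lattices\<close>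

definition Mat :: "bool \<Rightarrow> rat mat" where
  "Mat e = (if e then A else B)"

lemma Mat_carrier [simp]: "Mat e \<in> carrier_mat n n"
  using A B by (simp add: Mat_def)

lemma Mat_vec_carrier [simp]: "q \<in> carrier_vec n \<Longrightarrow> Mat e *\<^sub>v q \<in> carrier_vec n"
  by (rule mult_mat_vec_carrier[OF Mat_carrier])

lemma Mat_cancel [simp]:
  assumes "q \<in> carrier_vec n"
  shows "Mat e *\<^sub>v (Mat (\<not> e) *\<^sub>v q) = q" "Mat (\<not> e) *\<^sub>v (Mat e *\<^sub>v q) = q"
proof -
  have "Mat e * Mat (\<not> e) = 1\<^sub>m n" "Mat (\<not> e) * Mat e = 1\<^sub>m n" by (simp_all add: Mat_def AB BA)
  moreover have "Mat e *\<^sub>v (Mat (\<not> e) *\<^sub>v q) = Mat e * Mat (\<not> e) *\<^sub>v q"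
    "Mat (\<not> e) *\<^sub>v (Mat e *\<^sub>v q) = Mat (\<not> e) * Mat e *\<^sub>v q"
    by (rule assoc_mult_mat_vec[OF Mat_carrier Mat_carrier assms, symmetric])+
  ultimately show "Mat e *\<^sub>v (Mat (\<not> e) *\<^sub>v q) = q" "Mat (\<not> e) *\<^sub>v (Mat e *\<^sub>v q) = q" using assms by simp_all
qed

definition Lat :: "bool \<Rightarrow> int vec set" where
  "Lat e = (if e then L else {w \<in> carrier_vec n. \<exists>v\<in>L. A *\<^sub>v int_to_rat_vec v = int_to_rat_vec w})"

lemma int_to_rat_vec_add:
  "v \<in> carrier_vec n \<Longrightarrow> w \<in> carrier_vec n \<Longrightarrow> int_to_rat_vec (v + w) = int_to_rat_vec v + int_to_rat_vec w"
  by (intro eq_vecI) auto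

lemma int_to_rat_vec_uminus: "int_to_rat_vec (- v) = - int_to_rat_vec v"
  by (intro eq_vecI) auto

lemma int_to_rat_vec_inj: "int_to_rat_vec v = int_to_rat_vec w \<Longrightarrow> v = w"
  by (metis eq_vecI index_map_vec of_int_eq_iff)

lemma Mat_int_add:
  assumes "v \<in> carrier_vec n" "w \<in> carrier_vec n"
  shows "Mat e *\<^sub>v int_to_rat_vec (v + w) = Mat e *\<^sub>v int_to_rat_vec v + Mat e *\<^sub>v int_to_rat_vec w"
  using assms by (simp add: int_to_rat_vec_add mult_add_distrib_mat_vec[OF Mat_carrier])

lemma Mat_int_uminus:
  assumes "v \<in> carrier_vec n"
  shows "Mat e *\<^sub>v int_to_rat_vec (- v) = - (Mat e *\<^sub>v int_to_rat_vec v)"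
  unfolding int_to_rat_vec_uminus
  by (intro eq_vecI) (use assms A B in \<open>auto simp: Mat_def carrier_vecD\<close>)

lemma carrier_lm_lattice: "v \<in> carrier (lm_lattice A) \<longleftrightarrow>
    v \<in> carrier_vec n \<and> (\<exists>w\<in>carrier_vec n. A *\<^sub>v int_to_rat_vec v = int_to_rat_vec w)"
  by (auto simp: lm_lattice_def)

lemma lm_lattice_simps: "x \<otimes>\<^bsub>lm_lattice A\<^esub> y = x + y" "\<one>\<^bsub>lm_lattice A\<^esub> = 0\<^sub>v n"
  by (simp_all add: lm_lattice_def monoid_vec_def)

lemma lm_lattice_uminus: "v \<in> carrier (lm_lattice A) \<Longrightarrow> - v \<in> carrier (lm_lattice A)"
  using Mat_int_uminus[of v True]
  by (auto simp: carrier_lm_lattice Mat_def int_to_rat_vec_uminus intro!: bexI[of _ "- _"])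

lemma group_lm_lattice: "group (lm_lattice A)"
proof (rule groupI)
  show "x \<otimes>\<^bsub>lm_lattice A\<^esub> y \<in> carrier (lm_lattice A)"
    if xy: "x \<in> carrier (lm_lattice A)" "y \<in> carrier (lm_lattice A)" for x y
  proof -
    obtain v w where "v \<in> carrier_vec n" "w \<in> carrier_vec n" "A *\<^sub>v int_to_rat_vec x = int_to_rat_vec v"
      "A *\<^sub>v int_to_rat_vec y = int_to_rat_vec w" using xy by (auto simp: carrier_lm_lattice)
    thus ?thesis using xy Mat_int_add[of x y True]
      by (auto simp: carrier_lm_lattice lm_lattice_simps Mat_def int_to_rat_vec_add intro!: bexI[of _ "v + w"])
  qed
  have "A *\<^sub>v int_to_rat_vec (0\<^sub>v n) = int_to_rat_vec (0\<^sub>v n)"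
    by (intro eq_vecI) (use A in \<open>auto simp: scalar_prod_def\<close>)
  thus "\<one>\<^bsub>lm_lattice A\<^esub> \<in> carrier (lm_lattice A)"
    by (auto simp: carrier_lm_lattice lm_lattice_simps intro!: bexI[of _ "0\<^sub>v n"])
  show "\<exists>y\<in>carrier (lm_lattice A). y \<otimes>\<^bsub>lm_lattice A\<^esub> x = \<one>\<^bsub>lm_lattice A\<^esub>"
    if "x \<in> carrier (lm_lattice A)" for x
    using lm_lattice_uminus[OF that] that
    by (intro bexI[of _ "- x"]) (auto simp: lm_lattice_simps carrier_lm_lattice)
qed (auto simp: lm_lattice_simps carrier_lm_lattice)

lemma L_subgroup: "subgroup L (lm_lattice A)"
  using L by (simp add: finite_index_subgroup_def)

lemma Lat_carrier: "v \<in> Lat e \<Longrightarrow> v \<in> carrier_vec n"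
  using subgroup.subset[OF L_subgroup] carrier_lm_lattice by (auto simp: Lat_def split: if_splits)

lemma L_image: "v \<in> L \<Longrightarrow> \<exists>w\<in>carrier_vec n. A *\<^sub>v int_to_rat_vec v = int_to_rat_vec w"
  using subgroup.subset[OF L_subgroup] carrier_lm_lattice by auto

lemma L_zero: "0\<^sub>v n \<in> L"
  using subgroup.one_closed[OF L_subgroup] by (simp add: lm_lattice_simps)

lemma L_add: "v \<in> L \<Longrightarrow> w \<in> L \<Longrightarrow> v + w \<in> L"
  using subgroup.m_closed[OF L_subgroup] by (simp add: lm_lattice_simps)

lemma L_uminus:
  assumes "v \<in> L"
  shows "- v \<in> L"
proof -
  interpret group "lm_lattice A" by (rule group_lm_lattice)
  have v: "v \<in> carrier (lm_lattice A)" using assms subgroup.subset[OF L_subgroup] by blast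
  have "inv\<^bsub>lm_lattice A\<^esub> v = - v"
    using v lm_lattice_uminus[OF v] by (intro inv_equality) (auto simp: lm_lattice_simps carrier_lm_lattice)
  thus ?thesis using subgroup.m_inv_closed[OF L_subgroup assms] by simp
qed

text \<open>On \<open>Lat e\<close> the product is already integral, and \<open>floor\<close> only
  changes the type of its entries.\<close>

definition edge_map :: "bool \<Rightarrow> int vec \<Rightarrow> int vec" where
  "edge_map e v = map_vec floor (Mat e *\<^sub>v int_to_rat_vec v)"

lemma edge_map_eq:
  assumes "Mat e *\<^sub>v int_to_rat_vec v = int_to_rat_vec w"
  shows "edge_map e v = w"
  unfolding edge_map_def assms by (intro eq_vecI) auto

lemma edge_map:
  assumes "v \<in> Lat e"
  shows "edge_map e v \<in> Lat (\<not> e)" "int_to_rat_vec (edge_map e v) = Mat e *\<^sub>v int_to_rat_vec v"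
proof -
  have "\<exists>w\<in>Lat (\<not> e). Mat e *\<^sub>v int_to_rat_vec v = int_to_rat_vec w"
  proof (cases e)
    case True
    then show ?thesis using assms L_image[of v] by (auto simp: Lat_def Mat_def)
  next
    case False
    then obtain u where u: "u \<in> L" "A *\<^sub>v int_to_rat_vec u = int_to_rat_vec v"
      using assms by (auto simp: Lat_def)
    have "Mat False *\<^sub>v (Mat True *\<^sub>v int_to_rat_vec u) = int_to_rat_vec u"
      using Mat_cancel(1)[of "int_to_rat_vec u" False] Lat_carrier[of u True] u by (simp add: Lat_def)
    then show ?thesis using u False by (auto simp: Lat_def Mat_def)
  qed
  thus "edge_map e v \<in> Lat (\<not> e)" "int_to_rat_vec (edge_map e v) = Mat e *\<^sub>v int_to_rat_vec v"
    using edge_map_eq by auto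
qed

lemma Lat_zero: "0\<^sub>v n \<in> Lat e"
proof -
  have "A *\<^sub>v int_to_rat_vec (0\<^sub>v n) = int_to_rat_vec (0\<^sub>v n)"
    by (intro eq_vecI) (use A in \<open>auto simp: scalar_prod_def\<close>)
  thus ?thesis using L_zero by (auto simp: Lat_def)
qed

lemma Lat_add:
  assumes "v \<in> Lat e" "w \<in> Lat e"
  shows "v + w \<in> Lat e"
proof (cases e)
  case True
  then show ?thesis using assms L_add by (simp add: Lat_def)
next
  case False
  then obtain a b where "a \<in> L" "A *\<^sub>v int_to_rat_vec a = int_to_rat_vec v"
    "b \<in> L" "A *\<^sub>v int_to_rat_vec b = int_to_rat_vec w" using assms by (auto simp: Lat_def)
  moreover from this have "a \<in> carrier_vec n" "b \<in> carrier_vec n"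
    using Lat_carrier[of _ True] by (simp_all add: Lat_def)
  ultimately have "A *\<^sub>v int_to_rat_vec (a + b) = int_to_rat_vec (v + w)" "a + b \<in> L"
    using Mat_int_add[of a b True] assms[THEN Lat_carrier] L_add
    by (simp_all add: Mat_def int_to_rat_vec_add)
  then show ?thesis using False assms[THEN Lat_carrier] by (auto simp: Lat_def)
qed

lemma Lat_uminus:
  assumes "v \<in> Lat e"
  shows "- v \<in> Lat e"
proof (cases e)
  case True
  then show ?thesis using assms L_uminus by (simp add: Lat_def)
next
  case False
  then obtain a where a: "a \<in> L" "A *\<^sub>v int_to_rat_vec a = int_to_rat_vec v"
    using assms by (auto simp: Lat_def)
  hence "A *\<^sub>v int_to_rat_vec (- a) = int_to_rat_vec (- v)"
    using Mat_int_uminus[of a True] Lat_carrier[of a True]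
    by (simp add: Mat_def Lat_def int_to_rat_vec_uminus)
  then show ?thesis using False Lat_carrier[OF assms] L_uminus[OF a(1)] by (auto simp: Lat_def)
qed

lemma edge_map_add:
  assumes "v \<in> Lat e" "w \<in> Lat e"
  shows "edge_map e (v + w) = edge_map e v + edge_map e w"
proof (rule edge_map_eq)
  have "edge_map e v \<in> carrier_vec n" "edge_map e w \<in> carrier_vec n"
    using assms edge_map(1) Lat_carrier by blast+
  thus "Mat e *\<^sub>v int_to_rat_vec (v + w) = int_to_rat_vec (edge_map e v + edge_map e w)"
    unfolding Mat_int_add[OF assms[THEN Lat_carrier]]
    using assms[THEN edge_map(2)] by (simp only: int_to_rat_vec_add)
qed

lemma edge_map_inverse:
  assumes "v \<in> Lat e"
  shows "edge_map (\<not> e) (edge_map e v) = v"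
  by (rule edge_map_eq) (use assms Lat_carrier edge_map in simp)

text \<open>By the pigeonhole principle two multiples of \<open>v\<close> lie in the same one of the
  finitely many cosets; their difference is the required multiple.\<close>

lemma L_multiple:
  assumes "v \<in> carrier (lm_lattice A)"
  shows "\<exists>j>0. of_nat j \<cdot>\<^sub>v v \<in> L"
proof -
  interpret group "lm_lattice A" by (rule group_lm_lattice)
  have vn: "v \<in> carrier_vec n" using assms carrier_lm_lattice by blast
  have pow: "of_nat j \<cdot>\<^sub>v v \<in> carrier (lm_lattice A)" for j
  proof -
    have "of_nat j \<cdot>\<^sub>v v = v [^]\<^bsub>lm_lattice A\<^esub> j"
    proof (induction j)
      case 0
      then show ?case using vn by (auto simp: lm_lattice_simps)
    next
      case (Suc j)
      have "of_nat (Suc j) \<cdot>\<^sub>v v = of_nat j \<cdot>\<^sub>v v + v"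
        by (intro eq_vecI) (auto simp: algebra_simps)
      then show ?case using Suc by (simp add: lm_lattice_simps)
    qed
    thus ?thesis using assms by simp
  qed
  define c where "c j = L #>\<^bsub>lm_lattice A\<^esub> (of_nat j \<cdot>\<^sub>v v)" for j :: nat
  have "c j \<in> rcosets\<^bsub>lm_lattice A\<^esub> L" for j
    unfolding c_def using pow subgroup.subset[OF L_subgroup] by (intro rcosetsI)
  hence "range c \<subseteq> rcosets\<^bsub>lm_lattice A\<^esub> L" by blast
  moreover have "finite (rcosets\<^bsub>lm_lattice A\<^esub> L)" using L by (simp add: finite_index_subgroup_def)
  ultimately have "finite (range c)" by (rule finite_subset)
  hence "\<not> inj c" using finite_imageD by blast
  then obtain j k where jk: "j < k" "c j = c k" by (metis injI linorder_neqE_nat)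
  have "of_nat k \<cdot>\<^sub>v v \<in> c k" unfolding c_def by (rule rcos_self[OF pow L_subgroup])
  then obtain h where h: "h \<in> L" "of_nat k \<cdot>\<^sub>v v = h + of_nat j \<cdot>\<^sub>v v"
    unfolding jk(2)[symmetric] by (auto simp: c_def r_coset_def lm_lattice_simps)
  have "h \<in> carrier_vec n" using h(1) Lat_carrier[of h True] by (simp add: Lat_def)
  have "h = of_nat (k - j) \<cdot>\<^sub>v v"
  proof (rule eq_vecI)
    fix i assume "i < dim_vec (of_nat (k - j) \<cdot>\<^sub>v v)"
    hence i: "i < n" using vn by simp
    have "(of_nat k \<cdot>\<^sub>v v) $ i = (h + of_nat j \<cdot>\<^sub>v v) $ i" using h(2) by simp
    thus "h $ i = (of_nat (k - j) \<cdot>\<^sub>v v) $ i"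
      using i vn \<open>h \<in> carrier_vec n\<close> jk(1) by (simp add: of_nat_diff algebra_simps)
  qed (use vn \<open>h \<in> carrier_vec n\<close> in simp)
  thus ?thesis using h(1) jk(1) by (intro exI[of _ "k - j"]) auto
qed

text \<open>Clearing denominators reduces the claim to \<open>L_multiple\<close>. For
  \<open>Lat False\<close> this is done for the preimage
  \<open>B *\<^sub>v int_to_rat_vec v\<close>, and \<open>A\<close> carries the resulting multiple
  back.\<close>

lemma Lat_multiple:
  assumes "v \<in> carrier_vec n"
  shows "\<exists>j>0. of_nat j \<cdot>\<^sub>v v \<in> Lat e"
proof (cases e)
  case True
  have Av: "A *\<^sub>v int_to_rat_vec v \<in> carrier_vec n" using A assms by simp
  obtain d w where d: "d > 0" "w \<in> carrier_vec n" "rat_of_nat d \<cdot>\<^sub>v (A *\<^sub>v int_to_rat_vec v) = int_to_rat_vec w"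
    using rat_vec_denominator[OF Av] by blast
  have "int_to_rat_vec (of_nat d \<cdot>\<^sub>v v) = rat_of_nat d \<cdot>\<^sub>v int_to_rat_vec v"
    by (intro eq_vecI) auto
  hence "A *\<^sub>v int_to_rat_vec (of_nat d \<cdot>\<^sub>v v) = int_to_rat_vec w"
    using d(3) A assms by (simp add: mult_mat_vec)
  hence "of_nat d \<cdot>\<^sub>v v \<in> carrier (lm_lattice A)" using d assms by (auto simp: carrier_lm_lattice)
  from L_multiple[OF this] obtain j where j: "j > 0" "of_nat j \<cdot>\<^sub>v (of_nat d \<cdot>\<^sub>v v) \<in> L" by blast
  have "of_nat j \<cdot>\<^sub>v (of_nat d \<cdot>\<^sub>v v) = of_nat (j * d) \<cdot>\<^sub>v v" by (intro eq_vecI) auto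
  then show ?thesis using j d True by (intro exI[of _ "j * d"]) (auto simp: Lat_def)
next
  case False
  have Bv: "B *\<^sub>v int_to_rat_vec v \<in> carrier_vec n" using B assms by simp
  obtain d w where d: "d > 0" "w \<in> carrier_vec n" "rat_of_nat d \<cdot>\<^sub>v (B *\<^sub>v int_to_rat_vec v) = int_to_rat_vec w"
    using rat_vec_denominator[OF Bv] by blast
  have ABv: "A *\<^sub>v (B *\<^sub>v int_to_rat_vec v) = int_to_rat_vec v"
    using Mat_cancel(1)[of "int_to_rat_vec v" True] assms by (simp add: Mat_def)
  have w: "A *\<^sub>v int_to_rat_vec w = int_to_rat_vec (of_nat d \<cdot>\<^sub>v v)"
  proof -
    have "A *\<^sub>v int_to_rat_vec w = rat_of_nat d \<cdot>\<^sub>v (A *\<^sub>v (B *\<^sub>v int_to_rat_vec v))"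
      unfolding d(3)[symmetric] using A Bv by (simp add: mult_mat_vec)
    also have "\<dots> = int_to_rat_vec (of_nat d \<cdot>\<^sub>v v)" unfolding ABv by (intro eq_vecI) auto
    finally show ?thesis .
  qed
  hence "w \<in> carrier (lm_lattice A)" using d assms by (auto simp: carrier_lm_lattice)
  from L_multiple[OF this] obtain j where j: "j > 0" "of_nat j \<cdot>\<^sub>v w \<in> L" by blast
  have "int_to_rat_vec (of_nat j \<cdot>\<^sub>v w) = rat_of_nat j \<cdot>\<^sub>v int_to_rat_vec w" by (intro eq_vecI) auto
  hence "A *\<^sub>v int_to_rat_vec (of_nat j \<cdot>\<^sub>v w) = rat_of_nat j \<cdot>\<^sub>v int_to_rat_vec (of_nat d \<cdot>\<^sub>v v)"
    using A d w by (simp add: mult_mat_vec)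
  also have "\<dots> = int_to_rat_vec (of_nat (j * d) \<cdot>\<^sub>v v)" by (intro eq_vecI) auto
  finally have "of_nat (j * d) \<cdot>\<^sub>v v \<in> Lat False" using j assms by (auto simp: Lat_def)
  then show ?thesis using j d False by (intro exI[of _ "j * d"]) auto
qed

subsection \<open>The vertex group\<close>

abbreviation G :: "lm_gen word set monoid" where "G \<equiv> LM_group A L"

abbreviation cls :: "lm_gen word \<Rightarrow> lm_gen word set" where "cls \<equiv> lm_class A L"

abbreviation W :: "lm_gen word set" where "W \<equiv> words (lm_gens n)"

lemma G_eq: "G = presented_group (lm_gens n) (lm_relations A L)"
  by (simp add: LM_group_def)

lemma cls_eq: "cls w = pres_class (lm_gens n) (lm_relations A L) w"
  by (simp add: lm_class_def)

sublocale G: group G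
  unfolding G_eq by (rule group_presented_group)

lemma carrier_G: "carrier G = cls ` W"
  unfolding G_eq by (simp add: carrier_presented_group lm_class_def)

lemma cls_closed [simp]: "w \<in> W \<Longrightarrow> cls w \<in> carrier G"
  by (simp add: carrier_G)

lemma cls_append: "u \<in> W \<Longrightarrow> v \<in> W \<Longrightarrow> cls (u @ v) = cls u \<otimes>\<^bsub>G\<^esub> cls v"
  unfolding G_eq cls_eq by (simp add: mult_presented_group)

lemma cls_Nil: "cls [] = \<one>\<^bsub>G\<^esub>"
  by (simp add: G_eq cls_eq presented_group_def)

lemma words_simps [simp]:
  "[] \<in> W" "(a, e) # w \<in> W \<longleftrightarrow> a \<in> lm_gens n \<and> w \<in> W" "u @ v \<in> W \<longleftrightarrow> u \<in> W \<and> v \<in> W"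
  by (auto simp: words_def)

lemma lm_gens_simps [simp]: "LM_t \<in> lm_gens n" "LM_x i \<in> lm_gens n \<longleftrightarrow> i < n"
  by (auto simp: lm_gens_def)

lemma x_word_W [simp]: "v \<in> carrier_vec n \<Longrightarrow> x_word v \<in> W"
  by (auto simp: x_word_def words_def)

lemma cls_relator: "(u, v) \<in> lm_relations A L \<Longrightarrow> u \<in> W \<Longrightarrow> v \<in> W \<Longrightarrow> cls u = cls v"
  by (simp add: cls_eq pres_class_eq_iff pres_relator)

lemma cls_Cons: "(a, e) # w \<in> W \<Longrightarrow> cls ((a, e) # w) = cls [(a, e)] \<otimes>\<^bsub>G\<^esub> cls w"
  using cls_append[of "[(a, e)]" w] by simp

lemma cls_inverse:
  assumes "a \<in> lm_gens n"
  shows "cls [(a, \<not> e)] = inv\<^bsub>G\<^esub> cls [(a, e)]"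
proof -
  have "([(a, \<not> e), (a, \<not> \<not> e)], []) \<in> pres_rel (lm_gens n) (lm_relations A L)"
    using assms by (rule pres_cancel)
  hence "cls [(a, \<not> e), (a, e)] = \<one>\<^bsub>G\<^esub>"
    using assms by (simp add: cls_eq pres_class_eq_iff flip: cls_Nil)
  hence "cls [(a, \<not> e)] \<otimes>\<^bsub>G\<^esub> cls [(a, e)] = \<one>\<^bsub>G\<^esub>"
    using assms cls_Cons[of a "\<not> e" "[(a, e)]"] by simp
  thus ?thesis using assms by (intro G.inv_equality[symmetric]) auto
qed

lemma cls_foldr: "w \<in> W \<Longrightarrow> cls w = foldr (\<lambda>l x. cls [l] \<otimes>\<^bsub>G\<^esub> x) w \<one>\<^bsub>G\<^esub>"
proof (induction w)
  case Nil
  then show ?case by (simp add: cls_Nil)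
next
  case (Cons l w)
  then show ?case using cls_Cons[of "fst l" "snd l" w] by (cases l) simp
qed

abbreviation H :: "lm_gen word set set" where "H \<equiv> LM_H A L"

definition gen_x :: "nat \<Rightarrow> lm_gen word set" where
  "gen_x i = cls [(LM_x i, True)]"

lemma H_def: "H = generate G (gen_x ` {..<n})"
  by (simp add: LM_H_def gen_x_def)

lemma gen_x_closed [simp]: "i < n \<Longrightarrow> gen_x i \<in> carrier G"
  by (simp add: gen_x_def)

lemma gen_x_commute:
  assumes "i < n" "j < n"
  shows "gen_x i \<otimes>\<^bsub>G\<^esub> gen_x j = gen_x j \<otimes>\<^bsub>G\<^esub> gen_x i"
proof -
  have "gen_x i \<otimes>\<^bsub>G\<^esub> gen_x j = gen_x j \<otimes>\<^bsub>G\<^esub> gen_x i" if ij: "i < j" "j < n" for i j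
  proof -
    have "cls [(LM_x i, True), (LM_x j, True), (LM_x i, False), (LM_x j, False)] = \<one>\<^bsub>G\<^esub>"
      unfolding cls_Nil[symmetric] using ij by (intro cls_relator) (auto simp: lm_relations_def)
    hence "gen_x i \<otimes>\<^bsub>G\<^esub> (gen_x j \<otimes>\<^bsub>G\<^esub> (inv\<^bsub>G\<^esub> gen_x i \<otimes>\<^bsub>G\<^esub> inv\<^bsub>G\<^esub> gen_x j)) = \<one>\<^bsub>G\<^esub>"
      using ij cls_inverse[of "LM_x i" True] cls_inverse[of "LM_x j" True]
      by (simp add: gen_x_def cls_Cons[of _ _ "_ # _"])
    hence "gen_x i \<otimes>\<^bsub>G\<^esub> gen_x j \<otimes>\<^bsub>G\<^esub> inv\<^bsub>G\<^esub> (gen_x j \<otimes>\<^bsub>G\<^esub> gen_x i) = \<one>\<^bsub>G\<^esub>"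
      using ij by (simp add: G.m_assoc G.inv_mult_group)
    from G.inv_equality[OF this] show ?thesis using ij by simp
  qed
  thus ?thesis using assms by (metis linorder_neqE_nat)
qed

lemma gen_x_subset: "gen_x ` {..<n} \<subseteq> carrier G"
  by auto

lemma H_subgroup: "subgroup H G"
  unfolding H_def by (rule G.generate_is_subgroup[OF gen_x_subset])

lemma H_commute: "x \<in> H \<Longrightarrow> y \<in> H \<Longrightarrow> x \<otimes>\<^bsub>G\<^esub> y = y \<otimes>\<^bsub>G\<^esub> x"
  unfolding H_def by (rule G.generate_commute[OF gen_x_subset]) (auto simp: gen_x_commute)

lemma gen_x_H: "i < n \<Longrightarrow> gen_x i \<in> H"
  unfolding H_def by (auto intro: generate.incl)

lemma comm_group_H: "comm_group (G\<lparr>carrier := H\<rparr>)"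
  by (rule group.group_comm_groupI[OF subgroup.subgroup_is_group[OF H_subgroup G.group_axioms]])
     (simp add: H_commute)

section \<open>Parametrization of the vertex group by integer vectors\<close>

interpretation K: comm_group "G\<lparr>carrier := H\<rparr>"
  by (rule comm_group_H)

text \<open>A word \<open>x_word v\<close> lists its letters in a fixed order. A product over a
  finite set in the commutative group \<open>H\<close> forgets the order, which makes additivity in
  the exponents available.\<close>

definition power_product :: "(nat \<Rightarrow> int) \<Rightarrow> lm_gen word set" where
  "power_product f = finprod (G\<lparr>carrier := H\<rparr>) (\<lambda>i. gen_x i [^]\<^bsub>G\<lparr>carrier := H\<rparr>\<^esub> f i) {..<n}"

lemma power_product_H: "power_product f \<in> H"
  using K.finprod_closed[of "\<lambda>i. gen_x i [^]\<^bsub>G\<lparr>carrier := H\<rparr>\<^esub> f i" "{..<n}"]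
  by (auto simp: power_product_def gen_x_H K.int_pow_closed[simplified])

lemma power_product_add:
  "power_product (\<lambda>i. f i + g i) = power_product f \<otimes>\<^bsub>G\<^esub> power_product g"
proof -
  have "power_product (\<lambda>i. f i + g i) = finprod (G\<lparr>carrier := H\<rparr>)
     (\<lambda>i. gen_x i [^]\<^bsub>G\<lparr>carrier := H\<rparr>\<^esub> f i \<otimes>\<^bsub>G\<lparr>carrier := H\<rparr>\<^esub> gen_x i [^]\<^bsub>G\<lparr>carrier := H\<rparr>\<^esub> g i) {..<n}"
    unfolding power_product_def
    by (rule K.finprod_cong') (auto simp: gen_x_H K.int_pow_mult[simplified] intro!: K.m_closed[simplified] K.int_pow_closed[simplified])
  also have "\<dots> = power_product f \<otimes>\<^bsub>G\<^esub> power_product g"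
    unfolding power_product_def
    by (subst K.finprod_multf) (auto simp: gen_x_H intro!: K.int_pow_closed[simplified])
  finally show ?thesis .
qed

lemma power_product_single:
  assumes "i < n"
  shows "power_product (\<lambda>j. if j = i then (if e then 1 else - 1) else 0) = cls [(LM_x i, e)]"
proof -
  have e: "gen_x i [^]\<^bsub>G\<lparr>carrier := H\<rparr>\<^esub> (if e then 1 else - 1 :: int) = cls [(LM_x i, e)]"
  proof (cases e)
    case True
    then show ?thesis using gen_x_H[OF assms] K.int_pow_1[of "gen_x i"] by (simp add: gen_x_def)
  next
    case False
    then show ?thesis
      using gen_x_H[OF assms] K.int_pow_neg[of "gen_x i" 1] K.int_pow_1[of "gen_x i"]
        G.m_inv_consistent[OF H_subgroup] cls_inverse[of "LM_x i" True] assms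
      by (simp add: gen_x_def)
  qed
  have clsH: "cls [(LM_x i, e)] \<in> H"
    using gen_x_H[OF assms] cls_inverse[of "LM_x i" True] assms subgroup.m_inv_closed[OF H_subgroup, of "gen_x i"]
    by (cases e) (simp_all add: gen_x_def)
  have "power_product (\<lambda>j. if j = i then (if e then 1 else - 1) else 0)
    = finprod (G\<lparr>carrier := H\<rparr>) (\<lambda>j. if i = j then cls [(LM_x i, e)] else \<one>\<^bsub>G\<lparr>carrier := H\<rparr>\<^esub>) {..<n}"
    unfolding power_product_def
    by (rule K.finprod_cong') (use e clsH subgroup.one_closed[OF H_subgroup] in auto)
  also have "\<dots> = cls [(LM_x i, e)]"
    by (rule K.finprod_singleton) (use assms clsH in auto)
  finally show ?thesis .
qed

text \<open>Vectors form a group only inside a fixed \<open>carrier_vec n\<close>, whereas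
  \<open>normal_forms\<close> asks for a type of class \<open>ab_group_add\<close>; functions
  \<open>nat \<Rightarrow> int\<close> are one. Extension by 0 keeps the translation additive and
  injective on \<open>carrier_vec n\<close>.\<close>

definition fun_of :: "int vec \<Rightarrow> nat \<Rightarrow> int" where
  "fun_of v i = (if i < n then v $ i else 0)"

lemma cls_x_word:
  assumes "v \<in> carrier_vec n"
  shows "cls (x_word v) = power_product (fun_of v)"
proof -
  have upd: "f(i := f i + c) = (\<lambda>j. (if j = i then c else 0) + f j)" for f :: "nat \<Rightarrow> int" and i c
    by auto
  have "power_product (\<lambda>i. 0) = \<one>\<^bsub>G\<^esub>"
    using K.finprod_one_eqI[of "{..<n}"] by (simp add: power_product_def)
  hence "cls (x_word v) = foldr (\<lambda>l x. cls [l] \<otimes>\<^bsub>G\<^esub> x) (x_word v) (power_product (\<lambda>i. 0))"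
    using assms by (simp add: cls_foldr)
  also have "\<dots> = power_product (\<lambda>i. 0 + (if i < dim_vec v then v $ i else 0))"
    by (rule foldr_x_word) (use assms in \<open>simp only: upd power_product_add power_product_single carrier_vecD\<close>)
  finally show ?thesis using assms by (simp add: fun_of_def[abs_def])
qed

abbreviation xi :: "int vec \<Rightarrow> lm_gen word set" where "xi v \<equiv> cls (x_word v)"

lemma fun_of_add: "v \<in> carrier_vec n \<Longrightarrow> w \<in> carrier_vec n \<Longrightarrow> fun_of (v + w) = (\<lambda>i. fun_of v i + fun_of w i)"
  by (auto simp: fun_of_def)

lemma xi_hom: "group_hom (monoid_vec TYPE(int) n) G xi"
proof -
  have "xi \<in> hom (monoid_vec TYPE(int) n) G"
    by (rule homI)
       (auto simp: monoid_vec_def cls_x_word fun_of_add power_product_add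
         intro: subgroup.mem_carrier[OF H_subgroup power_product_H])
  thus ?thesis using comm_group_vec[where 'a = int, of n] G.group_axioms
    by (simp add: group_hom_def group_hom_axioms_def comm_group_def)
qed

lemma H_eq: "H = xi ` carrier_vec n"
proof
  interpret xi: group_hom "monoid_vec TYPE(int) n" G xi by (rule xi_hom)
  have sub: "subgroup (xi ` carrier_vec n) G" using xi.img_is_subgroup by (simp add: monoid_vec_def)
  have "gen_x i \<in> xi ` carrier_vec n" if "i < n" for i
  proof -
    have "fun_of (unit_vec n i) = (\<lambda>j. if j = i then (if True then 1 else - 1) else 0)"
      using that by (auto simp: fun_of_def)
    hence "xi (unit_vec n i) = gen_x i"
      using power_product_single[OF that, of True] by (simp add: cls_x_word gen_x_def)
    thus ?thesis by (metis image_eqI unit_vec_carrier)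
  qed
  thus "H \<subseteq> xi ` carrier_vec n"
    unfolding H_def by (intro G.generate_subgroup_incl[OF _ sub]) auto
  show "xi ` carrier_vec n \<subseteq> H" by (auto simp: cls_x_word power_product_H)
qed

end

context leary_minasyan
begin

subsection \<open>Britton's lemma\<close>

lemma fun_of_plus: "v \<in> carrier_vec n \<Longrightarrow> w \<in> carrier_vec n \<Longrightarrow> fun_of (v + w) = fun_of v + fun_of w"
  by (auto simp: fun_of_def plus_fun_def)

lemma fun_of_uminus: "v \<in> carrier_vec n \<Longrightarrow> fun_of (- v) = - fun_of v"
  by (auto simp: fun_of_def fun_Compl_def)

lemma vec_fun_of [simp]: "v \<in> carrier_vec n \<Longrightarrow> vec n (fun_of v) = v"
  by (auto simp: fun_of_def)

definition P :: "bool \<Rightarrow> (nat \<Rightarrow> int) set" where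
  "P e = fun_of ` Lat e"

definition phi :: "bool \<Rightarrow> (nat \<Rightarrow> int) \<Rightarrow> nat \<Rightarrow> int" where
  "phi e f = fun_of (edge_map e (vec n f))"

lemma phi_fun_of: "v \<in> Lat e \<Longrightarrow> phi e (fun_of v) = fun_of (edge_map e v)"
  using Lat_carrier by (simp add: phi_def)

lemma fun_of_P_iff:
  assumes v: "v \<in> carrier_vec n"
  shows "fun_of v \<in> P e \<longleftrightarrow> v \<in> Lat e"
proof
  assume "fun_of v \<in> P e"
  then obtain w where w: "w \<in> Lat e" "fun_of v = fun_of w" by (auto simp: P_def)
  from w(2) have "vec n (fun_of v) = vec n (fun_of w)" by simp
  thus "v \<in> Lat e" using v w(1) Lat_carrier[OF w(1)] by simp
qed (simp add: P_def)

sublocale nf: normal_forms P phi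
proof
  fix e x y assume x: "x \<in> P e"
  then obtain v where v: "v \<in> Lat e" "x = fun_of v" by (auto simp: P_def)
  show "- x \<in> P e" using v Lat_uminus[OF v(1)] fun_of_uminus[OF Lat_carrier[OF v(1)]]
    unfolding P_def by (metis imageI)
  show "phi e x \<in> P (\<not> e)" using v edge_map(1)[OF v(1)] by (auto simp: P_def phi_fun_of)
  show "phi (\<not> e) (phi e x) = x"
    using v edge_map(1)[OF v(1)] edge_map_inverse[OF v(1)] by (simp add: phi_fun_of)
  assume y: "y \<in> P e"
  then obtain w where w: "w \<in> Lat e" "y = fun_of w" by (auto simp: P_def)
  have plus: "x + y = fun_of (v + w)"
    using v w Lat_carrier by (simp add: fun_of_plus)
  show "x + y \<in> P e" unfolding plus P_def using Lat_add[OF v(1) w(1)] by blast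
  have "edge_map e v \<in> carrier_vec n" "edge_map e w \<in> carrier_vec n"
    using v w edge_map(1) Lat_carrier by blast+
  thus "phi e (x + y) = phi e x + phi e y"
    unfolding plus using v w by (simp add: phi_fun_of Lat_add edge_map_add fun_of_plus)
next
  fix e
  have "fun_of (0\<^sub>v n) = 0" by (auto simp: fun_of_def)
  thus "0 \<in> P e" using Lat_zero[of e] unfolding P_def by (metis imageI)
qed

definition act_nf :: "lm_gen \<times> bool \<Rightarrow> (nat \<Rightarrow> int) \<times> (bool \<times> (nat \<Rightarrow> int)) list
    \<Rightarrow> (nat \<Rightarrow> int) \<times> (bool \<times> (nat \<Rightarrow> int)) list" where
  "act_nf l x = (case fst l of
     LM_x i \<Rightarrow> ((fst x)(i := fst x i + (if snd l then 1 else - 1)), snd x)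
   | LM_t \<Rightarrow> nf.tau (snd l) x)"

lemma act_nf_x_word:
  assumes "v \<in> carrier_vec n"
  shows "foldr act_nf (x_word v) x = (fun_of v + fst x, snd x)"
proof -
  have "foldr act_nf (x_word v) (fst x, snd x) = (\<lambda>i. fst x i + (if i < dim_vec v then v $ i else 0), snd x)"
    by (rule foldr_x_word[where Y = "\<lambda>f. (f, snd x)"]) (simp add: act_nf_def)
  thus ?thesis using assms by (simp add: fun_of_def[abs_def] plus_fun_def add.commute)
qed

lemma lm_relations_cases:
  assumes "(u, v) \<in> lm_relations A L"
  obtains (comm) i j where "i < j" "j < n"
      "u = [(LM_x i, True), (LM_x j, True), (LM_x i, False), (LM_x j, False)]" "v = []"
    | (stable) a b where "a \<in> L" "a \<in> carrier_vec n" "b \<in> carrier_vec n"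
      "A *\<^sub>v int_to_rat_vec a = int_to_rat_vec b"
      "u = [(LM_t, True)] @ x_word a @ [(LM_t, False)]" "v = x_word b"
  using assms Lat_carrier[of _ True] by (auto simp: lm_relations_def Lat_def)

lemma L_edge_map: "a \<in> L \<Longrightarrow> A *\<^sub>v int_to_rat_vec a = int_to_rat_vec b \<Longrightarrow> edge_map True a = b"
  by (rule edge_map_eq) (simp add: Mat_def)

sublocale nfa: word_action "lm_gens n" "lm_relations A L" "{x. nf.valid (snd x)}" act_nf
proof
  fix a e and x :: "(nat \<Rightarrow> int) \<times> (bool \<times> (nat \<Rightarrow> int)) list"
  assume x: "x \<in> {x. nf.valid (snd x)}"
  obtain f ls where fls: "x = (f, ls)" by (cases x)
  show "act_nf (a, e) x \<in> {x. nf.valid (snd x)}"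
    using x nf.valid_tau[of ls e f] fls by (cases a) (simp_all add: act_nf_def del: nf.tau.simps)
  show "act_nf (a, e) (act_nf (a, \<not> e) x) = x"
    using x nf.tau_cancel[of ls "\<not> e" f] fls by (cases a) (auto simp: act_nf_def simp del: nf.tau.simps)
next
  fix u v and x :: "(nat \<Rightarrow> int) \<times> (bool \<times> (nat \<Rightarrow> int)) list"
  assume "(u, v) \<in> lm_relations A L" and x: "x \<in> {x. nf.valid (snd x)}"
  then show "foldr act_nf u x = foldr act_nf v x"
  proof (cases rule: lm_relations_cases)
    case (comm i j)
    then show ?thesis by (cases x) (auto simp: act_nf_def fun_eq_iff)
  next
    case (stable a b)
    obtain f ls where fls: "x = (f, ls)" by (cases x)
    obtain f' ls' where t: "nf.tau False x = (f', ls')" by (cases "nf.tau False x")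
    \<comment> \<open>In the action of the relator, \<open>fun_of a\<close> is added between
      \<open>tau False\<close> and \<open>tau True\<close>. By \<open>tau_add\<close> it leaves
      \<open>tau True\<close> as \<open>fun_of b\<close>, and the remaining two letters undo each
      other.\<close>
    have undo: "nf.tau True (f', ls') = (f, ls)"
      using nf.tau_cancel[of ls False f] x fls t by simp
    have a: "fun_of a \<in> P True" using stable fun_of_P_iff by (simp add: Lat_def)
    have "phi True (fun_of a) = fun_of b"
      using stable phi_fun_of[of a True] L_edge_map by (simp add: Lat_def)
    hence "nf.tau True (fun_of a + f', ls') = (fun_of b + f, ls)"
      using nf.tau_add[OF a, of f' ls'] undo by simp
    moreover have "foldr act_nf u x = nf.tau True (foldr act_nf (x_word a) (nf.tau False x))"
      using stable by (simp add: act_nf_def del: nf.tau.simps)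
    ultimately show ?thesis using stable t fls by (simp add: act_nf_x_word del: nf.tau.simps)
  qed
qed

definition t :: "lm_gen word set" where
  "t = cls [(LM_t, True)]"

definition D :: "bool \<Rightarrow> lm_gen word set set" where
  "D e = xi ` Lat e"

lemma conj_t_xi:
  assumes "v \<in> L"
  shows "G.conj t (xi v) = xi (edge_map True v)"
proof -
  have v: "v \<in> Lat True" "v \<in> carrier_vec n" using assms Lat_carrier[of v True] by (simp_all add: Lat_def)
  have w: "edge_map True v \<in> carrier_vec n" using edge_map(1)[OF v(1)] Lat_carrier by blast
  have "A *\<^sub>v int_to_rat_vec v = int_to_rat_vec (edge_map True v)"
    using edge_map(2)[OF v(1)] by (simp add: Mat_def)
  hence "([(LM_t, True)] @ x_word v @ [(LM_t, False)], x_word (edge_map True v)) \<in> lm_relations A L"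
    using assms w by (auto simp: lm_relations_def)
  hence "cls ([(LM_t, True)] @ x_word v @ [(LM_t, False)]) = xi (edge_map True v)"
    using v w by (intro cls_relator) auto
  moreover have "cls ([(LM_t, True)] @ x_word v @ [(LM_t, False)]) = G.conj t (xi v)"
    using v cls_inverse[of LM_t True]
    by (simp add: cls_append[of "[_]" "_ @ _", simplified] cls_append t_def G.conj_def G.m_assoc)
  ultimately show ?thesis by simp
qed

lemma Lat_subgroup: "subgroup (Lat e) (monoid_vec TYPE(int) n)"
proof -
  interpret Z: comm_group "monoid_vec TYPE(int) n" by (rule comm_group_vec)
  show ?thesis
  proof (rule Z.subgroupI)
    show "Lat e \<subseteq> carrier (monoid_vec TYPE(int) n)" using Lat_carrier by (auto simp: monoid_vec_def)
    show "Lat e \<noteq> {}" using Lat_zero by blast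
    show "inv\<^bsub>monoid_vec TYPE(int) n\<^esub> v \<in> Lat e" if v: "v \<in> Lat e" for v
    proof -
      have "inv\<^bsub>monoid_vec TYPE(int) n\<^esub> v = - v"
        using Lat_carrier[OF v] by (intro Z.inv_equality) (auto simp: monoid_vec_def)
      thus ?thesis using Lat_uminus[OF v] by simp
    qed
  qed (simp add: monoid_vec_def Lat_add)
qed

lemma carrier_G_generate: "carrier G = generate G (insert t H)"
proof
  have sub: "insert t H \<subseteq> carrier G"
    using subgroup.subset[OF H_subgroup] by (auto simp: t_def)
  have gen: "subgroup (generate G (insert t H)) G" by (rule G.generate_is_subgroup[OF sub])
  have letter: "cls [(a, e)] \<in> generate G (insert t H)" if "a \<in> lm_gens n" for a e
  proof -
    have "cls [(a, True)] \<in> insert t H"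
      using that gen_x_H by (auto simp: lm_gens_def t_def gen_x_def)
    hence "cls [(a, True)] \<in> generate G (insert t H)" by (rule generate.incl)
    thus ?thesis using that cls_inverse[of a True] subgroup.m_inv_closed[OF gen] by (cases e) auto
  qed
  have "cls w \<in> generate G (insert t H)" if "w \<in> W" for w
    using that
  proof (induction w)
    case Nil
    then show ?case by (simp add: cls_Nil generate.one)
  next
    case (Cons l w)
    then show ?case
      using cls_Cons[of "fst l" "snd l" w] letter subgroup.m_closed[OF gen] by (cases l) simp
  qed
  thus "carrier G \<subseteq> generate G (insert t H)" by (auto simp: carrier_G)
  show "generate G (insert t H) \<subseteq> carrier G" by (rule G.generate_incl[OF sub])
qed

sublocale words: hnn_words G H D t
proof (intro hnn_words.intro hnn_words_axioms.intro)
  show "group G" by (rule G.group_axioms)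
next
  interpret xi: group_hom "monoid_vec TYPE(int) n" G xi by (rule xi_hom)
  show tc: "t \<in> carrier G" by (simp add: t_def)
  show "subgroup H G" by (rule H_subgroup)
  show "x \<otimes>\<^bsub>G\<^esub> y = y \<otimes>\<^bsub>G\<^esub> x" if "x \<in> H" "y \<in> H" for x y using that by (rule H_commute)
  show "subgroup (D e) G" for e unfolding D_def by (rule xi.subgroup_img_is_subgroup[OF Lat_subgroup])
  show "D e \<subseteq> H" for e using Lat_carrier by (auto simp: D_def H_eq)
  show "carrier G = generate G (insert t H)" by (rule carrier_G_generate)
  show "G.conj t x \<in> D False" if "x \<in> D True" for x
    using that conj_t_xi edge_map(1)[of _ True] by (auto simp: D_def Lat_def)
  show "G.conj (inv\<^bsub>G\<^esub> t) x \<in> D True" if x: "x \<in> D False" for x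
  proof -
    obtain w where w: "w \<in> Lat False" "x = xi w" using x by (auto simp: D_def)
    define v where "v = edge_map False w"
    have v: "v \<in> L" "edge_map True v = w"
      using edge_map(1)[OF w(1)] edge_map_inverse[OF w(1)] by (simp_all add: v_def Lat_def)
    hence "x = G.conj t (xi v)" using conj_t_xi w by simp
    moreover have "xi v \<in> carrier G" using v Lat_carrier[of v True] by (simp add: Lat_def)
    ultimately have "G.conj (inv\<^bsub>G\<^esub> t) x = xi v" using tc by simp
    thus ?thesis using v by (auto simp: D_def Lat_def)
  qed
qed

lemma stable_eq: "words.stable e = cls [(LM_t, e)]"
  unfolding words.stable_def using cls_inverse[of LM_t True] by (cases e) (simp_all add: t_def)

lemma class_act_stable: "nf.valid (snd x) \<Longrightarrow> nfa.class_act (words.stable e) x = nf.tau e x"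
  unfolding stable_eq cls_eq by (subst nfa.class_act_class) (simp_all add: act_nf_def del: nf.tau.simps)

lemma class_act_xi:
  "v \<in> carrier_vec n \<Longrightarrow> nf.valid (snd x) \<Longrightarrow> nfa.class_act (xi v) x = (fun_of v + fst x, snd x)"
  unfolding cls_eq by (subst nfa.class_act_class) (simp_all add: act_nf_x_word)

lemmas nf_act_mult = nfa.class_act_mult[folded G_eq]

text \<open>The invariant \<open>d \<in> P (\<not> a)\<close> drives the induction. If the next
  letter \<open>stable c\<close> is opposite to \<open>stable a\<close>, then \<open>d\<close> is in
  \<open>P c\<close>, so adding \<open>d\<close> does not affect the test that decides about
  cancellation: it is a test of \<open>h\<close> alone, and it fails for a reduced word.\<close>

lemma red_class_act:
  assumes "words.red m a b g"
  shows "\<exists>d r ls. nfa.class_act g (f, []) = (d, (a, r) # ls) \<and> d \<in> P (\<not> a) \<and> nf.valid ((a, r) # ls)"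
  using assms
proof (induction rule: words.red.induct)
  case (red_stable a)
  have "nfa.class_act (words.stable a) (f, []) = nf.tau a (f, [])" by (simp add: class_act_stable del: nf.tau.simps)
  then show ?case using nf.\<phi>_mem[OF nf.rep_mem] nf.valid_tau[of "[]" a f] by auto
next
  case (red_step m a b g h c)
  then obtain d r ls where IH: "nfa.class_act g (f, []) = (d, (a, r) # ls)" "d \<in> P (\<not> a)"
    "nf.valid ((a, r) # ls)" by blast
  obtain v where v: "v \<in> carrier_vec n" "h = xi v" using red_step by (auto simp: H_eq)
  have "nfa.class_act (words.stable c \<otimes>\<^bsub>G\<^esub> h \<otimes>\<^bsub>G\<^esub> g) (f, [])
    = nfa.class_act (words.stable c) (nfa.class_act h (nfa.class_act g (f, [])))"
    using red_step IH(3) by (simp add: nf_act_mult G.m_assoc)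
  also have "\<dots> = nf.tau c (fun_of v + d, (a, r) # ls)"
    using IH v by (simp add: class_act_xi class_act_stable del: nf.tau.simps)
  finally have eq: "nfa.class_act (words.stable c \<otimes>\<^bsub>G\<^esub> h \<otimes>\<^bsub>G\<^esub> g) (f, []) = nf.tau c (fun_of v + d, (a, r) # ls)" .
  have "\<not> (a = (\<not> c) \<and> fun_of v + d \<in> P c)"
  proof
    assume *: "a = (\<not> c) \<and> fun_of v + d \<in> P c"
    hence "fun_of v \<in> P c" using nf.P_add_iff[of d c "fun_of v"] IH(2) by (simp add: add.commute)
    hence "h \<in> D c" using v fun_of_P_iff by (auto simp: D_def)
    with red_step * show False by blast
  qed
  hence "nf.tau c (fun_of v + d, (a, r) # ls) = (phi c (fun_of v + d - nf.rep c (fun_of v + d)),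
      (c, nf.rep c (fun_of v + d)) # (a, r) # ls)" by simp
  then show ?case
    using eq nf.\<phi>_mem[OF nf.rep_mem, of c "fun_of v + d"] nf.valid_tau[OF IH(3), of c "fun_of v + d"] by auto
qed

text \<open>Elements of \<open>H\<close> leave the empty list of letters empty, whereas a reduced
  word produces a nonempty one.\<close>

lemma not_red_H: "words.red m a b g \<Longrightarrow> g \<notin> H"
proof
  assume r: "words.red m a b g" and "g \<in> H"
  then obtain v where v: "v \<in> carrier_vec n" "g = xi v" by (auto simp: H_eq)
  hence "nfa.class_act g (0, []) = (fun_of v + 0, [])" by (simp add: class_act_xi)
  thus False using red_class_act[OF r, of 0] by auto
qed

subsection \<open>The degree\<close>

definition act_deg :: "lm_gen \<times> bool \<Rightarrow> int \<Rightarrow> int" where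
  "act_deg l k = (case fst l of LM_x i \<Rightarrow> k | LM_t \<Rightarrow> k + (if snd l then 1 else - 1))"

lemma act_deg_x_word: "foldr act_deg (x_word v) k = k"
  using foldr_x_word[of v act_deg "\<lambda>_. k" "\<lambda>_. 0"] by (simp add: act_deg_def)

sublocale dga: word_action "lm_gens n" "lm_relations A L" UNIV act_deg
proof
  fix u v x assume "(u, v) \<in> lm_relations A L"
  then show "foldr act_deg u x = foldr act_deg v x"
  proof (cases rule: lm_relations_cases)
    case (comm i j)
    then show ?thesis by (simp add: act_deg_def)
  next
    case (stable a b)
    then show ?thesis by (simp add: act_deg_x_word) (simp add: act_deg_def)
  qed
qed (auto simp: act_deg_def split: lm_gen.split)

definition deg :: "lm_gen word set \<Rightarrow> int" where
  "deg g = dga.class_act g 0"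

lemma foldr_act_deg:
  "foldr act_deg w k = k + int (count_list w (LM_t, True)) - int (count_list w (LM_t, False))"
proof (induction w)
  case (Cons l w)
  obtain a e where l: "l = (a, e)" by (cases l)
  show ?case using Cons by (cases a; cases e) (simp_all add: l act_deg_def)
qed simp

lemma deg_cls: "w \<in> W \<Longrightarrow> deg (cls w) = int (count_list w (LM_t, True)) - int (count_list w (LM_t, False))"
  unfolding deg_def cls_eq by (subst dga.class_act_class) (simp_all add: foldr_act_deg)

lemma deg_mult:
  assumes "x \<in> carrier G" "y \<in> carrier G"
  shows "deg (x \<otimes>\<^bsub>G\<^esub> y) = deg x + deg y"
proof -
  obtain u v where "u \<in> W" "v \<in> W" "x = cls u" "y = cls v" using assms by (auto simp: carrier_G)
  thus ?thesis by (simp add: deg_cls flip: cls_append)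
qed

lemma deg_H: "x \<in> H \<Longrightarrow> deg x = 0"
proof -
  assume "x \<in> H"
  then obtain v where v: "v \<in> carrier_vec n" "x = xi v" by (auto simp: H_eq)
  have "dga.class_act (xi v) 0 = foldr act_deg (x_word v) 0"
    unfolding cls_eq by (rule dga.class_act_class) (use v in auto)
  thus ?thesis by (simp add: v deg_def act_deg_x_word)
qed

text \<open>The group acts on \<open>\<rat>\<^sup>n\<close> by affine maps, with \<open>LM_t\<close> acting as \<open>A\<close>; the linear part of an
  element of degree 0 is trivial.\<close>

definition act_aff :: "lm_gen \<times> bool \<Rightarrow> rat vec \<Rightarrow> rat vec" where
  "act_aff l q = (case fst l of
     LM_x i \<Rightarrow> q + (if snd l then 1 else - 1) \<cdot>\<^sub>v unit_vec n i
   | LM_t \<Rightarrow> Mat (snd l) *\<^sub>v q)"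

lemma act_aff_shift:
  assumes "q \<in> carrier_vec n" "i < n"
  shows "act_aff (LM_x i, e) (q + vec n (\<lambda>j. rat_of_int (f j)))
    = q + vec n (\<lambda>j. rat_of_int ((f(i := f i + (if e then 1 else - 1))) j))"
  using assms by (intro eq_vecI) (auto simp: act_aff_def)

lemma act_aff_x_word:
  assumes "v \<in> carrier_vec n" "q \<in> carrier_vec n"
  shows "foldr act_aff (x_word v) q = q + int_to_rat_vec v"
proof -
  let ?Y = "\<lambda>f. q + vec n (\<lambda>j. rat_of_int (f j))"
  have "foldr act_aff (x_word v) (?Y (\<lambda>_. 0)) = ?Y (\<lambda>i. 0 + (if i < dim_vec v then v $ i else 0))"
    by (rule foldr_x_word[where Y = ?Y]) (use assms act_aff_shift in auto)
  moreover have "?Y (\<lambda>_. 0) = q" using assms by (intro eq_vecI) auto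
  moreover have "?Y (\<lambda>i. 0 + (if i < dim_vec v then v $ i else 0)) = q + int_to_rat_vec v"
    using assms by (intro eq_vecI) auto
  ultimately show ?thesis by simp
qed

lemma act_aff_closed: "a \<in> lm_gens n \<Longrightarrow> x \<in> carrier_vec n \<Longrightarrow> act_aff (a, e) x \<in> carrier_vec n"
  by (auto simp: act_aff_def split: lm_gen.split)

sublocale afa: word_action "lm_gens n" "lm_relations A L" "carrier_vec n" act_aff
proof
  fix a e and x :: "rat vec" assume a: "a \<in> lm_gens n" and x: "x \<in> carrier_vec n"
  show "act_aff (a, e) x \<in> carrier_vec n" using a x by (rule act_aff_closed)
  show "act_aff (a, e) (act_aff (a, \<not> e) x) = x"
  proof (cases a)
    case (LM_x i)
    then show ?thesis using x by (intro eq_vecI) (auto simp: act_aff_def)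
  next
    case LM_t
    then show ?thesis using x by (simp add: act_aff_def)
  qed
next
  fix u v and x :: "rat vec" assume "(u, v) \<in> lm_relations A L" and x: "x \<in> carrier_vec n"
  then show "foldr act_aff u x = foldr act_aff v x"
  proof (cases rule: lm_relations_cases)
    case (comm i j)
    then show ?thesis using x by (intro eq_vecI) (auto simp: act_aff_def)
  next
    case (stable a b)
    have "foldr act_aff u x = Mat True *\<^sub>v (Mat False *\<^sub>v x + int_to_rat_vec a)"
      using stable x by (simp add: act_aff_def[of "(LM_t, _)"] act_aff_x_word)
    also have "\<dots> = Mat True *\<^sub>v (Mat False *\<^sub>v x) + Mat True *\<^sub>v int_to_rat_vec a"
      using stable x by (intro mult_add_distrib_mat_vec[OF Mat_carrier]) auto
    also have "\<dots> = x + int_to_rat_vec b"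
      using stable x Mat_cancel(1)[OF x, of True] by (simp add: Mat_def)
    finally show ?thesis using stable x by (simp add: act_aff_x_word)
  qed
qed

text \<open>The vector \<open>l\<close> is the linear part of \<open>w\<close> applied to
  \<open>v\<close>, that is, \<open>A\<close> raised to the degree of \<open>w\<close> and applied
  to \<open>v\<close>. Negative powers are moved to the other side of the equation, so that only
  \<open>A\<close> is iterated.\<close>

lemma act_aff_linear_part:
  assumes "w \<in> W" "q \<in> carrier_vec n" "v \<in> carrier_vec n"
  shows "\<exists>l\<in>carrier_vec n. foldr act_aff w (q + v) = foldr act_aff w q + l \<and>
    ((*\<^sub>v) A ^^ count_list w (LM_t, False)) l = ((*\<^sub>v) A ^^ count_list w (LM_t, True)) v"
  using assms
proof (induction w)
  case Nil
  then show ?case by auto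
next
  case (Cons l w)
  obtain a e where l: "l = (a, e)" by (cases l)
  have w: "w \<in> W" "a \<in> lm_gens n" using Cons.prems l by auto
  from Cons.IH[OF w(1) Cons.prems(2,3)] obtain k where k: "k \<in> carrier_vec n"
    "foldr act_aff w (q + v) = foldr act_aff w q + k"
    "((*\<^sub>v) A ^^ count_list w (LM_t, False)) k = ((*\<^sub>v) A ^^ count_list w (LM_t, True)) v" by blast
  have q': "foldr act_aff w q \<in> carrier_vec n" using afa.foldr_closed[OF w(1)] Cons.prems by simp
  show ?case
  proof (cases a)
    case (LM_x i)
    have "act_aff (LM_x i, e) (foldr act_aff w q + k) = act_aff (LM_x i, e) (foldr act_aff w q) + k"
      using q' k(1) by (intro eq_vecI) (auto simp: act_aff_def)
    then show ?thesis using k l LM_x by (intro bexI[of _ k]) auto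
  next
    case LM_t
    have lin: "act_aff l (foldr act_aff w q + k) = act_aff l (foldr act_aff w q) + Mat e *\<^sub>v k"
      using q' k(1) l LM_t by (simp add: act_aff_def mult_add_distrib_mat_vec[OF Mat_carrier])
    have "((*\<^sub>v) A ^^ count_list (l # w) (LM_t, False)) (Mat e *\<^sub>v k)
      = ((*\<^sub>v) A ^^ count_list (l # w) (LM_t, True)) v"
    proof (cases e)
      case True
      then show ?thesis using k(3) l LM_t by (simp add: Mat_def flip: funpow_swap1)
    next
      case False
      have "A *\<^sub>v (B *\<^sub>v k) = k" using Mat_cancel(1)[OF k(1), of True] by (simp add: Mat_def)
      then show ?thesis using False k(3) l LM_t by (simp add: Mat_def funpow_swap1)
    qed
    then show ?thesis using lin k by (intro bexI[of _ "Mat e *\<^sub>v k"]) auto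
  qed
qed

lemma funpow_A_inj:
  assumes "v \<in> carrier_vec n" "w \<in> carrier_vec n" "((*\<^sub>v) A ^^ m) v = ((*\<^sub>v) A ^^ m) w"
  shows "v = w"
  using assms
proof (induction m arbitrary: v w)
  case (Suc m)
  have "A *\<^sub>v v = A *\<^sub>v w"
    using Suc.IH[of "A *\<^sub>v v" "A *\<^sub>v w"] Suc.prems A by (simp add: funpow_swap1)
  thus ?case using Mat_cancel(2)[OF Suc.prems(1), of True] Mat_cancel(2)[OF Suc.prems(2), of True]
    by (simp add: Mat_def)
qed simp

text \<open>Evaluate both sides of \<open>conj g x \<otimes> g = g \<otimes> x\<close> at the
  origin. The left side translates the image of the origin under \<open>g\<close> by
  \<open>v'\<close>, the right side translates it by the linear part of \<open>g\<close> applied to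
  \<open>v\<close>; in degree 0 that linear part is the identity.\<close>

lemma deg_zero_conj:
  assumes "g \<in> carrier G" "deg g = 0" "x \<in> H" "G.conj g x \<in> H"
  shows "G.conj g x = x"
proof -
  obtain w where w: "w \<in> W" "g = cls w" using assms(1) by (auto simp: carrier_G)
  obtain v where v: "v \<in> carrier_vec n" "x = xi v" using assms(3) by (auto simp: H_eq)
  obtain v' where v': "v' \<in> carrier_vec n" "G.conj g x = xi v'" using assms(4) by (auto simp: H_eq)
  have "G.conj g x \<otimes>\<^bsub>G\<^esub> g = g \<otimes>\<^bsub>G\<^esub> x" using assms by (simp add: G.conj_def G.m_assoc)
  hence "cls (x_word v' @ w) = cls (w @ x_word v)" using w v v' by (simp add: cls_append)
  hence "(x_word v' @ w, w @ x_word v) \<in> pres_rel (lm_gens n) (lm_relations A L)"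
    using w v v' by (simp add: cls_eq pres_class_eq_iff)
  from afa.pres_rel_foldr[OF this, of "0\<^sub>v n"]
  have eq: "foldr act_aff w (0\<^sub>v n) + int_to_rat_vec v' = foldr act_aff w (0\<^sub>v n + int_to_rat_vec v)"
    using w v v' afa.foldr_closed[OF w(1), of "0\<^sub>v n"] by (simp add: act_aff_x_word)
  obtain l where l: "l \<in> carrier_vec n"
    "foldr act_aff w (0\<^sub>v n + int_to_rat_vec v) = foldr act_aff w (0\<^sub>v n) + l"
    "((*\<^sub>v) A ^^ count_list w (LM_t, False)) l = ((*\<^sub>v) A ^^ count_list w (LM_t, True)) (int_to_rat_vec v)"
    using act_aff_linear_part[OF w(1), of "0\<^sub>v n" "int_to_rat_vec v"] v by auto
  have z: "foldr act_aff w (0\<^sub>v n) \<in> carrier_vec n" using afa.foldr_closed[OF w(1)] by simp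
  have "int_to_rat_vec v' = l"
  proof (rule eq_vecI)
    fix i assume "i < dim_vec l"
    hence i: "i < n" using l by simp
    have "(foldr act_aff w (0\<^sub>v n) + int_to_rat_vec v') $ i = (foldr act_aff w (0\<^sub>v n) + l) $ i"
      using eq l(2) by simp
    thus "int_to_rat_vec v' $ i = l $ i" using i z l(1) v' by simp
  qed (use l v' in simp)
  moreover have "count_list w (LM_t, False) = count_list w (LM_t, True)"
    using assms(2) w by (simp add: deg_cls)
  ultimately have "int_to_rat_vec v' = int_to_rat_vec v"
    using funpow_A_inj l v by simp
  thus ?thesis using v v' int_to_rat_vec_inj by metis
qed

subsection \<open>The universal property\<close>

text \<open>The letters act on \<open>K\<close> by left multiplication with their intended images.
  Once the relators are checked, \<open>F g\<close> is the image of the unit under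
  \<open>g\<close>.\<close>

lemma universal:
  assumes "group K" "\<phi> \<in> hom (G\<lparr>carrier := H\<rparr>) K" "s \<in> carrier K"
    and st: "\<And>v. v \<in> D True \<Longrightarrow> group.conj K s (\<phi> v) = \<phi> (G.conj t v)"
  shows "\<exists>F\<in>hom G (K::lm_gen word set monoid). (\<forall>v\<in>H. F v = \<phi> v) \<and> F t = s"
proof -
  interpret K: group K by (rule assms(1))
  have HG: "group (G\<lparr>carrier := H\<rparr>)" using H_subgroup G.group_axioms subgroup.subgroup_is_group by blast
  interpret \<phi>: group_hom "G\<lparr>carrier := H\<rparr>" K \<phi>
    using assms HG by (simp add: group_hom_def group_hom_axioms_def)
  have \<phi>_closed: "\<phi> x \<in> carrier K" if "x \<in> H" for x using \<phi>.hom_closed that by simp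
  have \<phi>_mult: "\<phi> (x \<otimes>\<^bsub>G\<^esub> y) = \<phi> x \<otimes>\<^bsub>K\<^esub> \<phi> y" if "x \<in> H" "y \<in> H" for x y
    using \<phi>.hom_mult that by simp
  have \<phi>_one: "\<phi> \<one>\<^bsub>G\<^esub> = \<one>\<^bsub>K\<^esub>" using \<phi>.hom_one by simp
  define f where "f a = (case a of LM_x i \<Rightarrow> \<phi> (gen_x i) | LM_t \<Rightarrow> s)" for a
  define ev where "ev l = (if snd l then f (fst l) else inv\<^bsub>K\<^esub> f (fst l))" for l
  define act where "act l x = ev l \<otimes>\<^bsub>K\<^esub> x" for l x
  have f: "f a \<in> carrier K" if "a \<in> lm_gens n" for a
    using that \<phi>_closed gen_x_H assms(3) by (cases a) (auto simp: f_def)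
  have evc: "ev (a, e) \<in> carrier K" if "a \<in> lm_gens n" for a e
    using f[OF that] by (simp add: ev_def)
  have evx: "ev (LM_x i, e) = \<phi> (cls [(LM_x i, e)]) \<and> cls [(LM_x i, e)] \<in> H" if "i < n" for i e
  proof (cases e)
    case True
    then show ?thesis using gen_x_H[OF that] by (simp add: ev_def f_def gen_x_def)
  next
    case False
    have "cls [(LM_x i, False)] = inv\<^bsub>G\<^esub> gen_x i" using that cls_inverse[of "LM_x i" True] by (simp add: gen_x_def)
    moreover have "\<phi> (inv\<^bsub>G\<^esub> gen_x i) = inv\<^bsub>K\<^esub> \<phi> (gen_x i)"
      using \<phi>.hom_inv[of "gen_x i"] gen_x_H[OF that] G.m_inv_consistent[OF H_subgroup] by simp
    ultimately show ?thesis using False gen_x_H[OF that] by (simp add: ev_def f_def)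
  qed
  \<comment> \<open>Words without \<open>LM_t\<close> are evaluated through \<open>\<phi>\<close>.
    Both sides of a commutator relator are such words with equal classes, which settles these
    relators; only those containing \<open>LM_t\<close> use \<open>st\<close>.\<close>
  have xs: "foldr act w x = \<phi> (cls w) \<otimes>\<^bsub>K\<^esub> x \<and> cls w \<in> H"
    if "fst ` set w \<subseteq> range LM_x" "w \<in> W" "x \<in> carrier K" for w x
    using that(1,2)
  proof (induction w)
    case Nil
    then show ?case using that(3) subgroup.one_closed[OF H_subgroup] by (simp add: cls_Nil \<phi>_one)
  next
    case (Cons l w)
    then obtain i e where l: "l = (LM_x i, e)" by (cases l) auto
    have i: "i < n" and w: "w \<in> W" using Cons.prems l by auto
    have "cls (l # w) = cls [l] \<otimes>\<^bsub>G\<^esub> cls w" using cls_Cons[of "LM_x i" e w] Cons.prems l by simp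
    then show ?case using Cons evx[OF i] l w \<phi>_closed that(3)
      by (simp add: act_def \<phi>_mult K.m_assoc)
  qed
  have x_set: "fst ` set (x_word v) \<subseteq> range LM_x" for v
    by (auto simp: x_word_def)
  interpret act: word_action "lm_gens n" "lm_relations A L" "carrier K" act
  proof
    fix a e x assume a: "a \<in> lm_gens n" and x: "x \<in> carrier K"
    show "act (a, e) x \<in> carrier K" using evc[OF a] x by (simp add: act_def)
    show "act (a, e) (act (a, \<not> e) x) = x" using f[OF a] x by (simp add: act_def ev_def)
  next
    fix u v x assume rel: "(u, v) \<in> lm_relations A L" and uv: "u \<in> W" "v \<in> W" and x: "x \<in> carrier K"
    from rel show "foldr act u x = foldr act v x"
    proof (cases rule: lm_relations_cases)
      case (comm i j)
      have "cls u = cls v" by (rule cls_relator[OF rel uv])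
      moreover have "fst ` set u \<subseteq> range LM_x" "fst ` set v \<subseteq> range LM_x"
        using comm by auto
      ultimately show ?thesis using xs[of u x] xs[of v x] uv x by simp
    next
      case (stable a b)
      have a: "xi a \<in> D True" using stable by (auto simp: D_def Lat_def)
      have "foldr act u x = s \<otimes>\<^bsub>K\<^esub> (\<phi> (xi a) \<otimes>\<^bsub>K\<^esub> (inv\<^bsub>K\<^esub> s \<otimes>\<^bsub>K\<^esub> x))"
        using stable xs[OF x_set, of a "inv\<^bsub>K\<^esub> s \<otimes>\<^bsub>K\<^esub> x"] x assms(3)
        by (simp add: act_def[of "(LM_t, _)"] ev_def f_def)
      also have "\<dots> = K.conj s (\<phi> (xi a)) \<otimes>\<^bsub>K\<^esub> x"
        using x assms(3) \<phi>_closed words.D_H[OF a] by (simp add: K.conj_def K.m_assoc)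
      also have "\<dots> = \<phi> (xi b) \<otimes>\<^bsub>K\<^esub> x"
        using st[OF a] conj_t_xi[OF stable(1)] L_edge_map stable by simp
      finally show ?thesis using xs[OF x_set, of b x] stable x by simp
    qed
  qed
  define F where "F g = act.class_act g \<one>\<^bsub>K\<^esub>" for g
  have Fcls: "F (cls w) = foldr act w \<one>\<^bsub>K\<^esub>" if "w \<in> W" for w
    unfolding F_def cls_eq by (rule act.class_act_class) (use that in auto)
  have act_right: "foldr act w x = foldr act w \<one>\<^bsub>K\<^esub> \<otimes>\<^bsub>K\<^esub> x" if "w \<in> W" "x \<in> carrier K" for w x
    using that(1)
  proof (induction w)
    case Nil
    then show ?case using that by simp
  next
    case (Cons l w)
    obtain a e where l: "l = (a, e)" by (cases l)
    have "foldr act w \<one>\<^bsub>K\<^esub> \<in> carrier K" using Cons.prems l by (intro act.foldr_closed) auto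
    then show ?case using Cons l evc[of a e] that(2) by (simp add: act_def[of l] act_def[of "(a, e)"] K.m_assoc)
  qed
  have "F \<in> hom G K"
  proof (rule homI)
    show "F g \<in> carrier K" if "g \<in> carrier G" for g
      using that Fcls act.foldr_closed by (auto simp: carrier_G)
    show "F (g \<otimes>\<^bsub>G\<^esub> h) = F g \<otimes>\<^bsub>K\<^esub> F h" if gh: "g \<in> carrier G" "h \<in> carrier G" for g h
    proof -
      obtain u v where uv: "u \<in> W" "v \<in> W" "g = cls u" "h = cls v" using gh by (auto simp: carrier_G)
      have "foldr act v \<one>\<^bsub>K\<^esub> \<in> carrier K" using uv act.foldr_closed by simp
      thus ?thesis using uv act_right[OF uv(1), of "foldr act v \<one>\<^bsub>K\<^esub>"]
        by (simp add: Fcls flip: cls_append)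
    qed
  qed
  moreover have "F v = \<phi> v" if v: "v \<in> H" for v
  proof -
    obtain a where a: "a \<in> carrier_vec n" "v = xi a" using v by (auto simp: H_eq)
    thus ?thesis using Fcls[of "x_word a"] xs[OF x_set, of a "\<one>\<^bsub>K\<^esub>"] \<phi>_closed v by simp
  qed
  moreover have "F t = s"
    using Fcls[of "[(LM_t, True)]"] assms(3) by (simp add: t_def act_def ev_def f_def)
  ultimately show ?thesis by blast
qed

lemma D_power:
  assumes "x \<in> H"
  shows "\<exists>j>0. x [^]\<^bsub>G\<^esub> (j::nat) \<in> D e"
proof -
  obtain v where v: "v \<in> carrier_vec n" "x = xi v" using assms by (auto simp: H_eq)
  interpret xi: group_hom "monoid_vec TYPE(int) n" G xi by (rule xi_hom)
  obtain j where j: "j > 0" "of_nat j \<cdot>\<^sub>v v \<in> Lat e" using Lat_multiple[OF v(1)] by blast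
  have "v [^]\<^bsub>monoid_vec TYPE(int) n\<^esub> k = of_nat k \<cdot>\<^sub>v v" for k :: nat
  proof (induction k)
    case 0
    then show ?case using v(1) by (auto simp: monoid_vec_def)
  next
    case (Suc k)
    have "of_nat (Suc k) \<cdot>\<^sub>v v = of_nat k \<cdot>\<^sub>v v + v" by (intro eq_vecI) (auto simp: algebra_simps)
    then show ?case using Suc by (simp add: monoid_vec_def)
  qed
  hence "x [^]\<^bsub>G\<^esub> j = xi (of_nat j \<cdot>\<^sub>v v)"
    using xi.hom_nat_pow[of v j] v by (simp add: monoid_vec_def)
  thus ?thesis using j by (auto simp: D_def)
qed

section \<open>Leary-Minasyan groups as instances of \<open>hnn\<close>, and the main result\<close>

sublocale hnn G H D t deg
proof
  show "deg t = 1" by (simp add: t_def deg_cls)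
  show "\<exists>S. finite S \<and> H = generate G S" using H_def by blast
qed (use not_red_H deg_mult deg_H deg_zero_conj D_power universal in auto)

lemma LM_tree_eq: "LM_tree A L = coset_tree G H (D True) t"
  by (simp add: LM_tree_def coset_tree_def Let_def t_def D_def Lat_def LM_L_def)

text \<open>Only the first group is assumed not to be metabelian, while edge groups must be proper
  in both. Passing through an isomorphism covers the second group, and the identity covers the
  first.\<close>

lemma metabelian_of_iso:
  assumes "group G'" "f \<in> iso G' G" "D e = H"
  shows "metabelian G'"
proof -
  interpret f: group_hom G' G f by (rule iso_group_hom[OF assms(2,1) G.group_axioms])
  have inj: "inj_on f (carrier G')" using assms(2) by (simp add: iso_def bij_betw_def)
  show ?thesis
  proof (rule group.metabelian_of_degree[OF assms(1), of "\<lambda>x. deg (f x)"])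
    show "x \<otimes>\<^bsub>G'\<^esub> y = y \<otimes>\<^bsub>G'\<^esub> x"
      if "x \<in> carrier G'" "y \<in> carrier G'" "deg (f x) = 0" "deg (f y) = 0" for x y
      using that degree_kernel_commute[OF assms(3), of "f x" "f y"] inj_onD[OF inj]
      by (simp flip: f.hom_mult)
  qed (simp add: deg_mult)
qed

end

theorem corollary1p2:
  fixes n n' :: nat and A A' :: "rat mat" and L L' :: "int vec set"
  assumes "A \<in> carrier_mat n n" and "invertible_mat A"
    and "A' \<in> carrier_mat n' n'" and "invertible_mat A'"
    and "finite_index_subgroup L (lm_lattice A)"
    and "finite_index_subgroup L' (lm_lattice A')"
    and "\<not> metabelian (LM_group A L)"
    and "LM_group A L \<cong> LM_group A' L'"
  shows "\<exists>\<Phi> \<xi>\<^sub>V \<xi>\<^sub>E.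
    \<Phi> \<in> iso (LM_group A L) (LM_group A' L') \<and>
    graph_iso (LM_tree A L) (LM_tree A' L') \<xi>\<^sub>V \<xi>\<^sub>E \<and>
    (\<forall>g\<in>carrier (LM_group A L). \<forall>v\<in>verts (LM_tree A L).
      \<Phi> g <#\<^bsub>LM_group A' L'\<^esub> \<xi>\<^sub>V v = \<xi>\<^sub>V (g <#\<^bsub>LM_group A L\<^esub> v)) \<and>
    (\<forall>g\<in>carrier (LM_group A L). \<forall>e\<in>edges (LM_tree A L).
      \<Phi> g <#\<^bsub>LM_group A' L'\<^esub> \<xi>\<^sub>E e = \<xi>\<^sub>E (g <#\<^bsub>LM_group A L\<^esub> e))"
proof -
  have inv: "\<exists>B\<in>carrier_mat n n. A * B = 1\<^sub>m n \<and> B * A = 1\<^sub>m n"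
    if A: "A \<in> carrier_mat n n" and inv: "invertible_mat A" for A :: "rat mat" and n
  proof -
    obtain B where B: "A * B = 1\<^sub>m (dim_row A)" "B * A = 1\<^sub>m (dim_row B)"
      using inv by (auto simp: invertible_mat_def inverts_mat_def)
    \<comment> \<open>The shape of the inverse is read off from the dimensions of the two
      products.\<close>
    have "dim_col B = n" using B(1) A by (metis carrier_matD(1) index_mult_mat(3) index_one_mat(3))
    moreover have "dim_row B = n" using B(2) A by (metis carrier_matD(2) index_mult_mat(3) index_one_mat(3))
    ultimately show ?thesis using B A by (intro bexI[of _ B]) auto
  qed
  obtain B where "leary_minasyan n A B L"
    using inv[OF assms(1,2)] assms(1,5) by (auto simp: leary_minasyan_def)
  then interpret X: leary_minasyan n A B L .
  obtain B' where "leary_minasyan n' A' B' L'"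
    using inv[OF assms(3,4)] assms(3,6) by (auto simp: leary_minasyan_def)
  then interpret Y: leary_minasyan n' A' B' L' .
  obtain f where f: "f \<in> iso (LM_group A L) (LM_group A' L')" using assms(8) by (auto simp: is_iso_def)
  have id: "(\<lambda>x. x) \<in> iso (LM_group A L) (LM_group A L)" by (simp add: iso_def hom_def bij_betw_def inj_on_def)
  have 1: "X.D e \<noteq> X.H" for e
    using X.metabelian_of_iso[OF X.G.group_axioms id] assms(7) by blast
  have 2: "Y.D e \<noteq> Y.H" for e
    using Y.metabelian_of_iso[OF X.G.group_axioms f] assms(7) by blast
  show ?thesis
    using hnn_iso_coset_tree[OF X.hnn_axioms Y.hnn_axioms 1 2 f]
    unfolding X.LM_tree_eq Y.LM_tree_eq .
qed

end
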